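(* Let $p$ be any prime number. Then $$\mathrm{hspec}_{2}^{\mathcal S}(W_p)=[0,1].$$
   Context: $T_p$ is the infinite rooted tree in which every vertex has exactly $p$ immediate descendants, with vertices identified with finite words over $\{1,\dots,p\}$. $\mathrm{Aut}\,T_p$ is its group of root-fixing automorphisms, with the topology given by the level stabilizers $\mathrm{St}(n)$ (pointwise stabilizers of the set of words of length $n$). The label of $g$ at a vertex $v$ is the permutation $g|_v^1\in\mathrm{Sym}(p)$ with $(vx)g=(v)g\,(x)g|_v^1$ for every letter $x$. With $\sigma=(1\,2\,\cdots\,p)\in\mathrm{Sym}(p)$, the group of $p$-adic automorphisms is $W_p=\{g\in\mathrm{Aut}\,T_p\mid g|_v^1\in\langle\sigma\rangle\text{ for every vertex }v\}$. For a closed subgroup $L\le W_p$, $$\mathrm{hdim}^{\mathcal S}_{W_p}(L)=\liminf_{n\to\infty}\frac{\log|L:L\cap\mathrm{St}(n)|}{\log|W_p:W_p\cap\mathrm{St}(n)|},$$ and $\mathrm{hspec}_2^{\mathcal S}(W_p)$ is the set of values of $\mathrm{hdim}^{\mathcal S}_{W_p}(L)$ over closed subgroups $L\le W_p$ topologically generated by at most $2$ elements. *)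

theory Defs
  imports
    "HOL-Analysis.Analysis"
    "HOL-Algebra.Algebra"
begin

section \<open>The rooted tree and its automorphism group\<close>

definition words :: "nat \<Rightarrow> nat list set" where
  "words p = lists {1..p}"

definition tree_adj :: "nat list \<Rightarrow> nat list \<Rightarrow> bool" where
  "tree_adj v w \<longleftrightarrow> (\<exists>x. w = v @ [x] \<or> v = w @ [x])"

text \<open>
  Automorphisms are functions that are \<open>undefined\<close> off the vertex set, so that
  equality of functions is equality of automorphisms. They act on the right:
  the product of \<open>g\<close> and \<open>h\<close> is first \<open>g\<close>, then \<open>h\<close>.
\<close>

definition Aut_tree :: "nat \<Rightarrow> (nat list \<Rightarrow> nat list) monoid" where
  "Aut_tree p =
    \<lparr>carrier = {g \<in> Bij (words p). g [] = [] \<and>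
       (\<forall>v\<in>words p. \<forall>w\<in>words p. tree_adj (g v) (g w) \<longleftrightarrow> tree_adj v w)},
     mult = \<lambda>g h. compose (words p) h g,
     one = \<lambda>v\<in>words p. v\<rparr>"

lemma Aut_treeD:
  assumes "g \<in> carrier (Aut_tree p)"
  shows "bij_betw g (words p) (words p)" "g \<in> extensional (words p)" "g [] = []"
    "\<And>v w. v \<in> words p \<Longrightarrow> w \<in> words p \<Longrightarrow> tree_adj (g v) (g w) \<longleftrightarrow> tree_adj v w"
    "\<And>v. v \<in> words p \<Longrightarrow> g v \<in> words p"
  using assms by (auto simp: Aut_tree_def Bij_def bij_betw_def)

lemma Nil_in_words [simp]: "[] \<in> words p"
  by (simp add: words_def)

lemma snoc_in_words [simp]: "v @ [x] \<in> words p \<longleftrightarrow> v \<in> words p \<and> x \<in> {1..p}"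
  by (auto simp: words_def)

lemma group_Aut_tree: "group (Aut_tree p)"
proof (rule groupI)
  fix g h assume gh: "g \<in> carrier (Aut_tree p)" "h \<in> carrier (Aut_tree p)"
  then have "compose (words p) h g \<in> Bij (words p)"
    by (intro compose_Bij) (auto simp: Aut_tree_def)
  with gh show "g \<otimes>\<^bsub>Aut_tree p\<^esub> h \<in> carrier (Aut_tree p)"
    using Aut_treeD[OF gh(1)] Aut_treeD[OF gh(2)]
    by (auto simp: Aut_tree_def compose_def)
next
  show "\<one>\<^bsub>Aut_tree p\<^esub> \<in> carrier (Aut_tree p)"
    by (simp add: Aut_tree_def id_Bij)
next
  fix f g h assume "f \<in> carrier (Aut_tree p)" "g \<in> carrier (Aut_tree p)" "h \<in> carrier (Aut_tree p)"
  then show "f \<otimes>\<^bsub>Aut_tree p\<^esub> g \<otimes>\<^bsub>Aut_tree p\<^esub> h = f \<otimes>\<^bsub>Aut_tree p\<^esub> (g \<otimes>\<^bsub>Aut_tree p\<^esub> h)"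
    using Aut_treeD(5) by (auto simp: Aut_tree_def compose_def fun_eq_iff)
next
  fix g assume "g \<in> carrier (Aut_tree p)"
  then show "\<one>\<^bsub>Aut_tree p\<^esub> \<otimes>\<^bsub>Aut_tree p\<^esub> g = g"
    by (auto simp: Aut_tree_def Bij_def compose_def extensional_def fun_eq_iff)
next
  fix g assume g: "g \<in> carrier (Aut_tree p)"
  define h where "h = restrict (inv_into (words p) g) (words p)"
  note D = Aut_treeD[OF g]
  have hw: "h v \<in> words p" and gh: "g (h v) = v" if "v \<in> words p" for v
    using that D(1) unfolding h_def
    by (auto simp: bij_betw_def f_inv_into_f inv_into_into)
  have hg: "h (g v) = v" if "v \<in> words p" for v
    using that D unfolding h_def by (simp add: bij_betw_def inv_into_f_f)
  have "h \<in> Bij (words p)"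
    unfolding h_def using g by (intro restrict_inv_into_Bij) (simp add: Aut_tree_def)
  moreover have "h [] = []"
    using hg[of "[]"] D(3) by simp
  moreover have "tree_adj (h v) (h w) \<longleftrightarrow> tree_adj v w" if "v \<in> words p" "w \<in> words p" for v w
    using D(4)[OF hw[OF that(1)] hw[OF that(2)]] gh that by simp
  ultimately have "h \<in> carrier (Aut_tree p)"
    by (simp add: Aut_tree_def)
  moreover have "h \<otimes>\<^bsub>Aut_tree p\<^esub> g = \<one>\<^bsub>Aut_tree p\<^esub>"
    using gh by (auto simp: Aut_tree_def compose_def fun_eq_iff)
  ultimately show "\<exists>h\<in>carrier (Aut_tree p). h \<otimes>\<^bsub>Aut_tree p\<^esub> g = \<one>\<^bsub>Aut_tree p\<^esub>"
    by blast
qed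

definition level_stab :: "nat \<Rightarrow> nat \<Rightarrow> (nat list \<Rightarrow> nat list) set" where
  "level_stab p n =
    {g \<in> carrier (Aut_tree p). \<forall>v\<in>words p. length v = n \<longrightarrow> g v = v}"

definition Aut_tree_topology :: "nat \<Rightarrow> (nat list \<Rightarrow> nat list) topology" where
  "Aut_tree_topology p = topology_generated_by
     {g <#\<^bsub>Aut_tree p\<^esub> level_stab p n | g n. g \<in> carrier (Aut_tree p)}"

definition label :: "nat \<Rightarrow> (nat list \<Rightarrow> nat list) \<Rightarrow> nat list \<Rightarrow> nat \<Rightarrow> nat" where
  "label p g v =
    (THE \<pi>. \<pi> \<in> carrier (sym_group p) \<and> (\<forall>x\<in>{1..p}. g (v @ [x]) = g v @ [\<pi> x]))"

lemma Aut_tree_snoc: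
  assumes g: "g \<in> carrier (Aut_tree p)" and v: "v \<in> words p" and x: "x \<in> {1..p}"
  shows "\<exists>y\<in>{1..p}. g (v @ [x]) = g v @ [y]"
  using v x
proof (induction v arbitrary: x rule: rev_induct)
  case Nil
  then have "tree_adj (g []) (g [x])" "g [x] \<in> words p"
    using Aut_treeD(4)[OF g, of "[]" "[x]"] Aut_treeD(5)[OF g, of "[x]"] snoc_in_words[of "[]" x p]
    by (auto simp: tree_adj_def)
  then show ?case
    using Aut_treeD(3)[OF g] by (auto simp: tree_adj_def words_def)
next
  case (snoc z v)
  let ?w = "v @ [z]"
  have w: "?w @ [x] \<in> words p" "?w \<in> words p" "v \<in> words p"
    using snoc.prems by (auto simp flip: append_assoc)
  obtain y where y: "g ?w = g v @ [y]"
    using snoc.IH[of z] snoc.prems by auto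
  have "tree_adj (g ?w) (g (?w @ [x]))"
    using Aut_treeD(4)[OF g w(2,1)] by (auto simp: tree_adj_def)
  moreover have "g (?w @ [x]) \<noteq> g v"
    using Aut_treeD(1)[OF g] w by (auto simp: bij_betw_def inj_on_def)
  ultimately obtain u where "g (?w @ [x]) = g ?w @ [u]"
    using y by (auto simp: tree_adj_def)
  moreover have "g (?w @ [x]) \<in> words p"
    using Aut_treeD(5)[OF g w(1)] .
  ultimately show ?case
    by (metis snoc_in_words)
qed

lemma label_ex1:
  assumes g: "g \<in> carrier (Aut_tree p)" and v: "v \<in> words p"
  shows "\<exists>!\<pi>. \<pi> \<in> carrier (sym_group p) \<and> (\<forall>x\<in>{1..p}. g (v @ [x]) = g v @ [\<pi> x])"
proof -
  obtain f where f: "\<And>x. x \<in> {1..p} \<Longrightarrow> f x \<in> {1..p} \<and> g (v @ [x]) = g v @ [f x]"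
    using Aut_tree_snoc[OF g v] by metis
  define \<pi> where "\<pi> x = (if x \<in> {1..p} then f x else x)" for x
  have "inj_on f {1..p}"
  proof (rule inj_onI)
    fix x y assume xy: "x \<in> {1..p}" "y \<in> {1..p}" "f x = f y"
    then have "g (v @ [x]) = g (v @ [y])"
      using f by simp
    then show "x = y"
      using Aut_treeD(1)[OF g] v xy(1,2) inj_on_eq_iff[of g "words p" "v @ [x]" "v @ [y]"]
      by (simp add: bij_betw_def)
  qed
  moreover have "f ` {1..p} \<subseteq> {1..p}"
    using f by blast
  ultimately have "bij_betw f {1..p} {1..p}"
    by (simp add: bij_betw_def endo_inj_surj)
  then have "bij_betw \<pi> {1..p} {1..p}"
    by (rule bij_betw_cong[THEN iffD1, rotated]) (simp add: \<pi>_def)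
  then have "\<pi> permutes {1..p}"
    by (rule bij_imp_permutes) (auto simp: \<pi>_def)
  then have *: "\<pi> \<in> carrier (sym_group p) \<and> (\<forall>x\<in>{1..p}. g (v @ [x]) = g v @ [\<pi> x])"
    using f by (simp add: sym_group_carrier \<pi>_def)
  show ?thesis
  proof (rule ex1I)
    show "\<pi> \<in> carrier (sym_group p) \<and> (\<forall>x\<in>{1..p}. g (v @ [x]) = g v @ [\<pi> x])"
      by (rule *)
  next
    fix \<rho> assume \<rho>: "\<rho> \<in> carrier (sym_group p) \<and> (\<forall>x\<in>{1..p}. g (v @ [x]) = g v @ [\<rho> x])"
    show "\<rho> = \<pi>"
    proof
      fix x show "\<rho> x = \<pi> x"
      proof (cases "x \<in> {1..p}")
        case True
        with \<rho> * have "g v @ [\<rho> x] = g v @ [\<pi> x]" by metis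
        then show ?thesis by simp
      next
        case False
        then show ?thesis
          using \<rho> by (auto simp: sym_group_carrier \<pi>_def permutes_def)
      qed
    qed
  qed
qed

lemma label_props:
  assumes "g \<in> carrier (Aut_tree p)" "v \<in> words p"
  shows "label p g v \<in> carrier (sym_group p)"
    "x \<in> {1..p} \<Longrightarrow> g (v @ [x]) = g v @ [label p g v x]"
  using theI'[OF label_ex1[OF assms]] unfolding label_def by blast+

lemma label_eqI:
  assumes "g \<in> carrier (Aut_tree p)" "v \<in> words p"
    "\<pi> \<in> carrier (sym_group p)" "\<And>x. x \<in> {1..p} \<Longrightarrow> g (v @ [x]) = g v @ [\<pi> x]"
  shows "label p g v = \<pi>"
  unfolding label_def using assms by (intro the1_equality[OF label_ex1]) auto

section \<open>The group of p-adic automorphisms\<close>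

definition W :: "nat \<Rightarrow> (nat list \<Rightarrow> nat list) monoid" where
  "W p = (Aut_tree p)
    \<lparr>carrier := {g \<in> carrier (Aut_tree p). \<forall>v\<in>words p.
       label p g v \<in> generate (sym_group p) {cycle_of_list [1..<Suc p]}}\<rparr>"

lemma subgroup_W: "subgroup (carrier (W p)) (Aut_tree p)"
proof -
  interpret A: group "Aut_tree p" by (rule group_Aut_tree)
  interpret S: group "sym_group p" by (rule sym_group_is_group)
  let ?C = "generate (sym_group p) {cycle_of_list [1..<Suc p]}"
  have "cycle_of_list [1..<Suc p] permutes set [1..<Suc p]"
    by (rule cycle_permutes)
  then have "{cycle_of_list [1..<Suc p]} \<subseteq> carrier (sym_group p)"
    by (simp add: sym_group_carrier atLeastLessThanSuc_atLeastAtMost del: upt_Suc)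
  then interpret C: subgroup ?C "sym_group p"
    by (rule S.generate_is_subgroup)
  have mult: "(g \<otimes>\<^bsub>Aut_tree p\<^esub> h) v = h (g v)" if "v \<in> words p" for g h v
    using that by (simp add: Aut_tree_def compose_def)
  have label_mult: "label p (g \<otimes>\<^bsub>Aut_tree p\<^esub> h) v = label p h (g v) \<circ> label p g v"
    if "g \<in> carrier (Aut_tree p)" "h \<in> carrier (Aut_tree p)" "v \<in> words p" for g h v
  proof (rule label_eqI)
    note gv = Aut_treeD(5)[OF that(1,3)]
    show "g \<otimes>\<^bsub>Aut_tree p\<^esub> h \<in> carrier (Aut_tree p)" using that by simp
    show "label p h (g v) \<circ> label p g v \<in> carrier (sym_group p)"
      using label_props(1)[OF that(1,3)] label_props(1)[OF that(2) gv]
      by (simp add: sym_group_carrier permutes_compose)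
    fix x assume x: "x \<in> {1..p}"
    then have "label p g v x \<in> {1..p}"
      using label_props(1)[OF that(1,3)] permutes_in_image by (fastforce simp: sym_group_carrier)
    with x show "(g \<otimes>\<^bsub>Aut_tree p\<^esub> h) (v @ [x]) =
        (g \<otimes>\<^bsub>Aut_tree p\<^esub> h) v @ [(label p h (g v) \<circ> label p g v) x]"
      using that x label_props(2)[OF that(1,3)] label_props(2)[OF that(2) gv]
      by (simp add: mult)
  qed (fact that)
  have label_one: "label p \<one>\<^bsub>Aut_tree p\<^esub> v = id" if "v \<in> words p" for v
    using that by (intro label_eqI) (auto simp: sym_group_carrier permutes_id Aut_tree_def id_Bij)
  show ?thesis
  proof (rule A.subgroupI)
    show "carrier (W p) \<subseteq> carrier (Aut_tree p)" by (auto simp: W_def)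
    have "\<one>\<^bsub>Aut_tree p\<^esub> \<in> carrier (W p)"
      using C.one_closed by (simp add: W_def label_one sym_group_one)
    then show "carrier (W p) \<noteq> {}" by blast
  next
    fix g h assume "g \<in> carrier (W p)" "h \<in> carrier (W p)"
    then show "g \<otimes>\<^bsub>Aut_tree p\<^esub> h \<in> carrier (W p)"
      using C.m_closed Aut_treeD(5) by (auto simp: W_def label_mult sym_group_mult)
  next
    fix g assume g: "g \<in> carrier (W p)"
    let ?h = "inv\<^bsub>Aut_tree p\<^esub> g"
    have gA: "g \<in> carrier (Aut_tree p)" and hA: "?h \<in> carrier (Aut_tree p)"
      using g by (auto simp: W_def)
    have "label p ?h v \<in> ?C" if v: "v \<in> words p" for v
    proof -
      note hv = Aut_treeD(5)[OF hA v]
      have "label p g (?h v) \<circ> label p ?h v = id"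
        using label_mult[OF hA gA v] label_one[OF v] gA by simp
      then have eq: "label p g (?h v) \<otimes>\<^bsub>sym_group p\<^esub> label p ?h v = \<one>\<^bsub>sym_group p\<^esub>"
        by (simp add: sym_group_mult sym_group_one)
      have gC: "label p g (?h v) \<in> ?C" using g hv by (simp add: W_def)
      have "label p ?h v = inv\<^bsub>sym_group p\<^esub> (label p g (?h v))"
        using eq label_props(1)[OF gA hv] label_props(1)[OF hA v]
        by (metis S.inv_equality S.inv_inv)
      then show ?thesis using C.m_inv_closed[OF gC] by simp
    qed
    then show "?h \<in> carrier (W p)" using hA by (simp add: W_def)
  qed
qed

lemma group_W: "group (W p)"
  using group.subgroup_imp_group[OF group_Aut_tree subgroup_W[of p]] by (simp add: W_def)

definition closed_subgroup :: "nat \<Rightarrow> (nat list \<Rightarrow> nat list) set \<Rightarrow> bool" where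
  "closed_subgroup p L \<longleftrightarrow> subgroup L (W p) \<and> closedin (Aut_tree_topology p) L"

definition group_index :: "('a, 'b) monoid_scheme \<Rightarrow> 'a set \<Rightarrow> nat" where
  "group_index G H = card (rcosets\<^bsub>G\<^esub> H)"

text \<open>The term \<open>n = 0\<close> is \<open>0 / 0 = 0\<close>, which does not affect the limit inferior.\<close>

definition hdim :: "nat \<Rightarrow> (nat list \<Rightarrow> nat list) set \<Rightarrow> ereal" where
  "hdim p L = liminf (\<lambda>n. ereal
     (ln (real (group_index ((W p)\<lparr>carrier := L\<rparr>) (L \<inter> level_stab p n))) /
      ln (real (group_index (W p) (carrier (W p) \<inter> level_stab p n)))))"

definition top_generated_by :: "nat \<Rightarrow> (nat list \<Rightarrow> nat list) set \<Rightarrow> (nat list \<Rightarrow> nat list) set \<Rightarrow> bool" where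
  "top_generated_by p L S \<longleftrightarrow>
     S \<subseteq> carrier (W p) \<and> L = (Aut_tree_topology p) closure_of (generate (W p) S)"

definition hspec :: "nat \<Rightarrow> nat \<Rightarrow> ereal set" where
  "hspec d p = {hdim p L | L. closed_subgroup p L \<and>
     (\<exists>S. finite S \<and> card S \<le> d \<and> top_generated_by p L S)}"

end

theory Submission
  imports Defs
begin

text \<open>
  All dimensions lie between 0 and 1, so the point is to attain every \<open>\<alpha> \<in> [0,1]\<close> by a group with
  two topological generators. Write \<open>\<alpha>\<close> as the sum of \<open>c i / p ^ (i + 1)\<close> with digits \<open>c i < p\<close>, and
  call the vertices \<open>1\<^sup>i y\<close> with \<open>2 \<le> y \<le> c i + 1\<close> active. They hang off the ray \<open>111\<dots>\<close>, and the
  subtree of such a vertex carries the fraction \<open>p ^ -(i + 1)\<close> of all labels. A group that acts only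
  below the active vertices has dimension at most \<open>\<alpha>\<close> (\<open>two_gen_upper\<close>). Two such elements are
  constructed whose group loses asymptotically nothing below any single active vertex.

  The first ingredient is a finitely generated group \<open>D 0\<close> whose derived subgroup has dimension 1.
  Finitely many generators force some loss, and the loss has to become negligible on deep levels. The
  group \<open>D i\<close> is generated by rotations at one vertex of each level less than \<open>5 + i\<close>, which produce all
  rotations on these levels, and by one further element \<open>spinal i\<close>. The latter has as sections,
  at six vertices of level 4, those generators of \<open>D (i + 1)\<close> that are not already present. Two
  elements whose nontrivial sections overlap in a single vertex have a commutator supported below that
  vertex. In this way the derived subgroup of \<open>D i\<close> contains a copy of the derived subgroup of
  \<open>D (i + 1)\<close> below every vertex of level 4 (\<open>graft_step\<close>). Since the range of levels without loss grows
  by one with each descent by four levels, the derived subgroup of \<open>D 0\<close> misses at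
  most \<open>p ^ (4 * (n div 5))\<close> of the \<open>p ^ n\<close> labels on level \<open>n\<close> (\<open>graft_rot_diff_deep\<close>).

  The second ingredient reduces to two generators and decouples the active vertices. Below the active
  vertex \<open>1\<^sup>i y\<close> the first generator acts as an odometer of order \<open>p ^ n\<close>, where \<open>n = depth i y\<close> increases
  along an enumeration of the active vertices. The second generator has the six generators of \<open>D 0\<close>
  as sections on level \<open>n\<close> below \<open>1\<^sup>i y\<close>, at the positions \<open>4 ^ 0, \<dots>, 4 ^ 5\<close>. The power \<open>p ^ (n - 1)\<close> of
  the first generator is trivial below all earlier active vertices, but not below \<open>1\<^sup>i y\<close>. As the
  differences of powers of four are pairwise distinct, commutators with this power and its conjugates
  isolate the commutators of the generators of \<open>D 0\<close> in single vertices (\<open>graft_derived_odometer\<close>). So the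
  elements that are trivial below the earlier active vertices induce below \<open>1\<^sup>i y\<close> at least a copy of the
  derived subgroup of \<open>D 0\<close> at each vertex of level \<open>n\<close> (\<open>tail_group_graft\<close>).

  These elements are not controlled below later active vertices. But if the vertices are ordered by
  active vertex first and by level second, the elements form a triangular system, in which each
  vertex contributes a factor \<open>p\<close> to the order of the action on a level (\<open>triangular_count\<close>). Passing to
  the closure changes no action on a finite level (\<open>closure_subgroup\<close>), and the two bounds
  meet in the limit (\<open>liminf_ratio\<close>).
\<close>

section \<open>Generated permutation groups\<close>

definition commutator :: "('a \<Rightarrow> 'a) \<Rightarrow> ('a \<Rightarrow> 'a) \<Rightarrow> 'a \<Rightarrow> 'a" where
  "commutator f g = f \<circ> g \<circ> inv' f \<circ> inv' g"

definition gen :: "('a \<Rightarrow> 'a) set \<Rightarrow> ('a \<Rightarrow> 'a) set" where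
  "gen S = \<Inter> {M. S \<subseteq> M \<and> id \<in> M \<and> (\<forall>f\<in>M. \<forall>g\<in>M. f \<circ> g \<in> M) \<and> (\<forall>f\<in>M. inv' f \<in> M)}"

lemma gen_id: "id \<in> gen S"
  by (simp add: gen_def)

lemma gen_base: "f \<in> S \<Longrightarrow> f \<in> gen S"
  by (auto simp: gen_def)

lemma gen_comp: "f \<in> gen S \<Longrightarrow> g \<in> gen S \<Longrightarrow> f \<circ> g \<in> gen S"
  unfolding gen_def by blast

lemma gen_inv: "f \<in> gen S \<Longrightarrow> inv' f \<in> gen S"
  unfolding gen_def by blast

lemmas gen_intros = gen_id gen_base gen_comp gen_inv

lemma gen_induct [consumes 1, case_names one base comp inv]:
  assumes "f \<in> gen S" and "P id" and "\<And>f. f \<in> S \<Longrightarrow> P f"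
    and comp: "\<And>f g. f \<in> gen S \<Longrightarrow> P f \<Longrightarrow> g \<in> gen S \<Longrightarrow> P g \<Longrightarrow> P (f \<circ> g)"
    and inv: "\<And>f. f \<in> gen S \<Longrightarrow> P f \<Longrightarrow> P (inv' f)"
  shows "P f"
proof -
  have "gen S \<subseteq> {f \<in> gen S. P f}"
    using assms(2-)
    by (subst (1) gen_def, intro Inter_lower) (simp, blast intro: gen_id gen_base gen_comp gen_inv)
  then show ?thesis using assms(1) by blast
qed

text \<open>
  The ambient group is always a set of bijections, so \<open>gen S\<close> is the subgroup generated by \<open>S\<close>
  and \<open>derived_gp S\<close> is the derived subgroup of \<open>gen S\<close>.
\<close>

definition derived_gp :: "('a \<Rightarrow> 'a) set \<Rightarrow> ('a \<Rightarrow> 'a) set" where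
  "derived_gp S = gen {commutator f g | f g. f \<in> gen S \<and> g \<in> gen S}"

lemma bij_eqs:
  assumes "bij f"
  shows "f (inv' f x) = x" "inv' f (f x) = x" "f \<circ> inv' f = id" "inv' f \<circ> f = id"
    "inv' (inv' f) = f" "bij (inv' f)" "f \<circ> (inv' f \<circ> g) = g" "inv' f \<circ> (f \<circ> g) = g"
proof -
  show 1: "f (inv' f x) = x" for x using assms by (simp add: bij_is_surj surj_f_inv_f)
  show 2: "inv' f (f x) = x" for x using assms by (simp add: bij_is_inj)
  show "f \<circ> inv' f = id" "inv' f \<circ> f = id" "f \<circ> (inv' f \<circ> g) = g" "inv' f \<circ> (f \<circ> g) = g"
    using 1 2 by (simp_all add: fun_eq_iff)
  show "inv' (inv' f) = f" "bij (inv' f)"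
    using assms by (simp_all add: inv_inv_eq bij_imp_bij_inv)
qed

lemma inv_eqI:
  fixes f :: "'a \<Rightarrow> 'a"
  assumes "bij f" "f \<circ> g = id"
  shows "inv' f = g"
proof -
  have "inv' f \<circ> (f \<circ> g) = g" by (rule bij_eqs(8)[OF assms(1)])
  then show ?thesis using assms(2) by simp
qed

lemma funpow_in_gen: "f \<in> gen S \<Longrightarrow> f ^^ n \<in> gen S"
  by (induction n) (auto intro: gen_intros simp flip: id_def)

lemma bij_inv_comp: "bij f \<Longrightarrow> bij g \<Longrightarrow> inv' (f \<circ> g) = inv' g \<circ> inv' f"
  by (rule o_inv_distrib)

section \<open>Sums of two powers of four\<close>

text \<open>
  The larger of the two exponents is determined because \<open>2 * 4 ^ d < 4 ^ (d + 1)\<close>.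
\<close>

lemma four_pow_sum_aux:
  assumes "a \<le> b" "c \<le> d" "(4::nat) ^ a + 4 ^ b = 4 ^ c + 4 ^ d"
  shows "b \<le> d"
proof (rule ccontr)
  assume "\<not> b \<le> d"
  then have "(4::nat) ^ Suc d \<le> 4 ^ b" by (intro power_increasing) auto
  moreover have "(4::nat) ^ c \<le> 4 ^ d" using assms by (intro power_increasing) auto
  moreover have "(0::nat) < 4 ^ d" by simp
  ultimately show False using assms(3) by simp
qed

lemma four_pow_sum_ordered:
  assumes "a \<le> b" "c \<le> d" "(4::nat) ^ a + 4 ^ b = 4 ^ c + 4 ^ d"
  shows "a = c \<and> b = d"
proof -
  have "b = d"
    using four_pow_sum_aux[OF assms] four_pow_sum_aux[OF assms(2,1) assms(3)[symmetric]] by simp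
  then show ?thesis using assms(3) by simp
qed

text \<open>
  The powers of four have pairwise distinct differences. This is used to slide a copy of
  them over itself so that the two copies meet in a single, prescribed point.
\<close>

lemma four_pow_sum:
  assumes "(4::nat) ^ a + 4 ^ b = 4 ^ c + 4 ^ d"
  shows "a = c \<and> b = d \<or> a = d \<and> b = c"
proof -
  consider "a \<le> b" "c \<le> d" | "a \<le> b" "d \<le> c" | "b \<le> a" "c \<le> d" | "b \<le> a" "d \<le> c"
    using nat_le_linear by blast
  then show ?thesis
    by cases (use assms four_pow_sum_ordered[of a b c d] four_pow_sum_ordered[of a b d c]
      four_pow_sum_ordered[of b a c d] four_pow_sum_ordered[of b a d c] in \<open>simp_all add: add.commute\<close>)
qed

section \<open>Automorphisms with cyclic labels\<close>

locale padic_tree =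
  fixes p :: nat
  assumes p_ge_2: "2 \<le> p"
begin

text \<open>
  All maps below are total on lists of natural numbers; \<open>\<sigma>\<close> fixes the letters outside
  \<open>{1..p}\<close>. In this way composition and inverse in the group are those of functions, and
  elements of the group \<open>W p\<close> are obtained by restriction.
\<close>

definition \<sigma> :: "nat \<Rightarrow> nat" where
  "\<sigma> = cycle_of_list [1..<Suc p]"

lemma \<sigma>_permutes: "\<sigma> permutes {1..p}"
  using cycle_permutes[of "[1..<Suc p]"]
  by (simp add: \<sigma>_def atLeastLessThanSuc_atLeastAtMost del: upt_Suc)

lemma \<sigma>_pow_on: "i < p \<Longrightarrow> (\<sigma> ^^ k) (Suc i) = Suc ((i + k) mod p)"
proof -
  assume i: "i < p"
  have "map (\<sigma> ^^ k) [1..<Suc p] = rotate k [1..<Suc p]"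
    unfolding \<sigma>_def by (rule cyclic_rotation) simp
  then have "map (\<sigma> ^^ k) [1..<Suc p] ! i = rotate k [1..<Suc p] ! i"
    by simp
  then show ?thesis
    using i by (simp add: nth_rotate add.commute del: upt_Suc)
qed

lemma \<sigma>_last: "\<sigma> p = 1"
  using \<sigma>_pow_on[of "p - 1" 1] p_ge_2 by simp

lemma \<sigma>_less: "x \<in> {1..<p} \<Longrightarrow> \<sigma> x = Suc x"
  using \<sigma>_pow_on[of "x - 1" 1] p_ge_2 by (cases x) auto

lemma \<sigma>_pow_p: "\<sigma> ^^ p = id"
  using cycle_is_id_root[of "[1..<Suc p]"] by (simp add: \<sigma>_def del: upt_Suc)

lemma \<sigma>_pow_inverse: "(\<sigma> ^^ ((p - 1) * k)) ((\<sigma> ^^ k) x) = x"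
proof -
  have "(\<sigma> ^^ ((p - 1) * k)) ((\<sigma> ^^ k) x) = (\<sigma> ^^ ((p - 1) * k + k)) x"
    by (simp add: funpow_add)
  also have "(p - 1) * k + k = p * k"
    using p_ge_2 by (cases p) auto
  also have "(\<sigma> ^^ (p * k)) x = x"
    by (simp add: funpow_mult[symmetric] \<sigma>_pow_p)
  finally show ?thesis .
qed

lemma \<sigma>_pow_in: "x \<in> {1..p} \<Longrightarrow> (\<sigma> ^^ k) x \<in> {1..p}"
proof (induction k)
  case (Suc k)
  then show ?case using permutes_in_image[OF \<sigma>_permutes] by auto
qed auto

lemma \<sigma>_pow_in_iff: "(\<sigma> ^^ k) x \<in> {1..p} \<longleftrightarrow> x \<in> {1..p}"
  using \<sigma>_pow_in \<sigma>_pow_inverse by metis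

definition auts :: "(nat list \<Rightarrow> nat list) set" where
  "auts = {f. f [] = [] \<and> (\<forall>v. \<exists>k. \<forall>x. f (v @ [x]) = f v @ [(\<sigma> ^^ k) x])}"

lemma autsI:
  assumes "f [] = []" "\<And>v. \<exists>k. \<forall>x. f (v @ [x]) = f v @ [(\<sigma> ^^ k) x]"
  shows "f \<in> auts"
  using assms by (simp add: auts_def)

lemma auts_Nil: "f \<in> auts \<Longrightarrow> f [] = []"
  by (simp add: auts_def)

lemma auts_snoc: "f \<in> auts \<Longrightarrow> \<exists>k. \<forall>x. f (v @ [x]) = f v @ [(\<sigma> ^^ k) x]"
  by (simp add: auts_def)

lemma auts_length [simp]: "f \<in> auts \<Longrightarrow> length (f w) = length w"
proof (induction w rule: rev_induct)
  case (snoc x w)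
  then show ?case using auts_snoc[of f w] by auto
qed (simp add: auts_Nil)

lemma auts_append: "f \<in> auts \<Longrightarrow> \<exists>w'. f (v @ w) = f v @ w' \<and> length w' = length w"
proof (induction w rule: rev_induct)
  case (snoc x w)
  then obtain w' where "f (v @ w) = f v @ w'" "length w' = length w" by auto
  moreover obtain k where "f ((v @ w) @ [x]) = f (v @ w) @ [(\<sigma> ^^ k) x]"
    using auts_snoc[OF snoc.prems, of "v @ w"] by blast
  ultimately show ?case by auto
qed simp

lemma auts_take: "f \<in> auts \<Longrightarrow> take n (f w) = f (take n w)"
proof -
  assume f: "f \<in> auts"
  obtain w' where "f (take n w @ drop n w) = f (take n w) @ w'" "length w' = length (drop n w)"
    using auts_append[OF f] by blast
  then show ?thesis using f by (auto simp: min_def)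
qed

lemma auts_words: "f \<in> auts \<Longrightarrow> f w \<in> words p \<longleftrightarrow> w \<in> words p"
proof (induction w rule: rev_induct)
  case (snoc x w)
  obtain k where "f (w @ [x]) = f w @ [(\<sigma> ^^ k) x]"
    using auts_snoc[OF snoc.prems, of w] by blast
  then show ?case using snoc \<sigma>_pow_in_iff by simp
qed (simp add: auts_Nil)

lemma id_auts: "id \<in> auts"
  by (intro autsI) (auto intro: exI[of _ 0])

lemma comp_auts:
  assumes "f \<in> auts" "g \<in> auts"
  shows "f \<circ> g \<in> auts"
proof (rule autsI)
  fix v
  obtain k where "\<forall>x. g (v @ [x]) = g v @ [(\<sigma> ^^ k) x]" using auts_snoc[OF assms(2)] by blast
  moreover obtain l where "\<forall>x. f (g v @ [x]) = f (g v) @ [(\<sigma> ^^ l) x]"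
    using auts_snoc[OF assms(1)] by blast
  ultimately have "\<forall>x. (f \<circ> g) (v @ [x]) = (f \<circ> g) v @ [(\<sigma> ^^ (l + k)) x]"
    by (simp add: funpow_add)
  then show "\<exists>k. \<forall>x. (f \<circ> g) (v @ [x]) = (f \<circ> g) v @ [(\<sigma> ^^ k) x]" by blast
qed (simp add: assms auts_Nil)

lemma inj_auts: assumes f: "f \<in> auts" shows "inj f"
proof (rule injI)
  fix v w assume "f v = f w"
  then show "v = w"
  proof (induction v arbitrary: w rule: rev_induct)
    case Nil
    then have "length w = 0" using auts_length[OF f] auts_Nil[OF f] by (metis list.size(3))
    then show ?case by simp
  next
    case (snoc x v)
    then have "length w = Suc (length v)" using auts_length[OF f] by (metis length_append_singleton)
    then obtain w' y where w: "w = w' @ [y]" by (metis length_Suc_conv_rev)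
    obtain k l where "f (v @ [x]) = f v @ [(\<sigma> ^^ k) x]" "\<And>y. f (w' @ [y]) = f w' @ [(\<sigma> ^^ l) y]"
      and k: "\<And>x. f (v @ [x]) = f v @ [(\<sigma> ^^ k) x]"
      using auts_snoc[OF f] by metis
    then have "f v = f w'" using snoc.prems w by simp
    then have "v = w'" by (rule snoc.IH)
    then have "(\<sigma> ^^ k) x = (\<sigma> ^^ k) y" using k snoc.prems w by simp
    then have "x = y" using \<sigma>_pow_inverse by metis
    then show ?case using \<open>v = w'\<close> w by simp
  qed
qed

lemma surj_auts: assumes f: "f \<in> auts" shows "surj f"
proof -
  have "\<exists>v. f v = w" for w
  proof (induction w rule: rev_induct)
    case Nil
    then show ?case using auts_Nil[OF f] by blast
  next
    case (snoc y w)
    then obtain v where v: "f v = w" by blast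
    obtain k where k: "\<And>x. f (v @ [x]) = f v @ [(\<sigma> ^^ k) x]" using auts_snoc[OF f] by blast
    have "(\<sigma> ^^ k) ((\<sigma> ^^ ((p - 1) * k)) y) = y"
      by (metis \<sigma>_pow_inverse add.commute comp_apply funpow_add)
    then show ?case using k v by metis
  qed
  then show ?thesis by (metis surjI)
qed

lemma bij_auts [simp]: "f \<in> auts \<Longrightarrow> bij f"
  by (simp add: bij_def inj_auts surj_auts)

lemma inv_auts: assumes f: "f \<in> auts" shows "inv' f \<in> auts"
proof (rule autsI)
  note b = bij_eqs[OF bij_auts[OF f]]
  show "inv' f [] = []" using b auts_Nil[OF f] by metis
  fix w
  obtain k where k: "\<And>x. f (inv' f w @ [x]) = w @ [(\<sigma> ^^ k) x]"
    using auts_snoc[OF f, of "inv' f w"] b by auto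
  have "inv' f (w @ [y]) = inv' f w @ [(\<sigma> ^^ ((p - 1) * k)) y]" for y
  proof -
    have "(\<sigma> ^^ k) ((\<sigma> ^^ ((p - 1) * k)) y) = y"
      by (metis \<sigma>_pow_inverse add.commute comp_apply funpow_add)
    then have "f (inv' f w @ [(\<sigma> ^^ ((p - 1) * k)) y]) = w @ [y]" using k by simp
    then show ?thesis using b by metis
  qed
  then show "\<exists>k. \<forall>y. inv' f (w @ [y]) = inv' f w @ [(\<sigma> ^^ k) y]" by blast
qed

lemma gen_auts: "S \<subseteq> auts \<Longrightarrow> gen S \<subseteq> auts"
proof
  fix f assume S: "S \<subseteq> auts" and "f \<in> gen S"
  from this(2) show "f \<in> auts"
    by (induction rule: gen_induct) (use S id_auts comp_auts inv_auts in blast)+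
qed

lemma commutator_auts: "f \<in> auts \<Longrightarrow> g \<in> auts \<Longrightarrow> commutator f g \<in> auts"
  by (auto simp: commutator_def intro!: comp_auts inv_auts)

lemma derived_gp_auts: "S \<subseteq> auts \<Longrightarrow> derived_gp S \<subseteq> auts"
  unfolding derived_gp_def using gen_auts commutator_auts
  by (intro gen_auts) blast

text \<open>
  An automorphism commutes with truncation, so it is determined by its values on long words.
\<close>

lemma auts_eqI:
  assumes "f \<in> auts" "g \<in> auts" "\<And>u w. length u = n \<Longrightarrow> f (u @ w) = g (u @ w)"
  shows "f = g"
proof
  fix w :: "nat list"
  let ?w = "w @ replicate n 1"
  have "f ?w = g ?w"
    using assms(3)[of "take n ?w" "drop n ?w"] unfolding append_take_drop_id by simp
  then have "take (length w) (f ?w) = take (length w) (g ?w)" by simp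
  then show "f w = g w" using assms(1,2) by (simp add: auts_take)
qed

section \<open>Sections and grafts\<close>

text \<open>
  An element of the base group of the wreath product over level \<open>n\<close>, given by its sections.
\<close>

definition base :: "nat \<Rightarrow> (nat list \<Rightarrow> nat list \<Rightarrow> nat list) \<Rightarrow> nat list \<Rightarrow> nat list" where
  "base n F w = (if length w < n then w else take n w @ F (take n w) (drop n w))"

abbreviation graft :: "nat list \<Rightarrow> (nat list \<Rightarrow> nat list) \<Rightarrow> nat list \<Rightarrow> nat list" where
  "graft v f \<equiv> base (length v) (\<lambda>u. if u = v then f else id)"

definition rot :: "nat list \<Rightarrow> nat list" where
  "rot w = (case w of [] \<Rightarrow> [] | x # w' \<Rightarrow> \<sigma> x # w')"

text \<open>
  Such an automorphism has trivial sections at all words of length \<open>n\<close>. Conjugation by it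
  permutes sections at level \<open>n\<close> without changing them.
\<close>

definition rigid :: "nat \<Rightarrow> (nat list \<Rightarrow> nat list) \<Rightarrow> bool" where
  "rigid n f \<longleftrightarrow> (\<forall>u w. length u = n \<longrightarrow> f (u @ w) = f u @ w)"

lemma base_append: "length u = n \<Longrightarrow> base n F (u @ w) = u @ F u w"
  by (simp add: base_def)

lemma base_auts:
  assumes "\<And>u. length u = n \<Longrightarrow> F u \<in> auts"
  shows "base n F \<in> auts"
proof (rule autsI)
  show "base n F [] = []" using assms by (auto simp: base_def auts_Nil)
  fix v :: "nat list"
  consider "Suc (length v) < n" | "Suc (length v) = n" | "n \<le> length v" by linarith
  then show "\<exists>k. \<forall>x. base n F (v @ [x]) = base n F v @ [(\<sigma> ^^ k) x]"
  proof cases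
    case 1 then show ?thesis by (auto simp: base_def intro: exI[of _ 0])
  next
    case 2 then show ?thesis using assms by (auto simp: base_def auts_Nil intro: exI[of _ 0])
  next
    case 3
    then have "F (take n v) \<in> auts" using assms by simp
    from auts_snoc[OF this, of "drop n v"] show ?thesis using 3 by (auto simp: base_def)
  qed
qed

lemma graft_auts: "f \<in> auts \<Longrightarrow> graft v f \<in> auts"
  by (rule base_auts) (auto intro: id_auts)

lemma base_comp:
  assumes "\<And>u. length u = n \<Longrightarrow> F u \<in> auts" "\<And>u. length u = n \<Longrightarrow> G u \<in> auts"
  shows "base n F \<circ> base n G = base n (\<lambda>u. F u \<circ> G u)"
  by (rule auts_eqI[where n=n])
    (auto intro!: comp_auts base_auts assms simp: base_append)

lemma base_cong: "(\<And>u. length u = n \<Longrightarrow> F u = G u) \<Longrightarrow> base n F = base n G"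
  by (auto simp: base_def fun_eq_iff)

lemma base_id: "base n (\<lambda>u. id) = id"
  by (auto simp: base_def fun_eq_iff)

lemma base_inv:
  assumes "\<And>u. length u = n \<Longrightarrow> F u \<in> auts"
  shows "inv' (base n F) = base n (\<lambda>u. inv' (F u))"
proof (rule inv_eqI)
  have "base n F \<circ> base n (\<lambda>u. inv' (F u)) = base n (\<lambda>u. F u \<circ> inv' (F u))"
    by (rule base_comp) (auto intro: assms inv_auts)
  also have "\<dots> = base n (\<lambda>u. id)"
    using assms by (intro base_cong) (simp add: bij_eqs)
  finally show "base n F \<circ> base n (\<lambda>u. inv' (F u)) = id" by (simp add: base_id)
qed (simp add: assms base_auts)

lemma base_conj:
  assumes "\<And>u. length u = n \<Longrightarrow> F u \<in> auts" "h \<in> auts" "rigid n h"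
  shows "h \<circ> base n F \<circ> inv' h = base n (\<lambda>u. F (inv' h u))"
proof (rule auts_eqI[where n=n])
  have i: "inv' h \<in> auts" using assms inv_auts by blast
  then show "h \<circ> base n F \<circ> inv' h \<in> auts" "base n (\<lambda>u. F (inv' h u)) \<in> auts"
    using assms by (auto intro!: comp_auts base_auts)
  fix u w :: "nat list" assume u: "length u = n"
  have hb: "h (inv' h u) = u" using assms(2) by (simp add: bij_eqs)
  have "h (inv' h u @ w') = u @ w'" for w'
    using assms(3) u i hb by (simp add: rigid_def)
  moreover from this have "inv' h (u @ w) = inv' h u @ w"
    using assms(2) by (metis bij_auts bij_eqs(2))
  ultimately show "(h \<circ> base n F \<circ> inv' h) (u @ w) = base n (\<lambda>u. F (inv' h u)) (u @ w)"
    using u i by (simp add: base_append)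
qed

lemma graft_conj:
  assumes "f \<in> auts" "h \<in> auts" "rigid (length v) h"
  shows "h \<circ> graft v f \<circ> inv' h = graft (h v) f"
proof -
  have "h \<circ> graft v f \<circ> inv' h = base (length v) (\<lambda>u. if inv' h u = v then f else id)"
    by (rule base_conj) (auto simp: assms id_auts)
  also have "\<dots> = base (length v) (\<lambda>u. if u = h v then f else id)"
    using assms(2) by (intro base_cong) (auto simp: bij_eqs)
  finally show ?thesis using assms by simp
qed

lemma graft_comp: "f \<in> auts \<Longrightarrow> g \<in> auts \<Longrightarrow> graft v (f \<circ> g) = graft v f \<circ> graft v g"
  using base_comp[of "length v" "\<lambda>u. if u = v then f else id" "\<lambda>u. if u = v then g else id"]
  by (simp add: id_auts if_distrib[of "\<lambda>h. h \<circ> _"] cong: if_cong)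

lemma graft_inv: "f \<in> auts \<Longrightarrow> graft v (inv' f) = inv' (graft v f)"
  using base_inv[of "length v" "\<lambda>u. if u = v then f else id"]
  by (simp add: id_auts if_distrib[of inv'] cong: if_cong)

lemma graft_id: "graft v id = id"
  using base_id[of "length v"] by simp

lemma graft_graft:
  assumes "f \<in> auts"
  shows "graft v (graft w f) = graft (v @ w) f"
proof (rule auts_eqI[where n="length v + length w"])
  show "graft v (graft w f) \<in> auts" "graft (v @ w) f \<in> auts" using graft_auts[OF graft_auts[OF assms], of v w] graft_auts[OF assms, of "v @ w"] .
  fix u z :: "nat list" assume u: "length u = length v + length w"
  define u1 u2 where "u1 = take (length v) u" and "u2 = drop (length v) u"
  have "u = u1 @ u2" "length u1 = length v" "length u2 = length w" using u by (auto simp: u1_def u2_def)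
  then have "graft v (graft w f) (u1 @ u2 @ z) = graft (v @ w) f ((u1 @ u2) @ z)"
    by (simp add: base_append del: append_assoc)
  then show "graft v (graft w f) (u @ z) = graft (v @ w) f (u @ z)" using \<open>u = u1 @ u2\<close> by simp
qed

text \<open>
  At every vertex other than \<open>v\<close> one of the two sections is trivial, so the commutator
  lives below \<open>v\<close>. All isolation arguments below end with this lemma.
\<close>

lemma commutator_base:
  assumes "\<And>u. length u = length v \<Longrightarrow> F u \<in> auts" "\<And>u. length u = length v \<Longrightarrow> G u \<in> auts"
    and "\<And>u. length u = length v \<Longrightarrow> u \<noteq> v \<Longrightarrow> F u = id \<or> G u = id"
  shows "commutator (base (length v) F) (base (length v) G) = graft v (commutator (F v) (G v))"
proof -
  have "commutator (base (length v) F) (base (length v) G) =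
      base (length v) (\<lambda>u. F u \<circ> G u \<circ> inv' (F u) \<circ> inv' (G u))"
    unfolding commutator_def using assms
    by (simp add: base_inv base_comp comp_auts inv_auts)
  also have "\<dots> = graft v (commutator (F v) (G v))"
    using assms by (intro base_cong) (fastforce simp: commutator_def bij_eqs)
  finally show ?thesis .
qed

lemma rot_auts: "rot \<in> auts"
proof (rule autsI)
  fix v :: "nat list"
  show "\<exists>k. \<forall>x. rot (v @ [x]) = rot v @ [(\<sigma> ^^ k) x]"
    by (cases v) (auto simp: rot_def intro: exI[of _ 0] exI[of _ "Suc 0"])
qed (simp add: rot_def)

lemma rigid_mono: assumes "f \<in> auts" "rigid n f" "n \<le> m" shows "rigid m f"
  unfolding rigid_def
proof (intro allI impI)
  fix u w :: "nat list" assume u: "length u = m"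
  define a b where "a = take n u" and "b = drop n u"
  have ab: "u = a @ b" "length a = n" using u assms by (auto simp: a_def b_def)
  have "f (a @ (b @ w)) = f a @ b @ w" "f (a @ b) = f a @ b"
    using assms(2) ab(2) by (auto simp: rigid_def)
  then show "f (u @ w) = f u @ w" using ab by simp
qed

lemma rigid_comp: "rigid n f \<Longrightarrow> rigid n g \<Longrightarrow> g \<in> auts \<Longrightarrow> rigid n (f \<circ> g)"
  by (simp add: rigid_def)

lemma rigid_id: "rigid n id"
  by (simp add: rigid_def)

lemma rigid_inv: assumes "rigid n f" "f \<in> auts" shows "rigid n (inv' f)"
  unfolding rigid_def
proof (intro allI impI)
  fix u w :: "nat list" assume u: "length u = n"
  have "f (inv' f u @ w) = u @ w"
    using assms u inv_auts[OF assms(2)] by (simp add: rigid_def bij_eqs)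
  then show "inv' f (u @ w) = inv' f u @ w" using assms(2) by (metis bij_auts bij_eqs(2))
qed

lemma rigid_funpow: "rigid n f \<Longrightarrow> f \<in> auts \<Longrightarrow> rigid n (f ^^ k)"
proof -
  assume "rigid n f" "f \<in> auts"
  then have "f ^^ k \<in> auts \<and> rigid n (f ^^ k)"
    by (induction k) (auto simp: id_auts rigid_id simp flip: id_def intro!: comp_auts rigid_comp)
  then show ?thesis ..
qed

lemma funpow_auts: "f \<in> auts \<Longrightarrow> f ^^ k \<in> auts"
  by (induction k) (auto simp: id_auts simp flip: id_def intro!: comp_auts)

lemma rigid_graft_rot: "rigid (Suc (length v)) (graft v rot)"
  unfolding rigid_def
proof (intro allI impI)
  fix u w :: "nat list" assume u: "length u = Suc (length v)"
  then obtain u' x where "u = u' @ [x]" "length u' = length v" by (metis length_Suc_conv_rev)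
  then show "graft v rot (u @ w) = graft v rot u @ w"
    by (simp add: base_append) (simp add: rot_def)
qed

lemma graft_rot_apply: "graft v rot (v @ x # w) = v @ \<sigma> x # w"
  by (simp add: base_append) (simp add: rot_def)

lemma graft_rot_pow_apply: "(graft v rot ^^ k) (v @ x # w) = v @ (\<sigma> ^^ k) x # w"
  by (induction k) (simp_all add: graft_rot_apply)

section \<open>Subgroups and their derived subgroups\<close>

lemma inv_app:
  assumes "f \<in> auts" "f a = b"
  shows "inv' f b = a"
proof -
  have "inv' f (f a) = a" by (rule bij_eqs(2)[OF bij_auts[OF assms(1)]])
  then show ?thesis by (simp only: assms(2))
qed

definition aut_group :: "(nat list \<Rightarrow> nat list) set \<Rightarrow> bool" where
  "aut_group M \<longleftrightarrow> M \<subseteq> auts \<and> id \<in> M \<and> (\<forall>f\<in>M. \<forall>g\<in>M. f \<circ> g \<in> M) \<and> (\<forall>f\<in>M. inv' f \<in> M)"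

lemma aut_groupD:
  assumes "aut_group M"
  shows "id \<in> M" "f \<in> M \<Longrightarrow> g \<in> M \<Longrightarrow> f \<circ> g \<in> M" "f \<in> M \<Longrightarrow> inv' f \<in> M" "f \<in> M \<Longrightarrow> f \<in> auts"
proof -
  show "id \<in> M" using assms unfolding aut_group_def by blast
  show "f \<in> M \<Longrightarrow> g \<in> M \<Longrightarrow> f \<circ> g \<in> M" using assms unfolding aut_group_def by blast
  show "f \<in> M \<Longrightarrow> inv' f \<in> M" using assms unfolding aut_group_def by blast
  show "f \<in> M \<Longrightarrow> f \<in> auts" using assms unfolding aut_group_def by blast
qed

lemma aut_group_gen: "S \<subseteq> auts \<Longrightarrow> aut_group (gen S)"
proof -
  assume S: "S \<subseteq> auts"
  have 1: "gen S \<subseteq> auts" by (rule gen_auts[OF S])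
  have 2: "\<forall>f\<in>gen S. inv' f \<in> gen S" by (intro ballI gen_inv)
  have 3: "\<forall>f\<in>gen S. \<forall>g\<in>gen S. f \<circ> g \<in> gen S" by (intro ballI gen_comp)
  show "aut_group (gen S)" unfolding aut_group_def using gen_id 1 2 3 by blast
qed

definition normalizes :: "(nat list \<Rightarrow> nat list) \<Rightarrow> (nat list \<Rightarrow> nat list) set \<Rightarrow> bool" where
  "normalizes q M \<longleftrightarrow> (\<forall>f\<in>M. q \<circ> f \<circ> inv' q \<in> M \<and> inv' q \<circ> f \<circ> q \<in> M)"

lemma gen_subset:
  assumes "aut_group M" "S \<subseteq> M"
  shows "gen S \<subseteq> M"
proof
  fix f assume "f \<in> gen S"
  then show "f \<in> M"
  proof (induction rule: gen_induct)
    case (base f)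
    then show ?case using assms(2) by (rule subsetD[rotated])
  qed (rule aut_groupD[OF assms(1)]; assumption)+
qed

lemma normalizes_gen:
  assumes S: "S \<subseteq> auts" and M: "aut_group M" and n: "\<And>q. q \<in> S \<Longrightarrow> normalizes q M" and g: "g \<in> gen S"
  shows "normalizes g M"
  using g
proof (induction rule: gen_induct)
  case one
  show ?case unfolding normalizes_def Hilbert_Choice.inv_id comp_id id_comp by blast
next
  case (base f)
  then show ?case by (rule n)
next
  case (comp f g)
  then have b: "bij f" "bij g" using gen_auts[OF S] by auto
  show ?case unfolding normalizes_def
  proof (intro ballI conjI)
    fix h assume h: "h \<in> M"
    have "f \<circ> (g \<circ> h \<circ> inv' g) \<circ> inv' f \<in> M" "inv' g \<circ> (inv' f \<circ> h \<circ> f) \<circ> g \<in> M"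
      using comp.IH h unfolding normalizes_def by blast+
    then show "f \<circ> g \<circ> h \<circ> inv' (f \<circ> g) \<in> M" "inv' (f \<circ> g) \<circ> h \<circ> (f \<circ> g) \<in> M"
      using b by (simp_all add: bij_inv_comp comp_assoc)
  qed
next
  case (inv f)
  then have "bij f" using gen_auts[OF S] by auto
  then show ?case using inv.IH by (simp add: normalizes_def bij_eqs)
qed

text \<open>
  This rests on the identities \<open>[a, fg] = [a, f] f [a, g] f^(-1)\<close> and \<open>[a, f^(-1)] = f^(-1) [a, f]^(-1) f\<close>.
\<close>

lemma commutator_gen:
  assumes S: "S \<subseteq> auts" and M: "aut_group M" and n: "\<And>q. q \<in> S \<Longrightarrow> normalizes q M"
    and a: "a \<in> auts" "\<And>x. x \<in> S \<Longrightarrow> commutator a x \<in> M" and g: "g \<in> gen S"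
  shows "commutator a g \<in> M"
  using g
proof (induction rule: gen_induct)
  case one
  have "commutator a id = id"
    unfolding commutator_def Hilbert_Choice.inv_id comp_id by (rule bij_eqs(3)[OF bij_auts[OF a(1)]])
  then show ?case using aut_groupD(1)[OF M] by metis
next
  case (base f)
  then show ?case by (rule a)
next
  case (comp f g)
  then have b: "bij f" "bij g" "bij a" using gen_auts[OF S] a by auto
  have "commutator a (f \<circ> g) = commutator a f \<circ> (f \<circ> commutator a g \<circ> inv' f)"
    using b by (simp add: fun_eq_iff commutator_def bij_eqs bij_inv_comp)
  moreover have "f \<circ> commutator a g \<circ> inv' f \<in> M"
    using normalizes_gen[OF S M n comp.hyps(1)] comp.IH by (simp add: normalizes_def)
  ultimately show ?case using comp.IH aut_groupD(2)[OF M] by metis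
next
  case (inv f)
  then have b: "bij f" "bij a" using gen_auts[OF S] a by auto
  have "commutator a (inv' f) = inv' f \<circ> inv' (commutator a f) \<circ> f"
    using b by (simp add: fun_eq_iff commutator_def bij_eqs bij_inv_comp bij_comp)
  moreover have "inv' (commutator a f) \<in> M" using inv.IH aut_groupD[OF M] by blast
  ultimately show ?case
    using normalizes_gen[OF S M n inv.hyps] unfolding normalizes_def by metis
qed

lemma commutator_inv: "bij f \<Longrightarrow> bij g \<Longrightarrow> inv' (commutator f g) = commutator g f"
  by (simp add: fun_eq_iff commutator_def bij_eqs bij_inv_comp bij_comp)

text \<open>
  The derived subgroup is the normal closure of the commutators of generators.
\<close>

lemma derived_subset:
  assumes S: "S \<subseteq> auts" and M: "aut_group M" and n: "\<And>q. q \<in> S \<Longrightarrow> normalizes q M"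
    and c: "\<And>x y. x \<in> S \<Longrightarrow> y \<in> S \<Longrightarrow> commutator x y \<in> M"
  shows "derived_gp S \<subseteq> M"
proof -
  have 1: "commutator x g \<in> M" if "x \<in> S" "g \<in> gen S" for x g
    by (rule commutator_gen[OF S M n subsetD[OF S that(1)] c[OF that(1)] that(2)])
  have sw: "commutator f g \<in> M" if "commutator g f \<in> M" "f \<in> auts" "g \<in> auts" for f g
    using aut_groupD(3)[OF M that(1)] commutator_inv[OF bij_auts[OF that(3)] bij_auts[OF that(2)]] by simp
  have "commutator f g \<in> M" if fS: "f \<in> gen S" and gS: "g \<in> gen S" for f g
  proof -
    have fg: "f \<in> auts" "g \<in> auts" using fS gS gen_auts[OF S] by auto
    have "commutator g x \<in> M" if "x \<in> S" for x
      by (rule sw[OF 1[OF that gS] fg(2) subsetD[OF S that]])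
    from commutator_gen[OF S M n fg(2) this fS] show ?thesis by (rule sw[OF _ fg])
  qed
  then show ?thesis unfolding derived_gp_def by (intro gen_subset[OF M]) blast
qed

lemma aut_group_derived: "S \<subseteq> auts \<Longrightarrow> aut_group (derived_gp S)"
  unfolding derived_gp_def using gen_auts commutator_auts
  by (intro aut_group_gen) blast

lemma derived_gp_subset_gen: assumes "S \<subseteq> auts" shows "derived_gp S \<subseteq> gen S"
  unfolding derived_gp_def
  by (intro gen_subset aut_group_gen assms) (auto simp: commutator_def intro: gen_intros)

lemma commutator_in_derived: "f \<in> gen S \<Longrightarrow> g \<in> gen S \<Longrightarrow> commutator f g \<in> derived_gp S"
  unfolding derived_gp_def by (blast intro: gen_intros)

lemma gen_normalizes_derived:
  assumes S: "S \<subseteq> auts" and q: "q \<in> gen S"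
  shows "normalizes q (derived_gp S)"
proof -
  have "q \<circ> f \<circ> inv' q \<in> derived_gp S" if "q \<in> gen S" "f \<in> derived_gp S" for f q
  proof -
    have "commutator q f \<circ> f \<in> derived_gp S"
      using that derived_gp_subset_gen[OF S] aut_groupD(2)[OF aut_group_derived[OF S]]
        commutator_in_derived by blast
    moreover have "f \<in> auts" using that aut_groupD(4)[OF aut_group_derived[OF S]] by blast
    then have "commutator q f \<circ> f = q \<circ> f \<circ> inv' q"
      by (simp add: commutator_def fun_eq_iff bij_eqs)
    ultimately show ?thesis by simp
  qed
  moreover have "inv' (inv' q) = q" using q gen_auts[OF S] by (auto simp: bij_eqs)
  ultimately show ?thesis using q unfolding normalizes_def by (metis gen_inv)
qed

text \<open>
  The maps whose graft at \<open>v\<close> lies in \<open>M\<close> form a subgroup. It is normalized by every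
  \<open>z\<close> in \<open>Z\<close>, because an element with section \<open>z\<close> at \<open>v\<close> that fixes the level of \<open>v\<close>
  conjugates the graft of \<open>f\<close> to the graft of \<open>z f z^(-1)\<close>. Hence it contains the whole
  derived subgroup as soon as it contains the commutators of generators.
\<close>

lemma graft_derived:
  assumes M: "aut_group M" and Z: "Z \<subseteq> auts"
    and lift: "\<And>z. z \<in> Z \<Longrightarrow> \<exists>Q. (\<forall>u. length u = length v \<longrightarrow> Q u \<in> auts) \<and> Q v = z \<and> normalizes (base (length v) Q) M"
    and comm: "\<And>x y. x \<in> Z \<Longrightarrow> y \<in> Z \<Longrightarrow> graft v (commutator x y) \<in> M"
    and h: "h \<in> derived_gp Z"
  shows "graft v h \<in> M"
proof -
  define Y where "Y = {h \<in> auts. graft v h \<in> M}"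
  have "aut_group Y"
    using aut_groupD[OF M] unfolding aut_group_def Y_def
    by (auto simp: graft_comp graft_inv base_id id_auts comp_auts inv_auts)
  moreover have "normalizes z Y" if zZ: "z \<in> Z" for z
    unfolding normalizes_def
  proof (intro ballI)
    fix f assume f: "f \<in> Y"
    obtain Q where Q: "\<And>u. length u = length v \<Longrightarrow> Q u \<in> auts" "Q v = z" "normalizes (base (length v) Q) M"
      using lift[OF zZ] by blast
    have fa: "f \<in> auts" "graft v f \<in> M" using f by (auto simp: Y_def)
    have za: "z \<in> auts" using zZ Z by auto
    let ?B = "base (length v) Q"
    have "?B \<circ> graft v f \<circ> inv' ?B = base (length v) (\<lambda>u. Q u \<circ> (if u = v then f else id) \<circ> inv' (Q u))"
      using Q(1) fa by (simp add: base_inv base_comp id_auts comp_auts inv_auts)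
    also have "\<dots> = graft v (z \<circ> f \<circ> inv' z)"
      using Q by (intro base_cong) (auto simp: bij_eqs)
    finally have 1: "graft v (z \<circ> f \<circ> inv' z) \<in> M" using Q(3) fa by (metis normalizes_def)
    have "inv' ?B \<circ> graft v f \<circ> ?B = base (length v) (\<lambda>u. inv' (Q u) \<circ> (if u = v then f else id) \<circ> Q u)"
      using Q(1) fa by (simp add: base_inv base_comp id_auts comp_auts inv_auts)
    also have "\<dots> = graft v (inv' z \<circ> f \<circ> z)"
      using Q by (intro base_cong) (auto simp: bij_eqs)
    finally have 2: "graft v (inv' z \<circ> f \<circ> z) \<in> M" using Q(3) fa by (metis normalizes_def)
    show "z \<circ> f \<circ> inv' z \<in> Y \<and> inv' z \<circ> f \<circ> z \<in> Y"
      using 1 2 fa za by (simp add: Y_def comp_auts inv_auts)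
  qed
  moreover have "commutator x y \<in> Y" if "x \<in> Z" "y \<in> Z" for x y
    using comm[OF that] that Z by (auto simp: Y_def intro!: commutator_auts)
  ultimately have "derived_gp Z \<subseteq> Y" by (intro derived_subset[OF Z])
  then show ?thesis using h by (auto simp: Y_def)
qed

section \<open>A finitely generated group of dimension one\<close>

definition spine_rot :: "nat \<Rightarrow> nat list \<Rightarrow> nat list" where
  "spine_rot j = graft (replicate j 1) rot"

text \<open>
  For \<open>l < 8\<close> the letters are the binary digits of \<open>l\<close>, increased by one. Level 3 has at least
  eight vertices for every \<open>p\<close>, and six stems are needed. All slots end in the letter 1, which
  leaves room to move a single slot away by a rotation at its stem.
\<close>

definition stem :: "nat \<Rightarrow> nat list" where
  "stem l = [l div 4 + 1, l div 2 mod 2 + 1, l mod 2 + 1]"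

definition slot :: "nat \<Rightarrow> nat list" where
  "slot l = stem l @ [1]"

lemma stem_inj: assumes "stem l = stem k" shows "l = k"
proof -
  have *: "n = 2 * (2 * (n div 4) + n div 2 mod 2) + n mod 2" for n :: nat
  proof -
    have "n div 4 = n div 2 div 2" by (simp add: div_mult2_eq[symmetric])
    then have "2 * (n div 4) + n div 2 mod 2 = n div 2" by (metis mult_div_mod_eq)
    then show ?thesis by simp
  qed
  have "l div 4 = k div 4" "l div 2 mod 2 = k div 2 mod 2" "l mod 2 = k mod 2"
    using assms by (simp_all add: stem_def)
  then show ?thesis using *[of l] *[of k] by simp
qed

lemma slot_inj [simp]: "slot l = slot k \<longleftrightarrow> l = k"
  by (auto simp: slot_def dest: stem_inj)

lemma inj_slot: "inj slot"
  by (rule injI) simp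

lemma length_stem_slot [simp]: "length (stem l) = 3" "length (slot l) = 4"
  by (auto simp: stem_def slot_def)

lemma stem_words: "l < 6 \<Longrightarrow> stem l \<in> words p"
proof -
  assume "l < 6"
  then have "l div 4 \<le> 1" by linarith
  moreover have "l div 2 mod 2 \<le> 1" "l mod 2 \<le> 1" by linarith+
  ultimately show ?thesis using p_ge_2 by (auto simp: stem_def words_def)
qed

lemma slot_words: "l < 6 \<Longrightarrow> slot l \<in> words p"
  using stem_words p_ge_2 by (simp add: slot_def)

text \<open>
  The spinal element has the sections \<open>spine_rot (i + 1), \<dots>, spine_rot (i + 5)\<close> at the first
  five slots and the next spinal element at the last one. As an infinite product of
  rotations at pairwise incomparable vertices it is given by recursion on the word.
\<close>

function spinal :: "nat \<Rightarrow> nat list \<Rightarrow> nat list" where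
  "spinal i w = (if length w < 4 then w else take 4 w @
     (if take 4 w = slot 5 then spinal (Suc i) (drop 4 w)
      else if take 4 w \<in> slot ` {..<5} then spine_rot (Suc i + inv' slot (take 4 w)) (drop 4 w)
      else drop 4 w))"
  by pat_completeness auto
termination by (relation "Wellfounded.measure (\<lambda>(i, w). length w)") auto

declare spinal.simps [simp del]

definition spinal_sec :: "nat \<Rightarrow> nat list \<Rightarrow> nat list \<Rightarrow> nat list" where
  "spinal_sec i u = (if u = slot 5 then spinal (Suc i)
     else if u \<in> slot ` {..<5} then spine_rot (Suc i + inv' slot u) else id)"

lemma spinal_base: "spinal i = base 4 (spinal_sec i)"
  by (rule ext, subst spinal.simps) (simp add: base_def spinal_sec_def)

lemma spinal_sec_slot: "l < 5 \<Longrightarrow> spinal_sec i (slot l) = spine_rot (Suc i + l)" "spinal_sec i (slot 5) = spinal (Suc i)"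
  "u \<notin> slot ` {..<6} \<Longrightarrow> spinal_sec i u = id"
proof -
  show "l < 5 \<Longrightarrow> spinal_sec i (slot l) = spine_rot (Suc i + l)"
    using inj_slot by (auto simp: spinal_sec_def)
  show "spinal_sec i (slot 5) = spinal (Suc i)" by (simp add: spinal_sec_def)
  show "u \<notin> slot ` {..<6} \<Longrightarrow> spinal_sec i u = id" by (auto simp: spinal_sec_def)
qed

lemma spine_rot_auts: "spine_rot j \<in> auts"
  unfolding spine_rot_def by (intro graft_auts rot_auts)

lemma spinal_short: "length w < 4 \<Longrightarrow> spinal i w = w"
  unfolding spinal_base by (simp add: base_def)

lemma spinal_sec_Nil: "spinal_sec i u [] = []"
  by (simp add: spinal_sec_def spinal_short auts_Nil spine_rot_auts)

text \<open>
  The sections of a spinal element include a spinal element, so the label at \<open>v\<close> is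
  found by induction on the length of \<open>v\<close>, four letters at a time.
\<close>

lemma spinal_auts: "spinal i \<in> auts"
proof -
  have "\<exists>k. \<forall>x. spinal i (v @ [x]) = spinal i v @ [(\<sigma> ^^ k) x]" for v
  proof (induction "length v" arbitrary: i v rule: less_induct)
    case less
    show ?case
    proof (cases "length v < 4")
      case True
      have "spinal i (v @ [x]) = v @ [x]" for x
        using True by (cases "length v = 3") (auto simp: spinal_base base_def spinal_sec_Nil)
      moreover have "spinal i v = v" using True by (simp add: spinal_short)
      ultimately show ?thesis by (auto intro: exI[of _ 0])
    next
      case False
      let ?u = "take 4 v" let ?w = "drop 4 v"
      have sv: "spinal i (v @ [x]) = ?u @ spinal_sec i ?u (?w @ [x])" "spinal i v = ?u @ spinal_sec i ?u ?w" for x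
        using False by (simp_all add: spinal_base base_def)
      have "?u \<noteq> slot 5 \<Longrightarrow> spinal_sec i ?u \<in> auts"
        using spine_rot_auts id_auts by (simp add: spinal_sec_def)
      then consider "?u = slot 5" | "?u \<noteq> slot 5" "spinal_sec i ?u \<in> auts" by blast
      then show ?thesis
      proof cases
        case 1
        have "\<exists>k. \<forall>x. spinal (Suc i) (?w @ [x]) = spinal (Suc i) ?w @ [(\<sigma> ^^ k) x]"
          using False by (intro less) auto
        then show ?thesis using sv 1 by (simp add: spinal_sec_slot)
      next
        case 2
        then show ?thesis using sv auts_snoc[OF 2(2), of ?w] by simp
      qed
    qed
  qed
  then show ?thesis by (intro autsI) (simp_all add: spinal_short)
qed

lemma spinal_sec_auts: "spinal_sec i u \<in> auts"
  by (simp add: spinal_sec_def spinal_auts spine_rot_auts id_auts)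

text \<open>
  The group \<open>D i\<close> generated by this set contains all rotations at vertices of level less
  than \<open>5 + i\<close>. Every generator of \<open>D (i + 1)\<close> is a section of an element of \<open>D i\<close>
  at level 4: the rotations on levels \<open>0, \<dots>, i\<close> because \<open>D i\<close> contains the
  rotations four levels deeper, the other five rotations and \<open>spinal (i + 1)\<close> because they
  occupy the slots of \<open>spinal i\<close>. So the range of levels without any loss grows by
  one whenever one descends by four levels, while the number of generators stays finite.
\<close>

definition D_gens :: "nat \<Rightarrow> (nat list \<Rightarrow> nat list) set" where
  "D_gens i = insert (spinal i) (spine_rot ` {..<5 + i})"

lemma D_gens_auts: "D_gens i \<subseteq> auts"
  by (auto simp: D_gens_def spinal_auts spine_rot_auts)

lemma D_gens_Suc_cases:
  assumes "z \<in> D_gens (Suc i)"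
  obtains j where "j \<le> i" "z = spine_rot j" | l where "l < 6" "z = spinal_sec i (slot l)"
proof -
  consider "z = spinal (Suc i)" | j where "j < 6 + i" "z = spine_rot j" using assms by (auto simp: D_gens_def)
  then show ?thesis
  proof cases
    case 1
    then show ?thesis using that(2)[of 5] by (simp add: spinal_sec_slot)
  next
    case 2
    show ?thesis
    proof (cases "j \<le> i")
      case False
      then show ?thesis using that(2)[of "j - Suc i"] 2 by (simp add: spinal_sec_slot)
    qed (use that 2 in blast)
  qed
qed

lemma replicate_words: "replicate n 1 \<in> words p"
  using p_ge_2 by (auto simp: words_def)

text \<open>
  The rotation at the vertex reached so far moves the last letter 1 to any other letter.
\<close>

lemma rigid_reach:
  assumes "v \<in> words p" "length v \<le> 5 + i"
  shows "\<exists>h\<in>gen (D_gens i). rigid (length v) h \<and> h (replicate (length v) 1) = v"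
  using assms
proof (induction v rule: rev_induct)
  case Nil
  show ?case by (intro bexI[OF _ gen_id]) (simp add: rigid_def)
next
  case (snoc x v)
  then obtain h where h: "h \<in> gen (D_gens i)" "rigid (length v) h" "h (replicate (length v) 1) = v" by auto
  have ha: "h \<in> auts" using h gen_auts[OF D_gens_auts] by auto
  have ev: "spine_rot (length v) \<in> gen (D_gens i)" using snoc.prems by (auto simp: D_gens_def intro!: gen_base)
  have "h \<circ> spine_rot (length v) \<circ> inv' h = graft v rot"
    using graft_conj[OF rot_auts ha, of "replicate (length v) 1"] h by (simp add: spine_rot_def)
  then have gv: "graft v rot \<in> gen (D_gens i)" using h ev by (metis gen_comp gen_inv)
  let ?h = "(graft v rot ^^ (x - 1)) \<circ> h"
  have "x \<in> {1..p}" using snoc.prems by simp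
  then have "(\<sigma> ^^ (x - 1)) 1 = x" using \<sigma>_pow_on[of 0 "x - 1"] by auto
  then have "?h (replicate (length (v @ [x])) 1) = v @ [x]"
    using h graft_rot_pow_apply[where k = "x - 1" and v = v and x = 1 and w = "[]"]
    by (simp add: rigid_def replicate_append_same[symmetric])
  moreover have "rigid (length (v @ [x])) ?h"
    using rigid_mono[OF ha h(2), of "Suc (length v)"] graft_auts[OF rot_auts, of v]
    by (auto intro!: rigid_comp rigid_funpow rigid_graft_rot ha)
  moreover have "?h \<in> gen (D_gens i)" using h gv by (intro gen_comp funpow_in_gen)
  ultimately show ?case by blast
qed

lemma rigid_transit:
  assumes "u \<in> words p" "u' \<in> words p" "length u = n" "length u' = n" "n \<le> 5 + i"
  shows "\<exists>h\<in>gen (D_gens i). rigid n h \<and> h u = u'"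
proof -
  obtain h where h: "h \<in> gen (D_gens i)" "rigid n h" "h (replicate n 1) = u"
    using rigid_reach[of u i] assms by auto
  obtain h' where h': "h' \<in> gen (D_gens i)" "rigid n h'" "h' (replicate n 1) = u'"
    using rigid_reach[of u' i] assms by auto
  have ha: "h \<in> auts" using h gen_auts[OF D_gens_auts] by auto
  have "(h' \<circ> inv' h) u = u'" unfolding comp_apply inv_app[OF ha h(3)] by (rule h'(3))
  moreover have "rigid n (h' \<circ> inv' h)" using h h' ha by (intro rigid_comp rigid_inv inv_auts)
  ultimately show ?thesis using h h' by (blast intro: gen_intros)
qed

lemma graft_rot_gen:
  assumes "v \<in> words p" "length v < 5 + i"
  shows "graft v rot \<in> gen (D_gens i)"
proof -
  obtain h where h: "h \<in> gen (D_gens i)" "rigid (length v) h" "h (replicate (length v) 1) = v"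
    using rigid_reach[of v i] assms by auto
  have ha: "h \<in> auts" using h gen_auts[OF D_gens_auts] by auto
  have ev: "spine_rot (length v) \<in> gen (D_gens i)" using assms by (auto simp: D_gens_def intro!: gen_base)
  have "h \<circ> spine_rot (length v) \<circ> inv' h = graft v rot"
    using graft_conj[OF rot_auts ha, of "replicate (length v) 1"] h by (simp add: spine_rot_def)
  then show "graft v rot \<in> gen (D_gens i)" using h ev by (metis gen_comp gen_inv)
qed

lemma comp_inv_conj:
  fixes f g :: "'a \<Rightarrow> 'a"
  assumes "bij f" "bij g"
  shows "f \<circ> inv' (g \<circ> f \<circ> inv' g) = commutator f g"
proof -
  have "inv' (g \<circ> f \<circ> inv' g) = inv' (inv' g) \<circ> inv' (g \<circ> f)"
    by (rule bij_inv_comp[OF bij_comp[OF assms] bij_eqs(6)[OF assms(2)]])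
  also have "inv' (inv' g) = g" by (rule bij_eqs(5)[OF assms(2)])
  also have "inv' (g \<circ> f) = inv' f \<circ> inv' g" by (rule bij_inv_comp[OF assms(2,1)])
  finally show ?thesis by (simp only: commutator_def comp_assoc)
qed

text \<open>
  A rigid element carrying \<open>u\<close> to \<open>u'\<close> conjugates one rotation to the other, so their
  quotient is a commutator.
\<close>

lemma graft_rot_diff:
  assumes "u \<in> words p" "u' \<in> words p" "length u = n" "length u' = n" "n < 5 + i"
  shows "graft u rot \<circ> inv' (graft u' rot) \<in> derived_gp (D_gens i)"
proof -
  have "n \<le> 5 + i" using assms(5) by simp
  from rigid_transit[OF assms(1-4) this] obtain h
    where h: "h \<in> gen (D_gens i)" "rigid n h" "h u = u'" by blast
  have ha: "h \<in> auts" using h gen_auts[OF D_gens_auts] by auto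
  have ga: "graft u rot \<in> auts" by (intro graft_auts rot_auts)
  have "graft u' rot = h \<circ> graft u rot \<circ> inv' h" using graft_conj[OF rot_auts ha, of u] h assms by simp
  then have "graft u rot \<circ> inv' (graft u' rot) = commutator (graft u rot) h"
    using comp_inv_conj[OF bij_auts[OF ga] bij_auts[OF ha]] by metis
  then show ?thesis using commutator_in_derived h graft_rot_gen assms by metis
qed

lemma spinal_gen: "spinal i \<in> gen (D_gens i)"
  by (rule gen_base) (simp add: D_gens_def)

lemma graft_spine_rot: "graft v (spine_rot j) = graft (v @ replicate j 1) rot"
  unfolding spine_rot_def by (rule graft_graft[OF rot_auts])

text \<open>
  Both kinds of generators of \<open>D (i + 1)\<close> occur as the section at \<open>v\<close> of an element of
  \<open>D i\<close> that fixes level 4; a generator in a slot is moved to \<open>v\<close> by a rigid element.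
\<close>

lemma generator_lift:
  assumes z: "z \<in> D_gens (Suc i)" and v: "v \<in> words p" "length v = 4"
  shows "\<exists>Q. (\<forall>u. length u = 4 \<longrightarrow> Q u \<in> auts) \<and> Q v = z \<and> base 4 Q \<in> gen (D_gens i)"
  using z
proof (cases rule: D_gens_Suc_cases)
  case (1 j)
  have "graft v (spine_rot j) = graft (v @ replicate j 1) rot" by (rule graft_spine_rot)
  also have "\<dots> \<in> gen (D_gens i)"
    using v 1 replicate_words[of j] by (intro graft_rot_gen) (auto simp: words_def)
  finally have "graft v (spine_rot j) \<in> gen (D_gens i)" .
  then show ?thesis using v 1 by (intro exI[of _ "\<lambda>u. if u = v then spine_rot j else id"]) (auto simp: spine_rot_auts id_auts)
next
  case (2 l)
  obtain h where h: "h \<in> gen (D_gens i)" "rigid 4 h" "h (slot l) = v"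
    using rigid_transit[of "slot l" v 4 i] slot_words[OF 2(1)] v by auto
  have ha: "h \<in> auts" using h gen_auts[OF D_gens_auts] by auto
  have "h \<circ> spinal i \<circ> inv' h = base 4 (\<lambda>u. spinal_sec i (inv' h u))"
    unfolding spinal_base by (rule base_conj) (auto simp: spinal_sec_auts ha h)
  moreover have "h \<circ> spinal i \<circ> inv' h \<in> gen (D_gens i)"
    using h(1) spinal_gen by (intro gen_comp gen_inv)
  moreover have "inv' h v = slot l" using h(3) by (rule inv_app[OF ha])
  ultimately show ?thesis using 2 by (intro exI[of _ "\<lambda>u. spinal_sec i (inv' h u)"]) (auto simp: spinal_sec_auts)
qed

text \<open>
  The commutator of \<open>spinal i\<close> with the rotation at the stem of slot \<open>l\<close> has trivial
  sections except at slot \<open>l\<close> and at its neighbour ending in 2, since the rotation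
  moves no other slot. A conjugate of \<open>spinal i\<close> that carries slot \<open>k\<close> to slot \<open>l\<close>
  without touching the last letter has only sections at words ending in 1. The two
  elements interact at slot \<open>l\<close> only.
\<close>

lemma graft_commutator_slots:
  assumes l: "l < 6" and k: "k < 6"
  shows "graft (slot l) (commutator (spinal_sec i (slot l)) (spinal_sec i (slot k))) \<in> derived_gp (D_gens i)"
proof -
  have S: "spinal i \<in> gen (D_gens i)" by (auto simp: D_gens_def intro: gen_base)
  \<comment> \<open>The rotation that separates slot \<open>l\<close> from the other slots.\<close>
  let ?e = "graft (stem l) rot"
  have ea: "?e \<in> auts" by (intro graft_auts rot_auts)
  have eg: "?e \<in> gen (D_gens i)" using stem_words[OF l] by (intro graft_rot_gen) auto
  have er: "rigid 4 ?e" using rigid_graft_rot[of "stem l"] by simp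
  define C where "C u = spinal_sec i u \<circ> inv' (spinal_sec i (inv' ?e u))" for u
  have "commutator (spinal i) ?e = spinal i \<circ> inv' (?e \<circ> spinal i \<circ> inv' ?e)"
    by (rule comp_inv_conj[OF bij_auts[OF spinal_auts] bij_auts[OF ea], symmetric])
  also have "?e \<circ> spinal i \<circ> inv' ?e = base 4 (\<lambda>u. spinal_sec i (inv' ?e u))"
    unfolding spinal_base by (rule base_conj) (rule spinal_sec_auts ea er)+
  also have "spinal i \<circ> inv' \<dots> = base 4 C"
    unfolding C_def spinal_base by (simp add: base_inv base_comp spinal_sec_auts inv_auts)
  finally have c: "base 4 C \<in> gen (D_gens i)"
    using S eg by (metis commutator_def gen_comp gen_inv)
  obtain t where t: "t \<in> gen (D_gens i)" "rigid 3 t" "t (stem k) = stem l"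
    using rigid_transit[of "stem k" "stem l" 3 i] stem_words l k by auto
  have ta: "t \<in> auts" using t gen_auts[OF D_gens_auts] by auto
  have tk: "inv' t (stem l @ [x]) = stem k @ [x]" for x
  proof -
    have "t (stem k @ [x]) = stem l @ [x]" using t by (simp add: rigid_def)
    then show ?thesis by (rule inv_app[OF ta])
  qed
  have y: "t \<circ> spinal i \<circ> inv' t = base 4 (\<lambda>u. spinal_sec i (inv' t u))"
    unfolding spinal_base by (rule base_conj) (auto simp: spinal_sec_auts ta intro: rigid_mono[OF ta t(2)])
  have yg: "base 4 (\<lambda>u. spinal_sec i (inv' t u)) \<in> gen (D_gens i)"
    using S t unfolding y[symmetric] by (intro gen_comp gen_inv)
  have nslot: "spinal_sec i (stem m @ [x]) = id" if "x \<noteq> 1" for m x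
    using that by (intro spinal_sec_slot) (auto simp: slot_def)
  have Cl: "C (slot l) = spinal_sec i (slot l)"
  proof -
    \<comment> \<open>The rotation brings the letter \<open>p \<noteq> 1\<close> to slot \<open>l\<close>, so the second factor of \<open>C\<close> is trivial there.\<close>
    have "?e (stem l @ [p]) = slot l" using graft_rot_apply[of "stem l" p "[]"] \<sigma>_last by (simp add: slot_def)
    then have "inv' ?e (slot l) = stem l @ [p]" by (rule inv_app[OF ea])
    then show ?thesis using p_ge_2 by (simp add: C_def nslot)
  qed
  have iso: "C u = id \<or> spinal_sec i (inv' t u) = id" if u: "length u = 4" "u \<noteq> slot l" for u
  proof -
    have "length u = Suc 3" using u by simp
    then obtain u' x where ux: "u = u' @ [x]" "length u' = 3" by (metis length_Suc_conv_rev)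
    show ?thesis
    proof (cases "u' = stem l")
      case True
      then show ?thesis using ux u tk nslot by (auto simp: slot_def)
    next
      case False
      then have "?e u = u" using ux by (simp add: base_append)
      then have "inv' ?e u = u" by (rule inv_app[OF ea])
      then show ?thesis by (simp add: C_def bij_eqs spinal_sec_auts)
    qed
  qed
  have E: "commutator (base (length (slot l)) C) (base (length (slot l)) (\<lambda>u. spinal_sec i (inv' t u))) =
      graft (slot l) (commutator (C (slot l)) (spinal_sec i (inv' t (slot l))))"
    by (rule commutator_base[of "slot l" C "\<lambda>u. spinal_sec i (inv' t u)"])
      (use iso in \<open>auto simp: C_def spinal_sec_auts comp_auts inv_auts\<close>)
  have T: "inv' t (slot l) = slot k" using tk by (simp add: slot_def)
  show ?thesis
    using commutator_in_derived[OF c yg] E[unfolded Cl T] by (simp only: length_stem_slot)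
qed

text \<open>
  If one of the two generators is a rotation that \<open>D i\<close> contains as a graft at \<open>v\<close>, any
  lift of the other one will do. For two generators in slots the previous lemma gives the
  commutator at a slot, and a rigid element moves it to \<open>v\<close>.
\<close>

lemma graft_step:
  assumes v: "v \<in> words p" "length v = 4" and h: "h \<in> derived_gp (D_gens (Suc i))"
  shows "graft v h \<in> derived_gp (D_gens i)"
proof (rule graft_derived[OF aut_group_derived D_gens_auts _ _ h])
  show "D_gens i \<subseteq> auts" by (rule D_gens_auts)
  fix z assume "z \<in> D_gens (Suc i)"
  from generator_lift[OF this v] show "\<exists>Q. (\<forall>u. length u = length v \<longrightarrow> Q u \<in> auts) \<and> Q v = z \<and> normalizes (base (length v) Q) (derived_gp (D_gens i))"
    using gen_normalizes_derived[OF D_gens_auts] v by metis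
next
  fix x y assume x: "x \<in> D_gens (Suc i)" and y: "y \<in> D_gens (Suc i)"
  then have xy: "x \<in> auts" "y \<in> auts" using D_gens_auts by auto
  obtain Qx where Qx: "\<And>u. length u = 4 \<Longrightarrow> Qx u \<in> auts" "Qx v = x" "base 4 Qx \<in> gen (D_gens i)"
    using generator_lift[OF x v] by blast
  obtain Qy where Qy: "\<And>u. length u = 4 \<Longrightarrow> Qy u \<in> auts" "Qy v = y" "base 4 Qy \<in> gen (D_gens i)"
    using generator_lift[OF y v] by blast
  have small: "graft v (spine_rot j) \<in> gen (D_gens i)" if "j \<le> i" for j
  proof -
    have "graft v (spine_rot j) = graft (v @ replicate j 1) rot" by (rule graft_spine_rot)
    also have "\<dots> \<in> gen (D_gens i)"
      using v that replicate_words[of j] by (intro graft_rot_gen) (auto simp: words_def)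
    finally show ?thesis .
  qed
  show "graft v (commutator x y) \<in> derived_gp (D_gens i)"
  proof (cases rule: D_gens_Suc_cases[OF x])
    case (1 j)
    have E: "commutator (graft v x) (base (length v) Qy) = graft v (commutator (if v = v then x else id) (Qy v))"
      by (rule commutator_base[of v "\<lambda>u. if u = v then x else id" Qy]) (use Qy v xy in \<open>auto simp: id_auts\<close>)
    have "commutator (graft v x) (base 4 Qy) \<in> derived_gp (D_gens i)"
      by (rule commutator_in_derived[OF small[OF 1(1), folded 1(2)] Qy(3)])
    then show ?thesis using E[unfolded Qy(2) simp_thms(6) if_True] by (simp only: v(2))
  next
    case (2 l)
    note l = this
    show ?thesis
    proof (cases rule: D_gens_Suc_cases[OF y])
      case (1 j)
      have E: "commutator (base (length v) Qx) (graft v y) = graft v (commutator (Qx v) (if v = v then y else id))"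
        by (rule commutator_base[of v Qx "\<lambda>u. if u = v then y else id"]) (use Qx v xy in \<open>auto simp: id_auts\<close>)
      have "commutator (base 4 Qx) (graft v y) \<in> derived_gp (D_gens i)"
        by (rule commutator_in_derived[OF Qx(3) small[OF 1(1), folded 1(2)]])
      then show ?thesis using E[unfolded Qx(2) simp_thms(6) if_True] by (simp only: v(2))
    next
      case (2 k)
      obtain t where t: "t \<in> gen (D_gens i)" "rigid 4 t" "t (slot l) = v"
        using rigid_transit[of "slot l" v 4 i] slot_words[OF l(1)] v by auto
      have ta: "t \<in> auts" using t gen_auts[OF D_gens_auts] by auto
      have "t \<circ> graft (slot l) (commutator x y) \<circ> inv' t = graft v (commutator x y)"
        using graft_conj[OF commutator_auts[OF xy] ta, of "slot l"] t by simp
      moreover have "graft (slot l) (commutator x y) \<in> derived_gp (D_gens i)"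
        unfolding l(2) 2(2) by (rule graft_commutator_slots[OF l(1) 2(1)])
      ultimately show ?thesis using gen_normalizes_derived[OF D_gens_auts t(1)] by (metis normalizes_def)
    qed
  qed
qed

lemma graft_steps:
  assumes "w \<in> words p" "length w = 4 * j" "h \<in> derived_gp (D_gens (i + j))"
  shows "graft w h \<in> derived_gp (D_gens i)"
  using assms
proof (induction j arbitrary: w h)
  case 0
  have "graft [] h = h" by (simp add: fun_eq_iff base_def)
  then show ?case using 0 by simp
next
  case (Suc j)
  let ?a = "take (4 * j) w" let ?b = "drop (4 * j) w"
  have ab: "?a \<in> words p" "?b \<in> words p" "length ?a = 4 * j" "length ?b = 4"
    using Suc.prems by (auto simp: words_def dest: in_set_takeD in_set_dropD)
  have "graft ?b h \<in> derived_gp (D_gens (i + j))" using Suc.prems ab by (intro graft_step) auto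
  then have "graft ?a (graft ?b h) \<in> derived_gp (D_gens i)" using Suc.IH ab by blast
  moreover have "h \<in> auts" using Suc.prems derived_gp_auts[OF D_gens_auts] by blast
  ultimately show ?case using graft_graft[of h ?a ?b] by simp
qed

text \<open>
  Descend \<open>n div 5\<close> times by four levels. The remaining \<open>n - 4 * (n div 5)\<close> levels are
  fewer than \<open>5 + n div 5\<close>, the range in which \<open>D (n div 5)\<close> contains all rotations. On
  level \<open>n\<close> the derived subgroup of \<open>D 0\<close> thus misses at most one label for each of the
  \<open>p ^ (4 * (n div 5))\<close> prefixes, a vanishing proportion.
\<close>

lemma graft_rot_diff_deep:
  assumes "w \<in> words p" "w' \<in> words p" "length w = n" "length w' = n"
    "take (4 * (n div 5)) w = take (4 * (n div 5)) w'"
  shows "graft w rot \<circ> inv' (graft w' rot) \<in> derived_gp (D_gens 0)"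
proof -
  let ?m = "4 * (n div 5)"
  have m: "?m \<le> n" "n - ?m < 5 + n div 5" by linarith+
  let ?a = "take ?m w" let ?b = "drop ?m w" let ?b' = "drop ?m w'"
  have ab: "?a \<in> words p" "?b \<in> words p" "?b' \<in> words p" "length ?a = ?m"
    using assms m by (auto simp: words_def dest: in_set_takeD in_set_dropD)
  let ?d = "graft ?b rot \<circ> inv' (graft ?b' rot)"
  have "?d \<in> derived_gp (D_gens (0 + n div 5))"
    using ab assms m by (intro graft_rot_diff[of _ _ "n - ?m"]) auto
  then have "graft ?a ?d \<in> derived_gp (D_gens 0)" using ab by (intro graft_steps)
  moreover have "graft ?a ?d = graft (?a @ ?b) rot \<circ> inv' (graft (?a @ ?b') rot)"
    using graft_comp[OF graft_auts[OF rot_auts] inv_auts[OF graft_auts[OF rot_auts]], of ?a ?b ?b']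
      graft_inv[OF graft_auts[OF rot_auts], of ?a ?b'] graft_graft[OF rot_auts, of ?a ?b] graft_graft[OF rot_auts, of ?a ?b']
    by (simp only:)
  ultimately show ?thesis using assms(5) by (metis append_take_drop_id)
qed

section \<open>Odometers\<close>

text \<open>
  Addition of 1 with carry to the first \<open>n\<close> letters, the letter \<open>x\<close> being the digit
  \<open>x - 1\<close> and the least significant digit coming first.
\<close>

primrec odometer :: "nat \<Rightarrow> nat list \<Rightarrow> nat list" where
  "odometer 0 = id"
| "odometer (Suc n) = rot \<circ> graft [p] (odometer n)"

lemma odometer_auts: "odometer n \<in> auts"
proof (induction n)
  case (Suc n)
  then show ?case unfolding odometer.simps by (intro comp_auts rot_auts graft_auts)
qed (simp only: odometer.simps id_auts)

lemma odometer_Suc_Cons: "odometer (Suc n) (x # w) = \<sigma> x # (if x = p then odometer n w else w)"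
  by (simp add: base_def rot_def)

lemma odometer_rigid: "rigid n (odometer n)"
proof (induction n)
  case (Suc n)
  show ?case unfolding rigid_def
  proof (intro allI impI)
    fix u w :: "nat list" assume "length u = Suc n"
    then obtain x u' where "u = x # u'" "length u' = n" by (cases u) auto
    then show "odometer (Suc n) (u @ w) = odometer (Suc n) u @ w"
      using Suc by (simp add: odometer_Suc_Cons rigid_def del: odometer.simps)
  qed
qed (simp only: odometer.simps rigid_id)

text \<open>
  The first \<open>n\<close> digits of \<open>z\<close> in base \<open>p\<close>, written in the letters \<open>1, \<dots>, p\<close>.
\<close>

primrec dig :: "nat \<Rightarrow> nat \<Rightarrow> nat list" where
  "dig 0 z = []"
| "dig (Suc n) z = Suc (z mod p) # dig n (z div p)"

lemma length_dig [simp]: "length (dig n z) = n"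
  by (induction n arbitrary: z) auto

lemma odometer_dig: "odometer n (dig n z @ w) = dig n (Suc z) @ w"
proof (induction n arbitrary: z)
  case (Suc n)
  have "z mod p < p" using p_ge_2 by simp
  then have "Suc (z mod p) \<noteq> p \<Longrightarrow> \<sigma> (Suc (z mod p)) = Suc (Suc (z mod p))"
    by (intro \<sigma>_less) auto
  then show ?case
    using Suc[of "z div p"] \<sigma>_last by (simp add: odometer_Suc_Cons mod_Suc div_Suc del: odometer.simps)
qed simp

lemma odometer_pow_dig: "(odometer n ^^ d) (dig n z @ w) = dig n (z + d) @ w"
  by (induction d) (simp_all add: odometer_dig)

lemma dig_eq_iff: "dig n z = dig n z' \<longleftrightarrow> z mod p ^ n = z' mod p ^ n"
proof (induction n arbitrary: z z')
  case (Suc n)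
  have *: "z mod p ^ Suc n = p * (z div p mod p ^ n) + z mod p" for z
    by (simp add: mod_mult2_eq)
  have "z mod p ^ Suc n = z' mod p ^ Suc n \<longleftrightarrow>
      z mod p = z' mod p \<and> z div p mod p ^ n = z' div p mod p ^ n" (is "?L \<longleftrightarrow> ?R")
  proof
    assume L: ?L
    then have "(p * (z div p mod p ^ n) + z mod p) mod p = (p * (z' div p mod p ^ n) + z' mod p) mod p"
      unfolding * by simp
    then have m: "z mod p = z' mod p" by simp
    then have "p * (z div p mod p ^ n) = p * (z' div p mod p ^ n)" using L unfolding * by simp
    then show ?R using m p_ge_2 by simp
  qed (simp add: * del: power_Suc)
  then show ?case using Suc by (simp del: power_Suc)
qed simp

lemma dig_surj: "w \<in> words p \<Longrightarrow> length w = n \<Longrightarrow> \<exists>z < p ^ n. w = dig n z"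
proof (induction n arbitrary: w)
  case (Suc n)
  then obtain x w' where w: "w = x # w'" "x \<in> {1..p}" "w' \<in> words p" "length w' = n"
    by (cases w) (auto simp: words_def)
  obtain z where z: "z < p ^ n" "w' = dig n z" using Suc.IH[OF w(3,4)] by blast
  obtain y where y: "x = Suc y" "y < p" using w(2) by (cases x) auto
  have "p * z + y < p * Suc z" using y by simp
  also have "\<dots> \<le> p * p ^ n" using z(1) by (intro mult_le_mono2) simp
  finally have "p * z + y < p ^ Suc n" by simp
  moreover have "dig (Suc n) (p * z + y) = w"
    using w(1) z(2) y by simp
  ultimately show ?case by metis
qed simp

text \<open>
  The order of the odometer divides \<open>p ^ m\<close>. Words shorter than \<open>m\<close> are padded, as
  \<open>dig\<close> describes the action on words of length \<open>m\<close> only.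
\<close>

lemma odometer_pow_fix:
  assumes "w \<in> words p" "m \<le> k"
  shows "(odometer m ^^ (p ^ k)) w = w"
proof -
  let ?w = "w @ replicate m 1" let ?f = "odometer m ^^ (p ^ k)"
  have "?w \<in> words p" using assms replicate_words[of m] by (auto simp: words_def)
  then have "take m ?w \<in> words p" by (auto simp: words_def dest: in_set_takeD)
  moreover have "length (take m ?w) = m" by simp
  ultimately obtain z where z: "take m ?w = dig m z" using dig_surj by blast
  have "p ^ m dvd p ^ k" using assms(2) by (simp add: le_imp_power_dvd)
  then have "dig m (z + p ^ k) = dig m z" by (simp add: dig_eq_iff mod_add_eq[symmetric] dvd_imp_mod_0 flip: mod_add_eq) 
  then have "?f (take m ?w @ drop m ?w) = take m ?w @ drop m ?w" unfolding z by (simp add: odometer_pow_dig)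
  then have "?f ?w = ?w" by (simp only: append_take_drop_id)
  moreover have "take (length w) (?f ?w) = ?f (take (length w) ?w)"
    by (rule auts_take[OF funpow_auts[OF odometer_auts]])
  ultimately show ?thesis by simp
qed

section \<open>Seeds\<close>

definition D_gen :: "nat \<Rightarrow> nat list \<Rightarrow> nat list" where
  "D_gen l = (if l < 5 then spine_rot l else spinal 0)"

lemma D_gen_auts: "D_gen l \<in> auts"
  by (simp add: D_gen_def spine_rot_auts spinal_auts)

lemma D_gens_0: "D_gens 0 = D_gen ` {..<6}"
proof -
  have "{..<6::nat} = insert 5 {..<5}" by auto
  then show ?thesis by (auto simp: D_gens_def D_gen_def image_iff)
qed

text \<open>
  The six generators of \<open>D 0\<close> are planted at the positions \<open>4 ^ 0, \<dots>, 4 ^ 5\<close> on level \<open>n\<close>.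
  For \<open>n \<ge> 12\<close> these positions are different and at most half of \<open>p ^ (n - 1)\<close>.
\<close>

definition seed_sec :: "nat \<Rightarrow> nat list \<Rightarrow> nat list \<Rightarrow> nat list" where
  "seed_sec n u = (if \<exists>l<6. u = dig n (4 ^ l) then D_gen (SOME l. l < 6 \<and> u = dig n (4 ^ l)) else id)"

lemma seed_sec_auts: "seed_sec n u \<in> auts"
  by (simp add: seed_sec_def D_gen_auts id_auts)

definition seed :: "nat \<Rightarrow> nat list \<Rightarrow> nat list" where
  "seed n = base n (seed_sec n)"

lemma seed_auts: "seed n \<in> auts"
  unfolding seed_def by (intro base_auts seed_sec_auts)

lemma p_pow_ge: "12 \<le> n \<Longrightarrow> 2048 \<le> p ^ (n - 1) \<and> 2 * p ^ (n - 1) \<le> p ^ n"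
proof -
  assume n: "12 \<le> n"
  have "(2048::nat) = 2 ^ 11" by simp
  also have "\<dots> \<le> 2 ^ (n - 1)" using n by (intro power_increasing) auto
  also have "\<dots> \<le> p ^ (n - 1)" using p_ge_2 by (intro power_mono) auto
  finally have "2048 \<le> p ^ (n - 1)" .
  moreover have "p ^ n = p * p ^ (n - 1)" using n by (cases n) auto
  ultimately show ?thesis using p_ge_2 by simp
qed

lemma four_pow_le: "l < 6 \<Longrightarrow> (4::nat) ^ l \<le> 1024"
proof -
  assume "l < 6"
  then have "(4::nat) ^ l \<le> 4 ^ 5" by (intro power_increasing) auto
  then show ?thesis by simp
qed

lemma dig_inj: "dig n z = dig n z' \<Longrightarrow> z < p ^ n \<Longrightarrow> z' < p ^ n \<Longrightarrow> z = z'"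
  by (simp add: dig_eq_iff)

lemma seed_sec_dig:
  assumes n: "12 \<le> n" and l: "l < 6"
  shows "seed_sec n (dig n (4 ^ l)) = D_gen l"
proof -
  have small: "4 ^ k < p ^ n" if "k < 6" for k
    using p_pow_ge[OF n] four_pow_le[OF that] by linarith
  have "(SOME k. k < 6 \<and> dig n (4 ^ l) = dig n (4 ^ k)) = l"
  proof (rule some_equality)
    fix k assume "k < 6 \<and> dig n (4 ^ l) = dig n (4 ^ k)"
    then have "(4::nat) ^ l = 4 ^ k" using dig_inj[of n "4 ^ l" "4 ^ k"] small l by blast
    then show "k = l" by simp
  qed (use l in simp)
  then show ?thesis using l by (auto simp: seed_sec_def)
qed

lemma seed_sec_id: "(\<And>l. l < 6 \<Longrightarrow> u \<noteq> dig n (4 ^ l)) \<Longrightarrow> seed_sec n u = id"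
  by (auto simp: seed_sec_def)

lemma odometer_pow_dig': "(odometer n ^^ d) (dig n z) = dig n (z + d)"
  using odometer_pow_dig[of d n z "[]"] by simp

lemma inv_odometer_pow_dig: "inv' (odometer n ^^ d) (dig n (z + d)) = dig n z"
  by (rule inv_app[OF funpow_auts[OF odometer_auts] odometer_pow_dig'])

lemma seed_conj:
  "(odometer n ^^ d) \<circ> seed n \<circ> inv' (odometer n ^^ d) = base n (\<lambda>u. seed_sec n (inv' (odometer n ^^ d) u))"
  unfolding seed_def
  by (rule base_conj) (auto simp: seed_sec_auts funpow_auts odometer_auts intro!: rigid_funpow odometer_rigid)

text \<open>
  Let \<open>\<alpha>\<close> be the power \<open>p ^ (n - 1)\<close> of the odometer and \<open>b\<close> the seed. The commutator of
  \<open>\<alpha>\<close> and \<open>b\<close> lies in \<open>M\<close>; its sections sit at the positions \<open>4 ^ k\<close> and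
  \<open>4 ^ k + p ^ (n - 1)\<close>. Conjugating \<open>b\<close> by a power of the odometer shifts its positions so that
  \<open>4 ^ y\<close> lands on \<open>4 ^ x + p ^ (n - 1)\<close>. A second coincidence would give an equation between
  sums of two powers of four, or a shift by \<open>p ^ (n - 1)\<close> between small numbers, so
  the commutator of the two elements is concentrated in that one position.
\<close>

lemma graft_commutator_D_gen:
  assumes n: "12 \<le> n" and M: "aut_group M"
    and nm: "\<And>q. q \<in> gen {odometer n, seed n} \<Longrightarrow> normalizes q M"
    and top: "odometer n ^^ (p ^ (n - 1)) \<in> M"
    and x: "x < 6" and y: "y < 6" and neq: "x \<noteq> y"
  shows "graft (dig n (4 ^ x + p ^ (n - 1))) (commutator (D_gen x) (D_gen y)) \<in> M"
proof -
  define P where "P = p ^ (n - 1)"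
  have P: "2048 \<le> P" "2 * P \<le> p ^ n" using p_pow_ge[OF n] by (auto simp: P_def)
  define \<alpha> where "\<alpha> = odometer n ^^ P"
  \<comment> \<open>The shift that carries the position \<open>4 ^ y\<close> to \<open>4 ^ x + P\<close>.\<close>
  define d where "d = 4 ^ x + P - 4 ^ y"
  define \<beta> where "\<beta> = odometer n ^^ d"
  define v0 where "v0 = dig n (4 ^ x + P)"
  have lv: "length v0 = n" by (simp add: v0_def)
  have ab: "odometer n \<in> gen {odometer n, seed n}" "seed n \<in> gen {odometer n, seed n}" by (auto intro: gen_base)
  have \<alpha>: "\<alpha> \<in> auts" "\<alpha> \<in> M" using top by (auto simp: \<alpha>_def P_def intro: funpow_auts odometer_auts)
  have \<beta>: "\<beta> \<in> auts" by (auto simp: \<beta>_def intro: funpow_auts odometer_auts)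
  define C where "C u = seed_sec n (inv' \<alpha> u) \<circ> inv' (seed_sec n u)" for u
  define Y where "Y u = seed_sec n (inv' \<beta> u)" for u
  have y4: "(4::nat) ^ k \<le> 1024" "(1::nat) \<le> 4 ^ k" if "k < 6" for k using four_pow_le[OF that] by auto
  have "base n C = (\<alpha> \<circ> seed n \<circ> inv' \<alpha>) \<circ> inv' (seed n)"
    unfolding \<alpha>_def seed_conj unfolding seed_def C_def \<alpha>_def
    by (simp add: base_inv base_comp seed_sec_auts inv_auts)
  also have "\<dots> = \<alpha> \<circ> (seed n \<circ> inv' \<alpha> \<circ> inv' (seed n))" by (simp add: comp_assoc)
  finally have CM: "base n C \<in> M"
    using nm[OF ab(2)] \<alpha> aut_groupD[OF M] unfolding normalizes_def by metis
  have Y: "base n Y \<in> gen {odometer n, seed n}"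
    unfolding Y_def \<beta>_def seed_conj[symmetric] using ab by (intro gen_comp gen_inv funpow_in_gen)
  have Ya: "base n Y \<in> auts" "base n C \<in> auts"
    by (auto simp: Y_def C_def intro!: base_auts comp_auts inv_auts seed_sec_auts)
  have "commutator (base n C) (base n Y) = base n C \<circ> (base n Y \<circ> inv' (base n C) \<circ> inv' (base n Y))"
    by (simp add: commutator_def comp_assoc)
  moreover have "base n Y \<circ> inv' (base n C) \<circ> inv' (base n Y) \<in> M"
    using nm[OF Y] CM aut_groupD(3)[OF M] unfolding normalizes_def by metis
  ultimately have cM: "commutator (base n C) (base n Y) \<in> M" using CM aut_groupD(2)[OF M] by metis
  have iso: "C u = id \<or> Y u = id" if "length u = length v0" "u \<noteq> v0" for u
  proof (rule ccontr)
    assume "\<not> (C u = id \<or> Y u = id)"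
    then have nC: "C u \<noteq> id" and nY: "Y u \<noteq> id" by auto
    from nY obtain l where l: "l < 6" "inv' \<beta> u = dig n (4 ^ l)" unfolding Y_def using seed_sec_id by blast
    then have "u = \<beta> (dig n (4 ^ l))" using bij_eqs(1)[OF bij_auts[OF \<beta>], of u] by simp
    then have u: "u = dig n (4 ^ l + d)" by (simp add: \<beta>_def odometer_pow_dig')
    have b: "4 ^ l + d + 4 ^ y = 4 ^ l + 4 ^ x + P"
      using y4[OF y] P by (simp add: d_def)
    have "4 ^ l + d < p ^ n"
      using b y4(1)[OF l(1)] y4(1)[OF x] y4(2)[OF y] P by linarith
    note bound = this b
    have "seed_sec n u \<noteq> id \<or> seed_sec n (inv' \<alpha> u) \<noteq> id"
      using nC by (auto simp: C_def bij_eqs seed_sec_auts)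
    then consider k where "k < 6" "u = dig n (4 ^ k)" | k where "k < 6" "inv' \<alpha> u = dig n (4 ^ k)"
      using seed_sec_id by blast
    then show False
    proof cases
      case 1
      have "4 ^ l + d = 4 ^ k" using 1 u bound P y4[OF 1(1)] by (intro dig_inj) auto
      then show False using bound y4[OF l(1)] y4[OF x] y4[OF y] y4[OF 1(1)] P by linarith
    next
      case 2
      then have "u = \<alpha> (dig n (4 ^ k))" using bij_eqs(1)[OF bij_auts[OF \<alpha>(1)], of u] by simp
      then have u': "u = dig n (4 ^ k + P)" by (simp add: \<alpha>_def odometer_pow_dig')
      have "4 ^ l + d = 4 ^ k + P" using u u' bound P y4[OF 2(1)] by (intro dig_inj) auto
      then have "(4::nat) ^ l + 4 ^ x = 4 ^ k + 4 ^ y"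
        using bound y4[OF y] P by linarith
      then have "x = k" using four_pow_sum[of l x k y] neq by auto
      then show False using u' that by (simp add: v0_def)
    qed
  qed
  have E: "commutator (base (length v0) C) (base (length v0) Y) = graft v0 (commutator (C v0) (Y v0))"
    by (rule commutator_base) (use iso in \<open>auto simp: C_def Y_def seed_sec_auts comp_auts inv_auts\<close>)
  have Yv: "Y v0 = D_gen y"
  proof -
    have "v0 = dig n (4 ^ y + d)" using y4[OF y] P by (simp add: v0_def d_def)
    then have "inv' \<beta> v0 = dig n (4 ^ y)" by (simp add: \<beta>_def inv_odometer_pow_dig)
    then show ?thesis by (simp add: Y_def seed_sec_dig n y)
  qed
  have Cv: "C v0 = D_gen x"
  proof -
    have "inv' \<alpha> v0 = dig n (4 ^ x)" by (simp add: \<alpha>_def v0_def inv_odometer_pow_dig)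
    moreover have "seed_sec n v0 = id"
    proof (rule seed_sec_id)
      fix l :: nat assume l: "l < 6"
      show "v0 \<noteq> dig n (4 ^ l)"
      proof
        assume "v0 = dig n (4 ^ l)"
        then have "4 ^ x + P = 4 ^ l" unfolding v0_def using P y4[OF l] y4[OF x] by (intro dig_inj) auto
        then show False using y4[OF l] P by linarith
      qed
    qed
    ultimately show ?thesis by (simp add: C_def seed_sec_dig n x)
  qed
  show ?thesis
    using cM E[unfolded Yv Cv] unfolding lv v0_def[symmetric] P_def[symmetric] by simp
qed

text \<open>
  The commutators of two generators of \<open>D 0\<close> are available at one vertex of level \<open>n\<close> by the
  previous lemma, hence at all of them, because the odometer acts transitively. A high power of
  the odometer is the only source of elements of \<open>M\<close>, so \<open>M\<close> may consist of elements that are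
  trivial wherever smaller odometers act.
\<close>

lemma graft_derived_odometer:
  assumes n: "12 \<le> n" and M: "aut_group M"
    and nm: "\<And>q. q \<in> gen {odometer n, seed n} \<Longrightarrow> normalizes q M"
    and top: "odometer n ^^ (p ^ (n - 1)) \<in> M"
    and v: "v \<in> words p" "length v = n" and h: "h \<in> derived_gp (D_gens 0)"
  shows "graft v h \<in> M"
proof (rule graft_derived[OF M D_gens_auts _ _ h])
  obtain zz where zz: "zz < p ^ n" "v = dig n zz" using dig_surj[OF v] by blast
  have P: "2048 \<le> p ^ (n - 1)" "2 * p ^ (n - 1) \<le> p ^ n" using p_pow_ge[OF n] by auto
  have ab: "odometer n \<in> gen {odometer n, seed n}" "seed n \<in> gen {odometer n, seed n}" by (auto intro: gen_base)
  {
    fix z assume "z \<in> D_gens 0"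
    then obtain l where l: "l < 6" "z = D_gen l" by (auto simp: D_gens_0)
    \<comment> \<open>Adding \<open>p ^ n\<close> does not change digits and keeps the subtraction exact.\<close>
    define d where "d = zz + p ^ n - 4 ^ l"
    have "4 ^ l + d = zz + p ^ n" using four_pow_le[OF l(1)] P by (simp add: d_def)
    then have "v = dig n (4 ^ l + d)" using zz by (simp add: dig_eq_iff)
    then have "inv' (odometer n ^^ d) v = dig n (4 ^ l)" by (simp add: inv_odometer_pow_dig)
    then have "seed_sec n (inv' (odometer n ^^ d) v) = z" using l n by (simp add: seed_sec_dig)
    moreover have "base n (\<lambda>u. seed_sec n (inv' (odometer n ^^ d) u)) \<in> gen {odometer n, seed n}"
      unfolding seed_conj[symmetric] using ab by (intro gen_comp gen_inv funpow_in_gen)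
    ultimately show "\<exists>Q. (\<forall>u. length u = length v \<longrightarrow> Q u \<in> auts) \<and> Q v = z \<and> normalizes (base (length v) Q) M"
      using nm v(2) by (intro exI[of _ "\<lambda>u. seed_sec n (inv' (odometer n ^^ d) u)"]) (auto simp: seed_sec_auts)
  }
  fix g1 g2 assume "g1 \<in> D_gens 0" "g2 \<in> D_gens 0"
  then obtain x y where xy: "x < 6" "y < 6" "g1 = D_gen x" "g2 = D_gen y" by (auto simp: D_gens_0)
  show "graft v (commutator g1 g2) \<in> M"
  proof (cases "x = y")
    case True
    have "commutator (D_gen y) (D_gen y) = id"
      by (rule ext) (simp add: commutator_def bij_eqs[OF bij_auts[OF D_gen_auts]])
    then have "commutator g1 g2 = id" using True xy by simp
    then have "graft v (commutator g1 g2) = graft v id" by metis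
    also have "\<dots> = id" by (rule graft_id)
    finally have "graft v (commutator g1 g2) = id" .
    then show ?thesis using aut_groupD(1)[OF M] by metis
  next
    case False
    let ?v0 = "dig n (4 ^ x + p ^ (n - 1))"
    define d where "d = zz + p ^ n - (4 ^ x + p ^ (n - 1))"
    have "4 ^ x + p ^ (n - 1) + d = zz + p ^ n" using four_pow_le[OF xy(1)] P by (simp add: d_def)
    then have dv: "(odometer n ^^ d) ?v0 = v" unfolding odometer_pow_dig' using zz by (simp add: dig_eq_iff)
    have oa: "odometer n ^^ d \<in> auts" by (intro funpow_auts odometer_auts)
    have ca: "commutator g1 g2 \<in> auts" using xy by (auto intro: commutator_auts D_gen_auts)
    have "rigid (length ?v0) (odometer n ^^ d)" by (auto intro!: rigid_funpow odometer_rigid odometer_auts)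
    from graft_conj[OF ca oa this] have "(odometer n ^^ d) \<circ> graft ?v0 (commutator g1 g2) \<circ> inv' (odometer n ^^ d) = graft v (commutator g1 g2)"
      unfolding dv .
    moreover have "graft ?v0 (commutator g1 g2) \<in> M"
      unfolding xy(3,4) by (rule graft_commutator_D_gen[OF n M nm top xy(1,2) False])
    moreover have "normalizes (odometer n ^^ d) M" using ab by (intro nm funpow_in_gen)
    ultimately show ?thesis unfolding normalizes_def by metis
  qed
qed

section \<open>Two generators along a ray\<close>

text \<open>
  The automorphism with section \<open>F i y\<close> at the vertex \<open>1\<^sup>i y\<close>, \<open>y \<noteq> 1\<close>, which fixes the ray
  \<open>111\<dots>\<close>. These automorphisms form the direct product of the automorphism groups of the
  trees hanging off the ray.
\<close>

fun along_ray :: "(nat \<Rightarrow> nat \<Rightarrow> nat list \<Rightarrow> nat list) \<Rightarrow> nat list \<Rightarrow> nat list" where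
  "along_ray F [] = []"
| "along_ray F (y # w) = (if y = 1 then 1 # along_ray (\<lambda>i. F (Suc i)) w else y # F 0 y w)"

lemma along_ray_spine: "y \<noteq> 1 \<Longrightarrow> along_ray F (replicate i 1 @ y # w) = replicate i 1 @ y # F i y w"
  by (induction i arbitrary: F) auto

lemma along_ray_replicate: "along_ray F (replicate i 1) = replicate i 1"
  by (induction i arbitrary: F) auto

lemmas along_ray_simps = along_ray_spine[unfolded One_nat_def] along_ray_replicate[unfolded One_nat_def]

lemma spine_cases:
  obtains i where "w = replicate i (1::nat)" | i y w' where "y \<noteq> 1" "w = replicate i 1 @ y # w'"
proof (induction w arbitrary: thesis)
  case Nil
  then show ?case by (metis replicate_0)
next
  case (Cons y w)
  show ?case
  proof (cases "y = 1")
    case True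
    show ?thesis
    proof (rule Cons.IH)
      fix i assume "w = replicate i 1"
      then show thesis using True Cons.prems(1)[of "Suc i"] by simp
    next
      fix i z w' assume "z \<noteq> 1" "w = replicate i 1 @ z # w'"
      then show thesis using True Cons.prems(2)[of z "Suc i" w'] by simp
    qed
  next
    case False
    then show ?thesis using Cons.prems(2)[of y 0 w] by simp
  qed
qed

lemma along_ray_eqI:
  assumes "\<And>i. f (replicate i 1) = replicate i 1"
    "\<And>i y w. y \<noteq> 1 \<Longrightarrow> f (replicate i 1 @ y # w) = replicate i 1 @ y # F i y w"
  shows "f = along_ray F"
proof
  fix w show "f w = along_ray F w"
    by (cases w rule: spine_cases) (use assms in \<open>simp_all add: along_ray_simps\<close>)
qed

lemma along_ray_auts:
  assumes "\<And>i y. F i y \<in> auts"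
  shows "along_ray F \<in> auts"
proof (rule autsI)
  fix v :: "nat list"
  show "\<exists>k. \<forall>x. along_ray F (v @ [x]) = along_ray F v @ [(\<sigma> ^^ k) x]"
    using assms
  proof (induction v arbitrary: F)
    case Nil
    then show ?case by (auto simp: auts_Nil intro: exI[of _ 0])
  next
    case (Cons y v)
    show ?case
    proof (cases "y = 1")
      case True
      then show ?thesis using Cons.IH[of "\<lambda>i. F (Suc i)"] Cons.prems by simp
    next
      case False
      then show ?thesis using auts_snoc[OF Cons.prems, of 0 y v] by simp
    qed
  qed
qed simp

lemma along_ray_comp: "along_ray F \<circ> along_ray G = along_ray (\<lambda>i y. F i y \<circ> G i y)"
  by (rule along_ray_eqI) (simp_all add: along_ray_simps)

lemma along_ray_id: "along_ray (\<lambda>i y. id) = id"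
  by (rule along_ray_eqI[symmetric]) auto

lemma along_ray_inv:
  assumes "\<And>i y. F i y \<in> auts"
  shows "inv' (along_ray F) = along_ray (\<lambda>i y. inv' (F i y))"
proof (rule inv_eqI)
  show "bij (along_ray F)" using assms along_ray_auts by simp
  have "along_ray F \<circ> along_ray (\<lambda>i y. inv' (F i y)) = along_ray (\<lambda>i y. F i y \<circ> inv' (F i y))" by (rule along_ray_comp)
  also have "(\<lambda>i y. F i y \<circ> inv' (F i y)) = (\<lambda>i y. id)" using assms by (simp add: bij_eqs)
  finally show "along_ray F \<circ> along_ray (\<lambda>i y. inv' (F i y)) = id" unfolding along_ray_id .
qed

lemma along_ray_funpow: "along_ray F ^^ k = along_ray (\<lambda>i y. F i y ^^ k)"
proof (induction k)
  case 0
  then show ?case using along_ray_id by (simp add: id_def)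
next
  case (Suc k)
  show ?case unfolding funpow.simps(2) Suc along_ray_comp ..
qed

text \<open>
  If \<open>c\<close> is a sequence of digits, the active vertices \<open>1\<^sup>i y\<close> are those with \<open>2 \<le> y \<le> c i + 1\<close>.
  Their weights \<open>p ^ -(i + 1)\<close> sum up to the number with the digits \<open>c\<close> in base \<open>p\<close>.
\<close>

definition active :: "(nat \<Rightarrow> nat) \<Rightarrow> nat \<Rightarrow> nat \<Rightarrow> bool" where
  "active c i y \<longleftrightarrow> 2 \<le> y \<and> y \<le> Suc (c i)"

text \<open>
  The exponent of the order of the odometer below \<open>1\<^sup>i y\<close>. It is injective on the
  vertices hanging off the ray and thereby orders them; the summand 12 is what the seed
  needs.
\<close>

definition depth :: "nat \<Rightarrow> nat \<Rightarrow> nat" where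
  "depth i y = 12 + i * p + y"

definition odometers :: "(nat \<Rightarrow> nat) \<Rightarrow> nat \<Rightarrow> nat \<Rightarrow> nat list \<Rightarrow> nat list" where
  "odometers c i y = (if active c i y then odometer (depth i y) else id)"

definition seeds :: "(nat \<Rightarrow> nat) \<Rightarrow> nat \<Rightarrow> nat \<Rightarrow> nat list \<Rightarrow> nat list" where
  "seeds c i y = (if active c i y then seed (depth i y) else id)"

definition two_gen :: "(nat \<Rightarrow> nat) \<Rightarrow> (nat list \<Rightarrow> nat list) set" where
  "two_gen c = gen {along_ray (odometers c), along_ray (seeds c)}"

lemma coordinate_auts: "odometers c i y \<in> auts" "seeds c i y \<in> auts"
  by (simp_all add: odometers_def seeds_def odometer_auts seed_auts id_auts)

lemma two_gen_gens_auts: "{along_ray (odometers c), along_ray (seeds c)} \<subseteq> auts"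
  by (auto intro: along_ray_auts coordinate_auts)

lemma aut_group_two_gen: "aut_group (two_gen c)"
  unfolding two_gen_def by (rule aut_group_gen[OF two_gen_gens_auts])

definition earlier_trivial :: "nat \<Rightarrow> nat \<Rightarrow> (nat \<Rightarrow> nat \<Rightarrow> nat list \<Rightarrow> nat list) \<Rightarrow> bool" where
  "earlier_trivial i y F \<longleftrightarrow> (\<forall>i' y'. 2 \<le> y' \<longrightarrow> y' \<le> p \<longrightarrow> depth i' y' < depth i y \<longrightarrow>
     (\<forall>w\<in>words p. F i' y' w = w))"

text \<open>
  What the group induces below \<open>1\<^sup>i y\<close> through those elements that are trivial below all
  vertices hanging off the ray that have smaller depth.
\<close>

definition tail_group :: "(nat \<Rightarrow> nat) \<Rightarrow> nat \<Rightarrow> nat \<Rightarrow> (nat list \<Rightarrow> nat list) set" where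
  "tail_group c i y = {F i y | F. (\<forall>i y. F i y \<in> auts) \<and> along_ray F \<in> two_gen c \<and> earlier_trivial i y F}"

lemma aut_group_tail: "aut_group (tail_group c i y)"
  unfolding aut_group_def
proof (intro conjI ballI)
  show "tail_group c i y \<subseteq> auts" by (auto simp: tail_group_def)
  show "id \<in> tail_group c i y"
    unfolding tail_group_def mem_Collect_eq
  proof (intro exI conjI)
    show "along_ray (\<lambda>i y. id) \<in> two_gen c" unfolding along_ray_id using aut_groupD(1)[OF aut_group_two_gen] .
  qed (auto simp: id_auts earlier_trivial_def)
next
  fix f g assume "f \<in> tail_group c i y" "g \<in> tail_group c i y"
  then obtain F F' where F: "f = F i y" "\<forall>i y. F i y \<in> auts" "along_ray F \<in> two_gen c" "earlier_trivial i y F"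
    and F': "g = F' i y" "\<forall>i y. F' i y \<in> auts" "along_ray F' \<in> two_gen c" "earlier_trivial i y F'"
    by (auto simp: tail_group_def)
  show "f \<circ> g \<in> tail_group c i y"
    unfolding tail_group_def mem_Collect_eq
  proof (intro exI conjI)
    show "f \<circ> g = (\<lambda>i y. F i y \<circ> F' i y) i y" using F F' by simp
    show "along_ray (\<lambda>i y. F i y \<circ> F' i y) \<in> two_gen c"
      using F F' aut_groupD(2)[OF aut_group_two_gen] by (metis along_ray_comp)
    show "\<forall>i y. F i y \<circ> F' i y \<in> auts" using F F' comp_auts by blast
    show "earlier_trivial i y (\<lambda>i y. F i y \<circ> F' i y)" using F F' by (simp add: earlier_trivial_def)
  qed
next
  fix f assume "f \<in> tail_group c i y"
  then obtain F where F: "f = F i y" "\<forall>i y. F i y \<in> auts" "along_ray F \<in> two_gen c" "earlier_trivial i y F"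
    by (auto simp: tail_group_def)
  show "inv' f \<in> tail_group c i y"
    unfolding tail_group_def mem_Collect_eq
  proof (intro exI conjI)
    show "inv' f = (\<lambda>i y. inv' (F i y)) i y" using F by simp
    show "along_ray (\<lambda>i y. inv' (F i y)) \<in> two_gen c"
      using F aut_groupD(3)[OF aut_group_two_gen] by (metis along_ray_inv)
    show "earlier_trivial i y (\<lambda>i y. inv' (F i y))"
      unfolding earlier_trivial_def
    proof (intro allI impI ballI)
      fix i' y' w assume "2 \<le> y'" "y' \<le> p" "depth i' y' < depth i y" "w \<in> words p"
      then have "F i' y' w = w" using F by (auto simp: earlier_trivial_def)
      then show "inv' (F i' y') w = w" using inv_app F(2) by blast
    qed
  qed (use F in \<open>auto simp: inv_auts\<close>)
qed

lemma earlier_trivial_conj: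
  assumes "\<And>i y. F i y \<in> auts" "earlier_trivial i y F'"
  shows "earlier_trivial i y (\<lambda>i y. F i y \<circ> F' i y \<circ> inv' (F i y))"
  unfolding earlier_trivial_def
proof (intro allI impI ballI)
  fix i' y' w assume a: "2 \<le> y'" "y' \<le> p" "depth i' y' < depth i y" "w \<in> words p"
  have "inv' (F i' y') w \<in> words p" using a(4) auts_words[OF inv_auts[OF assms(1)]] by blast
  then have "F' i' y' (inv' (F i' y') w) = inv' (F i' y') w"
    using assms(2) a by (auto simp: earlier_trivial_def)
  then show "(F i' y' \<circ> F' i' y' \<circ> inv' (F i' y')) w = w" using assms(1) by (simp add: bij_eqs)
qed

lemma normalizes_tail_aux:
  assumes F: "\<And>i y. F i y \<in> auts" "along_ray F \<in> two_gen c" and f: "f \<in> tail_group c i y"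
  shows "F i y \<circ> f \<circ> inv' (F i y) \<in> tail_group c i y"
proof -
  obtain F' where F': "f = F' i y" "\<forall>i y. F' i y \<in> auts" "along_ray F' \<in> two_gen c" "earlier_trivial i y F'"
    using f by (auto simp: tail_group_def)
  show ?thesis
    unfolding tail_group_def mem_Collect_eq
  proof (intro exI conjI)
    show "F i y \<circ> f \<circ> inv' (F i y) = (\<lambda>i y. F i y \<circ> F' i y \<circ> inv' (F i y)) i y" using F' by simp
    have "along_ray (\<lambda>i y. F i y \<circ> F' i y \<circ> inv' (F i y)) = along_ray F \<circ> along_ray F' \<circ> inv' (along_ray F)"
      using F by (simp add: along_ray_inv along_ray_comp)
    moreover have "along_ray F \<circ> along_ray F' \<circ> inv' (along_ray F) \<in> two_gen c"
      by (intro aut_groupD(2,3)[OF aut_group_two_gen] F(2) F'(3))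
    ultimately show "along_ray (\<lambda>i y. F i y \<circ> F' i y \<circ> inv' (F i y)) \<in> two_gen c" by (simp only:)
    show "\<forall>i y. F i y \<circ> F' i y \<circ> inv' (F i y) \<in> auts" by (intro allI comp_auts inv_auts F(1) F'(2)[rule_format])
    show "earlier_trivial i y (\<lambda>i y. F i y \<circ> F' i y \<circ> inv' (F i y))"
      by (rule earlier_trivial_conj[OF F(1) F'(4)])
  qed
qed

lemma normalizes_tail:
  assumes F: "\<And>i y. F i y \<in> auts" "along_ray F \<in> two_gen c"
  shows "normalizes (F i y) (tail_group c i y)"
proof -
  have *: "along_ray (\<lambda>i y. inv' (F i y)) \<in> two_gen c" using F aut_groupD(3)[OF aut_group_two_gen] by (metis along_ray_inv)
  show ?thesis
    unfolding normalizes_def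
  proof (intro ballI conjI)
    fix f assume f: "f \<in> tail_group c i y"
    show "F i y \<circ> f \<circ> inv' (F i y) \<in> tail_group c i y" using normalizes_tail_aux[OF F f] .
    have "inv' (F i y) \<circ> f \<circ> inv' (inv' (F i y)) \<in> tail_group c i y"
      by (rule normalizes_tail_aux[OF _ * f]) (rule inv_auts[OF F(1)])
    then show "inv' (F i y) \<circ> f \<circ> F i y \<in> tail_group c i y" using F by (simp add: bij_eqs)
  qed
qed

text \<open>
  Below a vertex of smaller depth the odometer has order dividing \<open>p ^ (depth i y - 1)\<close>, so the
  corresponding power of the first generator acts trivially there.
\<close>

lemma tail_group_graft:
  assumes act: "active c i y" and v: "v \<in> words p" "length v = depth i y"
    and h: "h \<in> derived_gp (D_gens 0)"
  shows "graft v h \<in> tail_group c i y"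
proof (rule graft_derived_odometer[OF _ aut_group_tail _ _ v h])
  show "12 \<le> depth i y" by (simp add: depth_def)
  have AB: "along_ray (odometers c) \<in> two_gen c" "along_ray (seeds c) \<in> two_gen c" unfolding two_gen_def by (auto intro: gen_base)
  have ab: "odometer (depth i y) = odometers c i y" "seed (depth i y) = seeds c i y"
    using act by (simp_all add: odometers_def seeds_def)
  show "normalizes q (tail_group c i y)" if "q \<in> gen {odometer (depth i y), seed (depth i y)}" for q
  proof (rule normalizes_gen[OF _ aut_group_tail _ that])
    show "{odometer (depth i y), seed (depth i y)} \<subseteq> auts" by (simp add: odometer_auts seed_auts)
    fix q assume "q \<in> {odometer (depth i y), seed (depth i y)}"
    then show "normalizes q (tail_group c i y)"
      using normalizes_tail[OF coordinate_auts(1) AB(1), of i y] normalizes_tail[OF coordinate_auts(2) AB(2), of i y] ab by auto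
  qed
  let ?k = "p ^ (depth i y - 1)"
  show "odometer (depth i y) ^^ ?k \<in> tail_group c i y"
    unfolding tail_group_def mem_Collect_eq
  proof (rule exI[of _ "\<lambda>i y. odometers c i y ^^ ?k"], intro conjI)
    show "odometer (depth i y) ^^ ?k = (\<lambda>i y. odometers c i y ^^ ?k) i y" unfolding ab(1) ..
    show "\<forall>i y. odometers c i y ^^ ?k \<in> auts" using funpow_auts[OF coordinate_auts(1)] by blast
    show "along_ray (\<lambda>i y. odometers c i y ^^ ?k) \<in> two_gen c"
      unfolding along_ray_funpow[symmetric] using AB(1) unfolding two_gen_def by (intro funpow_in_gen)
    show "earlier_trivial i y (\<lambda>i y. odometers c i y ^^ ?k)"
      unfolding earlier_trivial_def
    proof (intro allI impI ballI)
      fix i' y' w assume a: "depth i' y' < depth i y" "w \<in> words p"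
      then show "(odometers c i' y' ^^ ?k) w = w"
        using odometer_pow_fix[OF a(2), of "depth i' y'" "depth i y - 1"] by (simp add: odometers_def)
    qed
  qed
qed

section \<open>Counting the action on a level\<close>

definition level :: "nat \<Rightarrow> nat list set" where
  "level n = {w \<in> words p. length w = n}"

definition levelmap :: "nat \<Rightarrow> (nat list \<Rightarrow> nat list) \<Rightarrow> nat list \<Rightarrow> nat list" where
  "levelmap n f = restrict f (level n)"

text \<open>
  The number of vertices of level less than \<open>n\<close>.
\<close>

definition nverts :: "nat \<Rightarrow> nat" where
  "nverts n = (\<Sum>k<n. p ^ k)"

lemma level_alt: "level n = {w. set w \<subseteq> {1..p} \<and> length w = n}"
  by (auto simp: level_def words_def)

lemma finite_level [simp]: "finite (level n)"
  unfolding level_alt by (rule finite_lists_length_eq) simp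

lemma card_level: "card (level n) = p ^ n"
  unfolding level_alt by (subst card_lists_length_eq) auto

lemma finite_words_less: "finite {w \<in> words p. length w < n}"
  and card_words_less: "card {w \<in> words p. length w < n} = nverts n"
proof -
  have *: "{w \<in> words p. length w < n} = (\<Union>k<n. level k)" by (auto simp: level_def)
  have disj: "level i \<inter> level j = {}" if "i \<noteq> j" for i j using that by (auto simp: level_def)
  show "finite {w \<in> words p. length w < n}" unfolding * by simp
  show "card {w \<in> words p. length w < n} = nverts n"
    unfolding * nverts_def using disj by (subst card_UN_disjoint) (simp_all add: card_level)
qed

lemma levelmap_eq_iff: "levelmap n f = levelmap n g \<longleftrightarrow> (\<forall>w\<in>level n. f w = g w)"
  unfolding levelmap_def restrict_def fun_eq_iff by metis

lemma levelmap_eqD: "levelmap n f = levelmap n g \<Longrightarrow> w \<in> level n \<Longrightarrow> f w = g w"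
  by (simp add: levelmap_eq_iff)

lemma levelmap_eq_shorter:
  assumes "f \<in> auts" "g \<in> auts" "levelmap n f = levelmap n g" "w \<in> words p" "length w \<le> n"
  shows "f w = g w"
proof -
  let ?w = "w @ replicate (n - length w) 1"
  have "?w \<in> level n"
    using assms(4,5) replicate_words[of "n - length w"] by (auto simp: level_def words_def)
  then have "take (length w) (f ?w) = take (length w) (g ?w)" using assms(3) levelmap_eq_iff by metis
  then show ?thesis by (simp add: auts_take assms(1,2))
qed

lemma finite_levelmap:
  assumes "\<And>f w. f \<in> H \<Longrightarrow> w \<in> level n \<Longrightarrow> f w \<in> level n"
  shows "finite (levelmap n ` H)"
proof (rule finite_subset)
  show "levelmap n ` H \<subseteq> level n \<rightarrow>\<^sub>E level n" using assms by (auto simp: levelmap_def)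
qed (simp add: finite_PiE)

lemma auts_level: "f \<in> auts \<Longrightarrow> w \<in> level n \<Longrightarrow> f w \<in> level n"
  by (simp add: level_def auts_words)

lemma finite_levelmap_auts: "H \<subseteq> auts \<Longrightarrow> finite (levelmap n ` H)"
  by (rule finite_levelmap) (auto intro: auts_level)

lemma funpow_in_group: "aut_group H \<Longrightarrow> f \<in> H \<Longrightarrow> f ^^ k \<in> H"
proof (induction k)
  case 0
  then show ?case using aut_groupD(1)[of H] by (simp add: id_def)
next
  case (Suc k)
  then show ?case unfolding funpow.simps(2) by (intro aut_groupD(2))
qed

text \<open>
  The powers of \<open>g\<close> move the child \<open>v1\<close> to \<open>p\<close> different places, while \<open>K\<close> fixes it. So
  the cosets \<open>g ^ k K\<close> for \<open>k < p\<close> are told apart by the action on level \<open>N\<close>.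
\<close>

lemma orbit_count:
  assumes H: "aut_group H" and g: "g \<in> H" and v: "v \<in> words p" "length v < N"
    and move: "\<And>x. x \<in> {1..p} \<Longrightarrow> g (v @ [x]) = v @ [\<sigma> x]"
    and K: "K \<subseteq> H" "\<And>h. h \<in> K \<Longrightarrow> h (v @ [1]) = v @ [1]"
  shows "p * card (levelmap N ` K) \<le> card (levelmap N ` H)"
proof -
  have Ha: "H \<subseteq> auts" using aut_groupD(4)[OF H] by blast
  have ga: "g \<in> auts" using g Ha by blast
  obtain Q where Q: "Q \<subseteq> K" "inj_on (levelmap N) Q" "levelmap N ` Q = levelmap N ` K"
    using subset_image_inj[of "levelmap N ` K" "levelmap N" K] by auto
  have fin: "finite (levelmap N ` H)" by (rule finite_levelmap_auts[OF Ha])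
  have one: "1 \<in> {1..p}" using p_ge_2 by simp
  have v1: "v @ [1] \<in> words p" "length (v @ [1]) \<le> N" using v one by auto
  have pow: "(g ^^ k) (v @ [x]) = v @ [(\<sigma> ^^ k) x]" if "x \<in> {1..p}" for k x
    by (induction k) (use move \<sigma>_pow_in[OF that] in auto)
  define \<phi> where "\<phi> = (\<lambda>(k, h). levelmap N (g ^^ k \<circ> h))"
  have "inj_on \<phi> ({..<p} \<times> Q)"
  proof (rule inj_onI, clarify)
    fix k h k' h' assume k: "k < p" "k' < p" and h: "h \<in> Q" "h' \<in> Q" and eq: "\<phi> (k, h) = \<phi> (k', h')"
    have a: "g ^^ k \<circ> h \<in> auts" "g ^^ k' \<circ> h' \<in> auts"
      using h Q(1) K(1) Ha ga by (auto intro!: comp_auts funpow_auts)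
    have L: "levelmap N (g ^^ k \<circ> h) = levelmap N (g ^^ k' \<circ> h')" using eq by (simp add: \<phi>_def)
    have "(g ^^ k \<circ> h) (v @ [1]) = (g ^^ k' \<circ> h') (v @ [1])"
      by (rule levelmap_eq_shorter[OF a L v1])
    moreover have "h (v @ [1]) = v @ [1]" "h' (v @ [1]) = v @ [1]" using h Q(1) K(2) by auto
    ultimately have "(\<sigma> ^^ k) 1 = (\<sigma> ^^ k') 1" using pow[OF one] by simp
    then have kk: "k = k'" using \<sigma>_pow_on[of 0 k] \<sigma>_pow_on[of 0 k'] k by simp
    have "bij (g ^^ k)" by (rule bij_auts[OF funpow_auts[OF ga]])
    then have "levelmap N h = levelmap N h'"
      using L unfolding kk levelmap_eq_iff by (auto dest: bij_is_inj injD)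
    then show "k = k' \<and> h = h'" using kk Q(2) h by (auto dest: inj_onD)
  qed
  moreover have "\<phi> ` ({..<p} \<times> Q) \<subseteq> levelmap N ` H"
  proof clarify
    fix k h assume "h \<in> Q"
    then have "g ^^ k \<circ> h \<in> H"
      using Q(1) K(1) by (intro aut_groupD(2)[OF H] funpow_in_group[OF H g]) auto
    then show "\<phi> (k, h) \<in> levelmap N ` H" by (simp add: \<phi>_def)
  qed
  ultimately have "card ({..<p} \<times> Q) \<le> card (levelmap N ` H)"
    using fin by (rule card_inj_on_le)
  moreover have "card Q = card (levelmap N ` K)" using card_image[OF Q(2)] Q(3) by simp
  ultimately show ?thesis by (simp add: card_cartesian_product)
qed

text \<open>
  Each index contributes a factor \<open>p\<close>: remove an index of least key and pass to the
  subgroup that fixes the children of its vertex. The elements for the remaining indices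
  lie in this subgroup, however they act on vertices with larger key.
\<close>

lemma triangular_count:
  fixes vt :: "'i \<Rightarrow> nat list" and g :: "'i \<Rightarrow> nat list \<Rightarrow> nat list" and key :: "'i \<Rightarrow> nat"
  assumes "finite I" "aut_group H"
    and "\<And>i. i \<in> I \<Longrightarrow> g i \<in> H"
    and "\<And>i. i \<in> I \<Longrightarrow> vt i \<in> words p" "\<And>i. i \<in> I \<Longrightarrow> length (vt i) < N"
    and "\<And>i x. i \<in> I \<Longrightarrow> x \<in> {1..p} \<Longrightarrow> g i (vt i @ [x]) = vt i @ [\<sigma> x]"
    and "\<And>i j x. i \<in> I \<Longrightarrow> j \<in> I \<Longrightarrow> i \<noteq> j \<Longrightarrow> key j \<le> key i \<Longrightarrow> x \<in> {1..p} \<Longrightarrow> g i (vt j @ [x]) = vt j @ [x]"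
  shows "p ^ card I \<le> card (levelmap N ` H)"
  using assms
proof (induction "card I" arbitrary: I H)
  case 0
  then have "finite (levelmap N ` H)" "levelmap N ` H \<noteq> {}"
    using aut_groupD(1,4)[OF 0(3)] by (auto intro!: finite_levelmap_auts)
  then have "1 \<le> card (levelmap N ` H)" by (simp add: Suc_le_eq card_gt_0_iff)
  then show ?case using 0 by simp
next
  case (Suc m)
  note prems = Suc.prems
  have "I \<noteq> {}" using Suc.hyps(2) by auto
  then obtain j where j: "j \<in> I" "\<And>i. i \<in> I \<Longrightarrow> key j \<le> key i"
    using arg_min_if_finite[of I key] prems(1) by (metis leI)
  define K where "K = {h \<in> H. \<forall>x\<in>{1..p}. h (vt j @ [x]) = vt j @ [x]}"
  have Ha: "H \<subseteq> auts" using aut_groupD(4)[OF prems(2)] by blast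
  have K: "aut_group K"
    unfolding aut_group_def
  proof (intro conjI ballI)
    show "K \<subseteq> auts" using Ha by (auto simp: K_def)
    show "id \<in> K" using aut_groupD(1)[OF prems(2)] by (simp add: K_def)
    show "f \<circ> h \<in> K" if "f \<in> K" "h \<in> K" for f h
      using that aut_groupD(2)[OF prems(2)] unfolding K_def by simp
    show "inv' f \<in> K" if "f \<in> K" for f
      using that aut_groupD(3)[OF prems(2)] Ha unfolding K_def by (auto intro!: inv_app)
  qed
  have "p ^ card (I - {j}) \<le> card (levelmap N ` K)"
  proof (rule Suc.hyps(1)[OF _ _ K])
    show "m = card (I - {j})" "finite (I - {j})" using Suc.hyps(2) prems(1) j(1) by auto
    show "g i \<in> K" if "i \<in> I - {j}" for i
      using that prems(3) prems(7)[of i j] j by (auto simp: K_def)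
  qed (use prems in auto)
  moreover have "p * card (levelmap N ` K) \<le> card (levelmap N ` H)"
    by (rule orbit_count[OF prems(2) prems(3)[OF j(1)] prems(4)[OF j(1)] prems(5)[OF j(1)] prems(6)[OF j(1)]])
      (use p_ge_2 in \<open>auto simp: K_def\<close>)
  moreover have "p ^ card I = p * p ^ card (I - {j})"
    using j(1) prems(1) by (metis card.remove power_Suc)
  ultimately show ?case by (metis mult_le_mono2 order_trans)
qed

text \<open>
  An automorphism is determined on level \<open>N\<close> by its labels above that level, and the labels
  outside \<open>V\<close> are trivial.
\<close>

lemma label_count:
  fixes H :: "(nat list \<Rightarrow> nat list) set"
  assumes nil: "\<And>f. f \<in> H \<Longrightarrow> f [] = []"
    and lab: "\<And>f v. f \<in> H \<Longrightarrow> v \<in> words p \<Longrightarrow> \<exists>k<p. \<forall>x\<in>{1..p}. f (v @ [x]) = f v @ [(\<sigma> ^^ k) x]"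
    and V: "finite V"
    and outside: "\<And>f v x. f \<in> H \<Longrightarrow> v \<in> words p \<Longrightarrow> v \<notin> V \<Longrightarrow> length v < N \<Longrightarrow> x \<in> {1..p} \<Longrightarrow> f (v @ [x]) = f v @ [x]"
  shows "card (levelmap N ` H) \<le> p ^ card V"
proof -
  define P where "P f v k \<longleftrightarrow> (k < p \<and> (\<forall>x\<in>{1..p}. f (v @ [x]) = f v @ [(\<sigma> ^^ k) x]))" for f v k
  define L where "L f = restrict (\<lambda>v. if v \<in> words p then SOME k. P f v k else 0) V" for f
  have P: "P f v (SOME k. P f v k)" if "f \<in> H" "v \<in> words p" for f v
  proof (rule someI_ex)
    show "\<exists>k. P f v k" unfolding P_def by (rule lab[OF that])
  qed
  have Pf: "f (v @ [x]) = f v @ [(\<sigma> ^^ k) x]" if "P f v k" "x \<in> {1..p}" for f v k x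
    using that by (simp add: P_def)
  have Plt: "(SOME k. P f v k) < p" if "f \<in> H" "v \<in> words p" for f v
    using P[OF that] by (auto simp: P_def)
  have "L ` H \<subseteq> V \<rightarrow>\<^sub>E {..<p}"
    using Plt p_ge_2 by (auto simp: L_def)
  moreover have fin: "finite (V \<rightarrow>\<^sub>E {..<p})" using V by (simp add: finite_PiE)
  ultimately have LH: "finite (L ` H)" "card (L ` H) \<le> p ^ card V"
    using card_mono[OF fin] V by (auto simp: card_PiE intro: finite_subset)
  have determined: "levelmap N f = levelmap N g" if fg: "f \<in> H" "g \<in> H" "L f = L g" for f g
  proof -
    have "f w = g w" if "w \<in> words p" "length w \<le> N" for w
      using that
    proof (induction w rule: rev_induct)
      case Nil
      show ?case using nil[OF fg(1)] nil[OF fg(2)] by simp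
    next
      case (snoc x v)
      then have v: "v \<in> words p" "x \<in> {1..p}" "length v < N" "f v = g v" by auto
      show ?case
      proof (cases "v \<in> V")
        case True
        have "(SOME k. P f v k) = (SOME k. P g v k)"
          using fun_cong[OF fg(3), of v] True v(1) by (simp add: L_def)
        then show ?thesis
          using Pf[OF P[OF fg(1) v(1)] v(2)] Pf[OF P[OF fg(2) v(1)] v(2)] v(4) by simp
      next
        case False
        then show ?thesis using outside[OF fg(1) v(1) _ v(3,2)] outside[OF fg(2) v(1) _ v(3,2)] v(4) by simp
      qed
    qed
    then show ?thesis by (simp add: levelmap_eq_iff level_def)
  qed
  define \<psi> where "\<psi> l = levelmap N (SOME f. f \<in> H \<and> L f = l)" for l
  have "levelmap N f \<in> \<psi> ` (L ` H)" if "f \<in> H" for f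
  proof -
    have s: "(SOME f'. f' \<in> H \<and> L f' = L f) \<in> H \<and> L (SOME f'. f' \<in> H \<and> L f' = L f) = L f"
      by (rule someI[of _ f]) (use that in simp)
    have "levelmap N f = \<psi> (L f)"
      unfolding \<psi>_def by (rule determined[OF that conjunct1[OF s] conjunct2[OF s, symmetric]])
    then show ?thesis using that by blast
  qed
  then have "card (levelmap N ` H) \<le> card (L ` H)"
    by (intro surj_card_le[OF LH(1)]) blast
  then show ?thesis using LH(2) by simp
qed

section \<open>The group of p-adic automorphisms\<close>

definition to_W :: "(nat list \<Rightarrow> nat list) \<Rightarrow> nat list \<Rightarrow> nat list" where
  "to_W f = restrict f (words p)"

lemma \<sigma>_group: "\<sigma> \<in> carrier (sym_group p)" "(\<sigma> ^^ k) \<in> carrier (sym_group p)"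
proof -
  have "(\<sigma> ^^ k) permutes {1..p}" for k
  proof (induction k)
    case (Suc k)
    show ?case unfolding funpow.simps(2) by (rule permutes_compose[OF Suc \<sigma>_permutes])
  next
    case 0
    show ?case unfolding funpow.simps(1) by (rule permutes_id)
  qed
  then show "(\<sigma> ^^ k) \<in> carrier (sym_group p)" by (simp add: sym_group_carrier)
  show "\<sigma> \<in> carrier (sym_group p)" unfolding sym_group_carrier by (rule \<sigma>_permutes)
qed

lemma generate_\<sigma>: "h \<in> generate (sym_group p) {\<sigma>} \<longleftrightarrow> (\<exists>k. h = \<sigma> ^^ k)"
proof
  interpret S: Group.group "sym_group p" by (rule sym_group_is_group)
  have inv: "inv\<^bsub>sym_group p\<^esub> \<sigma> = \<sigma> ^^ (p - 1)"
  proof (rule S.inv_equality)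
    have "\<sigma> ^^ (p - 1) \<circ> \<sigma> = \<sigma> ^^ Suc (p - 1)" by (simp add: funpow_swap1 fun_eq_iff)
    then show "\<sigma> ^^ (p - 1) \<otimes>\<^bsub>sym_group p\<^esub> \<sigma> = \<one>\<^bsub>sym_group p\<^esub>"
      using p_ge_2 by (simp add: sym_group_mult sym_group_one \<sigma>_pow_p del: funpow.simps)
  qed (rule \<sigma>_group)+
  show "h \<in> generate (sym_group p) {\<sigma>} \<Longrightarrow> \<exists>k. h = \<sigma> ^^ k"
  proof (induction rule: generate.induct)
    case one
    show ?case by (rule exI[of _ 0]) (simp add: sym_group_one)
  next
    case (incl h)
    then show ?case by (intro exI[of _ 1]) simp
  next
    case (inv h)
    then show ?case using \<open>inv\<^bsub>sym_group p\<^esub> \<sigma> = \<sigma> ^^ (p - 1)\<close> by auto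
  next
    case (eng h1 h2)
    then show ?case by (metis funpow_add sym_group_mult)
  qed
  show "\<exists>k. h = \<sigma> ^^ k \<Longrightarrow> h \<in> generate (sym_group p) {\<sigma>}"
  proof (elim exE)
    fix k assume "h = \<sigma> ^^ k"
    moreover have "\<sigma> ^^ k \<in> generate (sym_group p) {\<sigma>}"
    proof (induction k)
      case 0
      then show ?case using generate.one[of "sym_group p" "{\<sigma>}"] by (simp add: sym_group_one id_def)
    next
      case (Suc k)
      have "\<sigma> \<otimes>\<^bsub>sym_group p\<^esub> \<sigma> ^^ k \<in> generate (sym_group p) {\<sigma>}"
        by (rule generate.eng[OF generate.incl Suc]) simp
      then show ?case unfolding sym_group_mult funpow.simps(2) .
    qed
    ultimately show "h \<in> generate (sym_group p) {\<sigma>}" by simp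
  qed
qed

lemma carrier_W: "g \<in> carrier (W p) \<longleftrightarrow>
    g \<in> carrier (Aut_tree p) \<and> (\<forall>v\<in>words p. \<exists>k. label p g v = \<sigma> ^^ k)"
  unfolding W_def using generate_\<sigma> by (simp add: \<sigma>_def del: upt_Suc)

lemma W_Aut: "g \<in> carrier (W p) \<Longrightarrow> g \<in> carrier (Aut_tree p)"
  by (simp add: carrier_W)

lemma W_label_pow: "g \<in> carrier (W p) \<Longrightarrow> v \<in> words p \<Longrightarrow> \<exists>k. label p g v = \<sigma> ^^ k"
  by (simp add: carrier_W)

lemma W_label:
  assumes "g \<in> carrier (W p)" "v \<in> words p"
  shows "\<exists>k<p. \<forall>x\<in>{1..p}. g (v @ [x]) = g v @ [(\<sigma> ^^ k) x]"
proof -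
  have g: "g \<in> carrier (Aut_tree p)" by (rule W_Aut[OF assms(1)])
  obtain k where "label p g v = \<sigma> ^^ k" using W_label_pow[OF assms] by blast
  moreover have "(\<sigma> ^^ k) x = (\<sigma> ^^ (k mod p)) x" for x
    using funpow_mod_eq[of p \<sigma> x k] \<sigma>_pow_p by simp
  ultimately show ?thesis
    using label_props(2)[OF g assms(2)] p_ge_2 by (intro exI[of _ "k mod p"]) auto
qed

lemma tree_adj_auts:
  assumes f: "f \<in> auts"
  shows "tree_adj (f v) (f w) \<longleftrightarrow> tree_adj v w"
proof -
  have 1: "tree_adj (g v) (g w)" if "g \<in> auts" "tree_adj v w" for g v w
    using that auts_snoc[OF that(1)] unfolding tree_adj_def by metis
  show ?thesis
    using 1[OF f, of v w] 1[OF inv_auts[OF f], of "f v" "f w"] f by (auto simp: bij_eqs)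
qed

lemma to_W_Aut: assumes f: "f \<in> auts" shows "to_W f \<in> carrier (Aut_tree p)"
proof -
  have "f ` words p = words p"
  proof
    show "words p \<subseteq> f ` words p"
    proof
      fix w assume "w \<in> words p"
      then have "inv' f w \<in> words p" "w = f (inv' f w)"
        using auts_words[OF inv_auts[OF f]] f by (auto simp: bij_eqs)
      then show "w \<in> f ` words p" by blast
    qed
  qed (use auts_words[OF f] in auto)
  then have "bij_betw f (words p) (words p)"
    using inj_auts[OF f] by (auto simp: bij_betw_def intro: inj_on_subset)
  then have "bij_betw (to_W f) (words p) (words p)"
    by (rule bij_betw_cong[THEN iffD1, rotated]) (simp add: to_W_def)
  then have "to_W f \<in> Bij (words p)" by (simp add: Bij_def to_W_def)
  then show ?thesis
    using auts_Nil[OF f] tree_adj_auts[OF f] by (simp add: Aut_tree_def to_W_def)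
qed

lemma to_W_W: assumes f: "f \<in> auts" shows "to_W f \<in> carrier (W p)"
  unfolding carrier_W
proof (intro conjI ballI)
  show "to_W f \<in> carrier (Aut_tree p)" by (rule to_W_Aut[OF f])
  fix v assume v: "v \<in> words p"
  obtain k where k: "\<And>x. f (v @ [x]) = f v @ [(\<sigma> ^^ k) x]" using auts_snoc[OF f] by blast
  have "label p (to_W f) v = \<sigma> ^^ k"
    by (rule label_eqI[OF to_W_Aut[OF f] v \<sigma>_group(2)]) (use v k in \<open>simp add: to_W_def\<close>)
  then show "\<exists>k. label p (to_W f) v = \<sigma> ^^ k" by blast
qed

lemma W_mult: "mult (W p) = mult (Aut_tree p)" "one (W p) = one (Aut_tree p)"
  by (simp_all add: W_def)

lemma mult_apply: "v \<in> words p \<Longrightarrow> (g \<otimes>\<^bsub>W p\<^esub> h) v = h (g v)"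
  by (simp add: W_mult Aut_tree_def compose_def)

lemma one_apply: "v \<in> words p \<Longrightarrow> \<one>\<^bsub>W p\<^esub> v = v"
  by (simp add: W_mult Aut_tree_def)

text \<open>
  The order is reversed, since \<open>W p\<close> acts on the right.
\<close>

lemma to_W_mult: "f \<in> auts \<Longrightarrow> g \<in> auts \<Longrightarrow> to_W f \<otimes>\<^bsub>W p\<^esub> to_W g = to_W (g \<circ> f)"
  by (auto simp: W_mult Aut_tree_def compose_def to_W_def fun_eq_iff auts_words)

lemma to_W_one: "to_W id = \<one>\<^bsub>W p\<^esub>"
  by (simp add: W_mult Aut_tree_def to_W_def fun_eq_iff restrict_def)

lemma to_W_inv: assumes "f \<in> auts" shows "inv\<^bsub>W p\<^esub> (to_W f) = to_W (inv' f)"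
proof -
  interpret G: Group.group "W p" by (rule group_W)
  show ?thesis
  proof (rule G.inv_equality)
    show "to_W (inv' f) \<otimes>\<^bsub>W p\<^esub> to_W f = \<one>\<^bsub>W p\<^esub>"
      using assms by (simp add: to_W_mult inv_auts bij_eqs to_W_one)
  qed (use assms in \<open>auto intro: to_W_W inv_auts\<close>)
qed

lemma generate_to_W: assumes S: "S \<subseteq> auts" shows "generate (W p) (to_W ` S) = to_W ` gen S"
proof
  have ga: "gen S \<subseteq> auts" by (rule gen_auts[OF S])
  show "generate (W p) (to_W ` S) \<subseteq> to_W ` gen S"
  proof
    fix h assume "h \<in> generate (W p) (to_W ` S)"
    then show "h \<in> to_W ` gen S"
    proof (induction rule: generate.induct)
      case one
      show ?case unfolding to_W_one[symmetric] by (intro imageI gen_id)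
    next
      case (incl h)
      then obtain f where f: "f \<in> S" "h = to_W f" by blast
      show ?case unfolding f(2) by (intro imageI gen_base f(1))
    next
      case (inv h)
      then obtain f where f: "f \<in> S" "h = to_W f" by blast
      show ?case unfolding f(2) to_W_inv[OF subsetD[OF S f(1)]] by (intro imageI gen_inv gen_base f(1))
    next
      case (eng h1 h2)
      then obtain f g where fg: "f \<in> gen S" "h1 = to_W f" "g \<in> gen S" "h2 = to_W g" by blast
      show ?case unfolding fg(2,4) to_W_mult[OF subsetD[OF ga fg(1)] subsetD[OF ga fg(3)]]
        by (intro imageI gen_comp fg(1,3))
    qed
  qed
  show "to_W ` gen S \<subseteq> generate (W p) (to_W ` S)"
  proof clarify
    interpret G: Group.group "W p" by (rule group_W)
    have sub: "to_W ` S \<subseteq> carrier (W p)" using to_W_W S by blast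
    fix f assume "f \<in> gen S"
    then show "to_W f \<in> generate (W p) (to_W ` S)"
    proof (induction rule: gen_induct)
      case one
      show ?case unfolding to_W_one by (rule generate.one)
    next
      case (base f)
      then show ?case by (intro generate.incl imageI)
    next
      case (comp f g)
      show ?case
        unfolding to_W_mult[OF subsetD[OF ga comp.hyps(2)] subsetD[OF ga comp.hyps(1)], symmetric]
        by (rule generate.eng[OF comp.IH(2,1)])
    next
      case (inv f)
      show ?case unfolding to_W_inv[OF subsetD[OF ga inv.hyps], symmetric]
        by (rule G.generate_m_inv_closed[OF sub inv.IH])
    qed
  qed
qed

lemma levelmap_to_W: "levelmap n (to_W f) = levelmap n f"
  by (auto simp: levelmap_def to_W_def level_def fun_eq_iff restrict_def)

section \<open>Closures of subgroups\<close>

lemma Aut_append: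
  assumes g: "g \<in> carrier (Aut_tree p)"
  shows "v @ w \<in> words p \<Longrightarrow> \<exists>w'. g (v @ w) = g v @ w' \<and> length w' = length w"
proof (induction w rule: rev_induct)
  case (snoc x w)
  then have vw: "v @ w \<in> words p" "x \<in> {1..p}" by (auto simp: words_def)
  then obtain w' where "g (v @ w) = g v @ w'" "length w' = length w" using snoc.IH by auto
  moreover obtain y where "g ((v @ w) @ [x]) = g (v @ w) @ [y]"
    using Aut_tree_snoc[OF g vw] by blast
  ultimately show ?case by auto
qed simp

lemma Aut_length: assumes g: "g \<in> carrier (Aut_tree p)" "w \<in> words p" shows "length (g w) = length w"
  using Aut_append[OF g(1), of "[]" w] g(2) Aut_treeD(3)[OF g(1)] by auto

lemma Aut_level: "g \<in> carrier (Aut_tree p) \<Longrightarrow> w \<in> level n \<Longrightarrow> g w \<in> level n"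
  using Aut_length Aut_treeD(5) by (auto simp: level_def)

lemma Aut_shorter:
  assumes f: "f \<in> carrier (Aut_tree p)" and g: "g \<in> carrier (Aut_tree p)"
    and eq: "levelmap n f = levelmap n g" and w: "w \<in> words p" "length w \<le> n"
  shows "f w = g w"
proof -
  let ?r = "replicate (n - length w) 1"
  have wr: "w @ ?r \<in> words p"
    using w replicate_words[of "n - length w"] by (auto simp: words_def)
  then have "w @ ?r \<in> level n" using w by (auto simp: level_def)
  then have "f (w @ ?r) = g (w @ ?r)" using eq levelmap_eq_iff by metis
  moreover obtain a where "f (w @ ?r) = f w @ a" using Aut_append[OF f wr] by blast
  moreover obtain b where "g (w @ ?r) = g w @ b" using Aut_append[OF g wr] by blast
  ultimately show ?thesis using Aut_length[OF f w(1)] Aut_length[OF g w(1)] by (metis append_eq_append_conv)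
qed

lemma levelmap_mono:
  assumes "f \<in> carrier (Aut_tree p)" "g \<in> carrier (Aut_tree p)" "levelmap n f = levelmap n g" "m \<le> n"
  shows "levelmap m f = levelmap m g"
  unfolding levelmap_eq_iff
proof
  fix w assume "w \<in> level m"
  then show "f w = g w" using assms(4) by (intro Aut_shorter[OF assms(1-3)]) (auto simp: level_def)
qed

text \<open>
  These sets are the cosets of the level stabilizers.
\<close>

definition nbhd :: "(nat list \<Rightarrow> nat list) \<Rightarrow> nat \<Rightarrow> (nat list \<Rightarrow> nat list) set" where
  "nbhd g n = {f \<in> carrier (Aut_tree p). levelmap n f = levelmap n g}"

lemma coset_level_stab:
  assumes g: "g \<in> carrier (Aut_tree p)"
  shows "g <#\<^bsub>Aut_tree p\<^esub> level_stab p n = nbhd g n"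
proof
  interpret A: Group.group "Aut_tree p" by (rule group_Aut_tree)
  have mult: "(a \<otimes>\<^bsub>Aut_tree p\<^esub> b) v = b (a v)" if "v \<in> words p" for a b v
    using that by (simp add: Aut_tree_def compose_def)
  show "g <#\<^bsub>Aut_tree p\<^esub> level_stab p n \<subseteq> nbhd g n"
  proof
    fix f assume "f \<in> g <#\<^bsub>Aut_tree p\<^esub> level_stab p n"
    then obtain h where h: "h \<in> level_stab p n" "f = g \<otimes>\<^bsub>Aut_tree p\<^esub> h" by (auto simp: l_coset_def)
    then have "h \<in> carrier (Aut_tree p)" by (simp add: level_stab_def)
    then have "f \<in> carrier (Aut_tree p)" using g h by simp
    moreover have "f w = g w" if "w \<in> level n" for w
      using that h Aut_level[OF g that] by (simp add: mult level_def level_stab_def)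
    ultimately show "f \<in> nbhd g n" by (simp add: nbhd_def levelmap_eq_iff)
  qed
  show "nbhd g n \<subseteq> g <#\<^bsub>Aut_tree p\<^esub> level_stab p n"
  proof
    fix f assume "f \<in> nbhd g n"
    then have f: "f \<in> carrier (Aut_tree p)" "\<And>w. w \<in> level n \<Longrightarrow> f w = g w"
      by (auto simp: nbhd_def levelmap_eq_iff)
    let ?h = "inv\<^bsub>Aut_tree p\<^esub> g \<otimes>\<^bsub>Aut_tree p\<^esub> f"
    have h: "?h \<in> carrier (Aut_tree p)" using f g by simp
    have gh: "g \<otimes>\<^bsub>Aut_tree p\<^esub> ?h = f" using f g by (simp add: A.m_assoc[symmetric])
    have ig: "inv\<^bsub>Aut_tree p\<^esub> g \<in> carrier (Aut_tree p)" using g by simp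
    have "?h w = w" if "w \<in> words p" "length w = n" for w
    proof -
      have lw: "w \<in> level n" using that by (simp add: level_def)
      let ?u = "(inv\<^bsub>Aut_tree p\<^esub> g) w"
      have "?h w = f ?u" using that by (simp add: mult)
      also have "\<dots> = g ?u" by (rule f(2)[OF Aut_level[OF ig lw]])
      also have "\<dots> = (inv\<^bsub>Aut_tree p\<^esub> g \<otimes>\<^bsub>Aut_tree p\<^esub> g) w" using that by (simp add: mult)
      also have "\<dots> = \<one>\<^bsub>Aut_tree p\<^esub> w" using g by simp
      also have "\<dots> = w" using that by (simp add: Aut_tree_def)
      finally show ?thesis .
    qed
    then have "?h \<in> level_stab p n" using h by (simp add: level_stab_def)
    then show "f \<in> g <#\<^bsub>Aut_tree p\<^esub> level_stab p n" using gh by (force simp: l_coset_def)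
  qed
qed

lemma Aut_tree_topology_eq:
  "Aut_tree_topology p = topology_generated_by {nbhd g n | g n. g \<in> carrier (Aut_tree p)}"
proof -
  have "{g <#\<^bsub>Aut_tree p\<^esub> level_stab p n | g n. g \<in> carrier (Aut_tree p)} =
      {nbhd g n | g n. g \<in> carrier (Aut_tree p)}"
    using coset_level_stab by blast
  then show ?thesis by (simp add: Aut_tree_topology_def)
qed

lemma open_contains_nbhd:
  assumes "generate_topology_on {nbhd g n | g n. g \<in> carrier (Aut_tree p)} T" "x \<in> T"
  shows "\<exists>n. nbhd x n \<subseteq> T"
  using assms
proof (induction rule: generate_topology_on.induct)
  case (Int a b)
  then obtain m n where mn: "nbhd x m \<subseteq> a" "nbhd x n \<subseteq> b" by blast
  have x: "x \<in> carrier (Aut_tree p)"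
  proof -
    have "a \<subseteq> carrier (Aut_tree p)"
      using Int.hyps(1) by (induction rule: generate_topology_on.induct) (auto simp: nbhd_def)
    then show ?thesis using Int.prems by blast
  qed
  have "nbhd x (max m n) \<subseteq> nbhd x m \<inter> nbhd x n"
    unfolding nbhd_def using levelmap_mono[OF _ x] by auto
  then show ?case using mn by blast
next
  case (UN K)
  then show ?case by blast
next
  case (Basis T)
  then obtain g n where "T = nbhd g n" by blast
  then have "nbhd x n \<subseteq> T" using Basis.prems by (auto simp: nbhd_def)
  then show ?case ..
qed simp

text \<open>
  The sets \<open>nbhd x n\<close> form a neighbourhood basis at \<open>x\<close>, so the closure consists of the
  automorphisms that agree on each level with some element of \<open>K\<close>.
\<close>

lemma closure_of_iff:
  "x \<in> Aut_tree_topology p closure_of K \<longleftrightarrow>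
    x \<in> carrier (Aut_tree p) \<and> (\<forall>n. \<exists>k\<in>K \<inter> carrier (Aut_tree p). levelmap n k = levelmap n x)"
  (is "?L \<longleftrightarrow> ?R")
proof
  have top: "topspace (Aut_tree_topology p) = carrier (Aut_tree p)"
    unfolding Aut_tree_topology_eq topology_generated_by_topspace by (auto simp: nbhd_def)
  {
    assume L: ?L
    then have x: "x \<in> carrier (Aut_tree p)" using top by (simp add: in_closure_of)
    have "\<exists>k\<in>K \<inter> carrier (Aut_tree p). levelmap n k = levelmap n x" for n
    proof -
      have "openin (Aut_tree_topology p) (nbhd x n)"
        unfolding Aut_tree_topology_eq by (rule topology_generated_by_Basis) (use x in blast)
      moreover have "x \<in> nbhd x n" using x by (simp add: nbhd_def)
      ultimately obtain k where "k \<in> K" "k \<in> nbhd x n" using L by (auto simp: in_closure_of)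
      then show ?thesis by (auto simp: nbhd_def)
    qed
    then show ?R using x by blast
  }
  assume R: ?R
  show ?L
    unfolding in_closure_of
  proof (intro conjI allI impI)
    show "x \<in> topspace (Aut_tree_topology p)" using R top by simp
    fix T assume "x \<in> T \<and> openin (Aut_tree_topology p) T"
    then obtain n where "nbhd x n \<subseteq> T"
      using open_contains_nbhd[of T x] by (auto simp: Aut_tree_topology_eq openin_topology_generated_by_iff)
    moreover obtain k where "k \<in> K \<inter> carrier (Aut_tree p)" "levelmap n k = levelmap n x" using R by blast
    ultimately show "\<exists>y. y \<in> K \<and> y \<in> T" by (auto simp: nbhd_def)
  qed
qed

text \<open>
  Taking the closure does not change the action on any finite level. The dimension of a closed
  subgroup can therefore be computed from any dense subgroup.
\<close>

lemma closure_subgroup: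
  assumes K: "subgroup K (W p)"
  shows "closed_subgroup p (Aut_tree_topology p closure_of K)"
    and "levelmap n ` (Aut_tree_topology p closure_of K) = levelmap n ` K"
proof -
  let ?L = "Aut_tree_topology p closure_of K"
  interpret G: Group.group "W p" by (rule group_W)
  interpret K: subgroup K "W p" by (rule K)
  have KA: "K \<subseteq> carrier (Aut_tree p)" using K.subset W_Aut by blast
  have iff: "x \<in> ?L \<longleftrightarrow> x \<in> carrier (Aut_tree p) \<and> (\<forall>n. \<exists>k\<in>K. levelmap n k = levelmap n x)" for x
    using closure_of_iff[of x K] KA by (simp add: Int_absorb2)
  have sub: "?L \<subseteq> carrier (W p)"
  proof
    fix x assume "x \<in> ?L"
    then have x: "x \<in> carrier (Aut_tree p)" "\<And>n. \<exists>k\<in>K. levelmap n k = levelmap n x" using iff by auto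
    have "\<exists>k. label p x v = \<sigma> ^^ k" if v: "v \<in> words p" for v
    proof -
      obtain k where k: "k \<in> K" "levelmap (Suc (length v)) k = levelmap (Suc (length v)) x" using x(2) by blast
      have kA: "k \<in> carrier (Aut_tree p)" using k KA by blast
      note eq = Aut_shorter[OF x(1) kA k(2)[symmetric]]
      have "label p x v = label p k v"
        by (rule label_eqI[OF x(1) v label_props(1)[OF kA v]])
          (use v eq label_props(2)[OF kA v] in simp)
      then show ?thesis using W_label_pow[OF K.mem_carrier[OF k(1)] v] by simp
    qed
    then show "x \<in> carrier (W p)" using x(1) unfolding carrier_W by simp
  qed
  have "K \<subseteq> ?L" using iff KA by blast
  have "subgroup ?L (W p)"
  proof (rule G.subgroupI[OF sub])
    show "?L \<noteq> {}" using \<open>K \<subseteq> ?L\<close> K.one_closed by blast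
    fix x assume x: "x \<in> ?L"
    have xW: "x \<in> carrier (W p)" using x sub by blast
    let ?i = "inv\<^bsub>W p\<^esub> x"
    have iA: "?i \<in> carrier (Aut_tree p)" using xW by (simp add: W_Aut)
    have "\<exists>k\<in>K. levelmap n k = levelmap n ?i" for n
    proof -
      obtain k where k: "k \<in> K" "levelmap n k = levelmap n x" using x iff by blast
      have kW: "k \<in> carrier (W p)" using k by simp
      have "(inv\<^bsub>W p\<^esub> k) w = ?i w" if w: "w \<in> level n" for w
      proof -
        have wp: "w \<in> words p" using w by (simp add: level_def)
        have iw: "?i w \<in> level n" by (rule Aut_level[OF iA w])
        then have iwp: "?i w \<in> words p" by (simp add: level_def)
        have "k (?i w) = x (?i w)" using k(2) iw levelmap_eq_iff by metis
        also have "\<dots> = (?i \<otimes>\<^bsub>W p\<^esub> x) w" using wp by (simp add: mult_apply)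
        also have "\<dots> = w" using xW wp by (simp add: one_apply)
        finally have "(inv\<^bsub>W p\<^esub> k) w = (inv\<^bsub>W p\<^esub> k) (k (?i w))" by simp
        also have "\<dots> = (k \<otimes>\<^bsub>W p\<^esub> inv\<^bsub>W p\<^esub> k) (?i w)" using iwp by (simp add: mult_apply)
        also have "\<dots> = ?i w" using kW iwp by (simp add: one_apply)
        finally show ?thesis .
      qed
      then show ?thesis using k(1) levelmap_eq_iff by (metis K.m_inv_closed)
    qed
    then show "?i \<in> ?L" using iA iff by blast
    fix y assume y: "y \<in> ?L"
    have yW: "y \<in> carrier (W p)" using y sub by blast
    have "x \<otimes>\<^bsub>W p\<^esub> y \<in> carrier (Aut_tree p)" using xW yW by (intro W_Aut G.m_closed)
    moreover have "\<exists>k\<in>K. levelmap n k = levelmap n (x \<otimes>\<^bsub>W p\<^esub> y)" for n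
    proof -
      obtain k l where k: "k \<in> K" "levelmap n k = levelmap n x" "l \<in> K" "levelmap n l = levelmap n y"
        using x y iff by metis
      have "(k \<otimes>\<^bsub>W p\<^esub> l) w = (x \<otimes>\<^bsub>W p\<^esub> y) w" if w: "w \<in> level n" for w
      proof -
        have wp: "w \<in> words p" using w by (simp add: level_def)
        have kw: "k w = x w" by (rule levelmap_eqD[OF k(2) w])
        have "l (x w) = y (x w)" by (rule levelmap_eqD[OF k(4) Aut_level[OF W_Aut[OF xW] w]])
        then show ?thesis using kw wp by (simp add: mult_apply)
      qed
      then have "levelmap n (k \<otimes>\<^bsub>W p\<^esub> l) = levelmap n (x \<otimes>\<^bsub>W p\<^esub> y)" by (simp add: levelmap_eq_iff)
      then show ?thesis using K.m_closed[OF k(1,3)] by blast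
    qed
    ultimately show "x \<otimes>\<^bsub>W p\<^esub> y \<in> ?L" using iff by blast
  qed
  then show "closed_subgroup p ?L" by (simp add: closed_subgroup_def)
  show "levelmap n ` ?L = levelmap n ` K"
  proof
    show "levelmap n ` ?L \<subseteq> levelmap n ` K"
    proof clarify
      fix x assume "x \<in> ?L"
      then obtain k where "k \<in> K" "levelmap n k = levelmap n x" using iff by blast
      then show "levelmap n x \<in> levelmap n ` K" by (metis imageI)
    qed
    show "levelmap n ` K \<subseteq> levelmap n ` ?L" using \<open>K \<subseteq> ?L\<close> by blast
  qed
qed

section \<open>Indices of level stabilizers\<close>

text \<open>
  Two elements lie in the same right coset of the level stabilizer if and only if they act in
  the same way on level \<open>n\<close>.
\<close>

lemma group_index_levelmap:
  assumes L: "subgroup L (W p)"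
  shows "group_index ((W p)\<lparr>carrier := L\<rparr>) (L \<inter> level_stab p n) = card (levelmap n ` L)"
proof -
  interpret G: Group.group "W p" by (rule group_W)
  interpret L: subgroup L "W p" by (rule L)
  define fiber where "fiber l = {b \<in> L. levelmap n b = l}" for l
  have "(L \<inter> level_stab p n) #>\<^bsub>(W p)\<lparr>carrier := L\<rparr>\<^esub> a = fiber (levelmap n a)" if a: "a \<in> L" for a
  proof
    have aW: "a \<in> carrier (W p)" using a by simp
    show "(L \<inter> level_stab p n) #>\<^bsub>(W p)\<lparr>carrier := L\<rparr>\<^esub> a \<subseteq> fiber (levelmap n a)"
    proof
      fix b assume "b \<in> (L \<inter> level_stab p n) #>\<^bsub>(W p)\<lparr>carrier := L\<rparr>\<^esub> a"
      then obtain h where h: "h \<in> L" "h \<in> level_stab p n" "b = h \<otimes>\<^bsub>W p\<^esub> a" by (auto simp: r_coset_def)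
      have "b w = a w" if "w \<in> level n" for w
        using that h by (simp add: mult_apply level_def level_stab_def)
      then show "b \<in> fiber (levelmap n a)" using h a by (simp add: fiber_def levelmap_eq_iff)
    qed
    show "fiber (levelmap n a) \<subseteq> (L \<inter> level_stab p n) #>\<^bsub>(W p)\<lparr>carrier := L\<rparr>\<^esub> a"
    proof
      fix b assume "b \<in> fiber (levelmap n a)"
      then have b: "b \<in> L" "\<And>w. w \<in> level n \<Longrightarrow> b w = a w" by (auto simp: fiber_def levelmap_eq_iff)
      let ?h = "b \<otimes>\<^bsub>W p\<^esub> inv\<^bsub>W p\<^esub> a"
      have bW: "b \<in> carrier (W p)" using b by simp
      have hL: "?h \<in> L" using a b by simp
      then have "?h \<in> carrier (Aut_tree p)" using L.subset W_Aut by blast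
      moreover have "?h w = w" if w: "w \<in> words p" "length w = n" for w
      proof -
        have lw: "w \<in> level n" using w by (simp add: level_def)
        have "?h w = (inv\<^bsub>W p\<^esub> a) (a w)" using w b(2)[OF lw] by (simp add: mult_apply)
        also have "\<dots> = (a \<otimes>\<^bsub>W p\<^esub> inv\<^bsub>W p\<^esub> a) w" using w by (simp add: mult_apply)
        also have "\<dots> = w" using aW w by (simp add: one_apply)
        finally show ?thesis .
      qed
      ultimately have "?h \<in> level_stab p n" by (simp add: level_stab_def)
      moreover have "?h \<otimes>\<^bsub>W p\<^esub> a = b" using aW bW by (simp add: G.m_assoc)
      ultimately show "b \<in> (L \<inter> level_stab p n) #>\<^bsub>(W p)\<lparr>carrier := L\<rparr>\<^esub> a"
        using hL by (force simp: r_coset_def)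
    qed
  qed
  then have "rcosets\<^bsub>(W p)\<lparr>carrier := L\<rparr>\<^esub> (L \<inter> level_stab p n) = fiber ` (levelmap n ` L)"
    by (auto simp: RCOSETS_def)
  moreover have "inj_on fiber (levelmap n ` L)"
  proof (rule inj_onI)
    fix l l' assume "l \<in> levelmap n ` L" "fiber l = fiber l'"
    then show "l = l'" by (auto simp: fiber_def)
  qed
  ultimately show ?thesis by (simp add: group_index_def card_image)
qed

lemma graft_rot_fix:
  assumes "v \<noteq> w" "length w \<le> length v"
  shows "graft v rot (w @ [x]) = w @ [x]"
proof (cases "length w = length v")
  case True
  then show ?thesis using assms by (simp add: base_append)
next
  case False
  then have "length (w @ [x]) \<le> length v" using assms by simp
  then show ?thesis by (cases "length (w @ [x]) < length v") (auto simp: base_def rot_def)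
qed

lemma W_card_level: "card (levelmap n ` carrier (W p)) = p ^ nverts n"
proof (rule antisym)
  let ?V = "{w \<in> words p. length w < n}"
  have "card (levelmap n ` carrier (W p)) \<le> p ^ card ?V"
  proof (rule label_count[OF _ _ finite_words_less])
    show "f [] = []" if "f \<in> carrier (W p)" for f by (rule Aut_treeD(3)[OF W_Aut[OF that]])
    show "\<exists>k<p. \<forall>x\<in>{1..p}. f (v @ [x]) = f v @ [(\<sigma> ^^ k) x]" if "f \<in> carrier (W p)" "v \<in> words p" for f v
      by (rule W_label[OF that])
  qed simp
  then show "card (levelmap n ` carrier (W p)) \<le> p ^ nverts n" by (simp add: card_words_less)
  have "p ^ card ?V \<le> card (levelmap n ` auts)"
  proof (rule triangular_count[where g = "\<lambda>v. graft v rot" and vt = "\<lambda>v. v" and key = length, OF finite_words_less])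
    show "aut_group auts" unfolding aut_group_def by (auto intro: id_auts comp_auts inv_auts)
    show "graft v rot (w @ [x]) = w @ [x]" if "v \<noteq> w" "length w \<le> length v" for v w x
      by (rule graft_rot_fix[OF that])
    show "graft v rot (v @ [x]) = v @ [\<sigma> x]" for v x using graft_rot_apply[of v x "[]"] by simp
  qed (auto intro: graft_auts rot_auts)
  also have "levelmap n ` auts = levelmap n ` to_W ` auts" by (simp add: image_image levelmap_to_W)
  also have "card \<dots> \<le> card (levelmap n ` carrier (W p))"
  proof (rule card_mono)
    show "finite (levelmap n ` carrier (W p))"
      by (rule finite_levelmap) (rule Aut_level[OF W_Aut])
    show "levelmap n ` to_W ` auts \<subseteq> levelmap n ` carrier (W p)" using to_W_W by blast
  qed
  finally show "p ^ nverts n \<le> card (levelmap n ` carrier (W p))" by (simp add: card_words_less)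
qed

lemma hdim_eq:
  assumes "closed_subgroup p L"
  shows "hdim p L = liminf (\<lambda>n. ereal (ln (real (card (levelmap n ` L))) / (nverts n * ln (real p))))"
proof -
  have L: "subgroup L (W p)" using assms by (simp add: closed_subgroup_def)
  interpret G: Group.group "W p" by (rule group_W)
  have W: "(W p)\<lparr>carrier := carrier (W p)\<rparr> = W p" by simp
  have "ln (real (group_index (W p) (carrier (W p) \<inter> level_stab p n))) = nverts n * ln (real p)" for n
    using group_index_levelmap[OF G.subgroup_self, of n] p_ge_2
    unfolding W W_card_level by (simp add: ln_realpow)
  then show ?thesis unfolding hdim_def group_index_levelmap[OF L] by simp
qed

section \<open>Upper bound for the two-generator group\<close>

lemma two_gen_form:
  assumes "g \<in> two_gen c"
  shows "\<exists>F. g = along_ray F \<and> (\<forall>i y. F i y \<in> auts) \<and> (\<forall>i y. \<not> active c i y \<longrightarrow> F i y = id)"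
  using assms unfolding two_gen_def
proof (induction rule: gen_induct)
  case one
  show ?case by (rule exI[of _ "\<lambda>i y. id"]) (simp only: along_ray_id id_auts, simp)
next
  case (base f)
  then consider "f = along_ray (odometers c)" | "f = along_ray (seeds c)" by blast
  then show ?case
  proof cases
    case 1
    have "\<forall>i y. \<not> active c i y \<longrightarrow> odometers c i y = id" by (simp add: odometers_def)
    then show ?thesis using 1 coordinate_auts(1) by blast
  next
    case 2
    have "\<forall>i y. \<not> active c i y \<longrightarrow> seeds c i y = id" by (simp add: seeds_def)
    then show ?thesis using 2 coordinate_auts(2) by blast
  qed
next
  case (comp f g)
  then obtain F F' where F: "f = along_ray F" "\<And>i y. F i y \<in> auts" "\<And>i y. \<not> active c i y \<Longrightarrow> F i y = id"
    and F': "g = along_ray F'" "\<And>i y. F' i y \<in> auts" "\<And>i y. \<not> active c i y \<Longrightarrow> F' i y = id" by blast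
  show ?case
  proof (rule exI[of _ "\<lambda>i y. F i y \<circ> F' i y"], intro conjI allI impI)
    show "f \<circ> g = along_ray (\<lambda>i y. F i y \<circ> F' i y)" unfolding F(1) F'(1) by (rule along_ray_comp)
    show "F i y \<circ> F' i y \<in> auts" for i y by (rule comp_auts[OF F(2) F'(2)])
    show "F i y \<circ> F' i y = id" if "\<not> active c i y" for i y
      unfolding F(3)[OF that] F'(3)[OF that] by (rule comp_id)
  qed
next
  case (inv f)
  then obtain F where F: "f = along_ray F" "\<And>i y. F i y \<in> auts" "\<And>i y. \<not> active c i y \<Longrightarrow> F i y = id" by blast
  show ?case
  proof (rule exI[of _ "\<lambda>i y. inv' (F i y)"], intro conjI allI impI)
    show "inv' f = along_ray (\<lambda>i y. inv' (F i y))" unfolding F(1) by (rule along_ray_inv[OF F(2)])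
    show "inv' (F i y) \<in> auts" for i y by (rule inv_auts[OF F(2)])
    show "inv' (F i y) = id" if "\<not> active c i y" for i y
      unfolding F(3)[OF that] by (rule Hilbert_Choice.inv_id)
  qed
qed

lemma auts_label:
  assumes "f \<in> auts"
  shows "\<exists>k<p. \<forall>x\<in>{1..p}. f (v @ [x]) = f v @ [(\<sigma> ^^ k) x]"
proof -
  obtain k where "\<And>x. f (v @ [x]) = f v @ [(\<sigma> ^^ k) x]" using auts_snoc[OF assms] by blast
  moreover have "(\<sigma> ^^ k) x = (\<sigma> ^^ (k mod p)) x" for x
    using funpow_mod_eq[of p \<sigma> x k] \<sigma>_pow_p by simp
  ultimately show ?thesis using p_ge_2 by (intro exI[of _ "k mod p"]) auto
qed

text \<open>
  Labels of elements of the group can only be nontrivial at vertices below active ones.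
\<close>

lemma two_gen_upper:
  "card (levelmap N ` two_gen c) \<le> p ^ (\<Sum>i<N. c i * nverts (N - Suc i))"
proof -
  define V where "V = (\<Union>i<N. \<Union>y\<in>{2..Suc (c i)}. (\<lambda>w. replicate i 1 @ y # w) ` {w \<in> words p. length w < N - Suc i})"
  have fin: "finite V" unfolding V_def using finite_words_less by blast
  have "card V \<le> (\<Sum>i<N. card (\<Union>y\<in>{2..Suc (c i)}. (\<lambda>w. replicate i 1 @ y # w) ` {w \<in> words p. length w < N - Suc i}))"
    unfolding V_def by (rule card_UN_le) simp
  also have "\<dots> \<le> (\<Sum>i<N. c i * nverts (N - Suc i))"
  proof (rule sum_mono)
    fix i
    have "card (\<Union>y\<in>{2..Suc (c i)}. (\<lambda>w. replicate i 1 @ y # w) ` {w \<in> words p. length w < N - Suc i})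
        \<le> (\<Sum>y\<in>{2..Suc (c i)}. card ((\<lambda>w. replicate i 1 @ y # w) ` {w \<in> words p. length w < N - Suc i}))"
      by (rule card_UN_le) simp
    also have "\<dots> \<le> (\<Sum>y\<in>{2..Suc (c i)}. nverts (N - Suc i))"
      by (rule sum_mono) (use card_image_le[OF finite_words_less] card_words_less in metis)
    finally show "card (\<Union>y\<in>{2..Suc (c i)}. (\<lambda>w. replicate i 1 @ y # w) ` {w \<in> words p. length w < N - Suc i})
        \<le> c i * nverts (N - Suc i)" by simp
  qed
  finally have V: "card V \<le> (\<Sum>i<N. c i * nverts (N - Suc i))" .
  have "card (levelmap N ` two_gen c) \<le> p ^ card V"
  proof (rule label_count[OF _ _ fin])
    have Ga: "f \<in> auts" if "f \<in> two_gen c" for f by (rule aut_groupD(4)[OF aut_group_two_gen that])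
    show "f [] = []" if "f \<in> two_gen c" for f by (rule auts_Nil[OF Ga[OF that]])
    show "\<exists>k<p. \<forall>x\<in>{1..p}. f (v @ [x]) = f v @ [(\<sigma> ^^ k) x]" if "f \<in> two_gen c" for f v
      by (rule auts_label[OF Ga[OF that]])
    fix f v x assume f: "f \<in> two_gen c" and v: "v \<in> words p" "v \<notin> V" "length v < N"
    obtain F where F: "f = along_ray F" "\<And>i y. F i y \<in> auts" "\<And>i y. \<not> active c i y \<Longrightarrow> F i y = id"
      using two_gen_form[OF f] by blast
    show "f (v @ [x]) = f v @ [x]"
    proof (cases v rule: spine_cases)
      case (1 i)
      show ?thesis
      proof (cases "x = 1")
        case True
        have "v @ [x] = replicate (Suc i) 1" unfolding 1 True by (simp add: replicate_append_same)
        then have "f (v @ [x]) = v @ [x]" unfolding F(1) using along_ray_replicate by metis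
        moreover have "f v = v" unfolding F(1) 1 by (rule along_ray_replicate)
        ultimately show ?thesis by simp
      next
        case False
        have "f (v @ [x]) = v @ [x]" unfolding F(1) 1 using along_ray_spine[OF False, of F i "[]"] auts_Nil[OF F(2)] by simp
        moreover have "f v = v" unfolding F(1) 1 by (rule along_ray_replicate)
        ultimately show ?thesis by simp
      qed
    next
      case (2 i y w)
      have w: "w \<in> words p" "y \<in> {1..p}" "length w < N - Suc i" "i < N"
        using v 2(2) by (auto simp: words_def)
      have "\<not> active c i y"
      proof
        assume "active c i y"
        then have "y \<in> {2..Suc (c i)}" by (simp add: active_def)
        then have "v \<in> V" unfolding V_def 2(2) using w by blast
        then show False using v by simp
      qed
      then have "F i y = id" by (rule F(3))
      then show ?thesis
        using along_ray_spine[OF 2(1), of F i w] along_ray_spine[OF 2(1), of F i "w @ [x]"] unfolding F(1) 2(2) by simp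
    qed
  qed
  also have "\<dots> \<le> p ^ (\<Sum>i<N. c i * nverts (N - Suc i))"
    using V p_ge_2 by (intro power_increasing) auto
  finally show ?thesis .
qed

section \<open>Lower bound for the two-generator group\<close>

text \<open>
  For every prefix of length \<open>4 * (n div 5)\<close> one reference vertex of level \<open>n\<close> is singled out. The
  rotation at any other vertex, corrected by the inverse rotation at its reference vertex,
  lies in the derived subgroup of \<open>D 0\<close>.
\<close>

definition reference :: "nat \<Rightarrow> nat list \<Rightarrow> nat list" where
  "reference n w = take (4 * (n div 5)) w @ replicate (n - 4 * (n div 5)) 1"

definition nonref :: "nat \<Rightarrow> nat list set" where
  "nonref n = {w \<in> level n. w \<noteq> reference n w}"

definition rot_diff :: "nat \<Rightarrow> nat list \<Rightarrow> nat list \<Rightarrow> nat list" where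
  "rot_diff n w = graft w rot \<circ> inv' (graft (reference n w) rot)"

lemma reference_level:
  assumes w: "w \<in> level n"
  shows "reference n w \<in> level n"
proof -
  have m: "4 * (n div 5) \<le> n" by linarith
  have "length (reference n w) = n" using w m by (simp add: reference_def level_def)
  moreover have "reference n w \<in> words p"
    using w p_ge_2 by (auto simp: reference_def words_def level_def dest: in_set_takeD)
  ultimately show ?thesis by (simp add: level_def)
qed

lemma reference_idem: "w \<in> level n \<Longrightarrow> reference n (reference n w) = reference n w"
  by (auto simp: reference_def level_def min_def)

lemma card_nonref: "real (p ^ n) - real (p ^ (4 * (n div 5))) \<le> real (card (nonref n))"
proof -
  let ?f = "\<lambda>u. u @ replicate (n - 4 * (n div 5)) (1::nat)"
  have "level n \<subseteq> nonref n \<union> ?f ` level (4 * (n div 5))"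
  proof
    fix w assume w: "w \<in> level n"
    show "w \<in> nonref n \<union> ?f ` level (4 * (n div 5))"
    proof (cases "w = reference n w")
      case True
      moreover have "take (4 * (n div 5)) w \<in> level (4 * (n div 5))"
        using w by (auto simp: level_def words_def dest: in_set_takeD)
      ultimately show ?thesis unfolding reference_def by blast
    qed (use w in \<open>simp add: nonref_def\<close>)
  qed
  then have "card (level n) \<le> card (nonref n \<union> ?f ` level (4 * (n div 5)))"
    by (intro card_mono) (auto simp: nonref_def)
  also have "\<dots> \<le> card (nonref n) + card (?f ` level (4 * (n div 5)))" by (rule card_Un_le)
  also have "\<dots> \<le> card (nonref n) + p ^ (4 * (n div 5))"
    using card_image_le[OF finite_level, of ?f] by (simp add: card_level)
  finally have "p ^ n \<le> card (nonref n) + p ^ (4 * (n div 5))" by (simp add: card_level)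
  then have "real (p ^ n) \<le> real (card (nonref n) + p ^ (4 * (n div 5)))" by (rule of_nat_mono)
  then show ?thesis by simp
qed

lemma rot_diff_derived:
  assumes "w \<in> level n"
  shows "rot_diff n w \<in> derived_gp (D_gens 0)"
  unfolding rot_diff_def
proof (rule graft_rot_diff_deep)
  show "take (4 * (n div 5)) w = take (4 * (n div 5)) (reference n w)"
    using assms by (simp add: reference_def level_def min_def)
qed (use assms reference_level in \<open>auto simp: level_def\<close>)

lemma rot_diff_fix:
  assumes w: "w \<in> level n" and z: "length z \<le> n" "z \<noteq> w" "z \<noteq> reference n w"
  shows "rot_diff n w (z @ [x]) = z @ [x]"
proof -
  have l: "length w = n" "length (reference n w) = n" using w reference_level[OF w] by (auto simp: level_def)
  have "inv' (graft (reference n w) rot) (z @ [x]) = z @ [x]"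
    by (rule inv_app[OF graft_auts[OF rot_auts] graft_rot_fix]) (use l z in auto)
  moreover have "graft w rot (z @ [x]) = z @ [x]" by (rule graft_rot_fix) (use l z in auto)
  ultimately show ?thesis by (simp add: rot_diff_def)
qed

lemma rot_diff_move:
  assumes w: "w \<in> nonref n"
  shows "rot_diff n w (w @ [x]) = w @ [\<sigma> x]"
proof -
  have w': "w \<in> level n" "w \<noteq> reference n w" using w by (auto simp: nonref_def)
  have l: "length w = n" "length (reference n w) = n" using w' reference_level by (auto simp: level_def)
  have "inv' (graft (reference n w) rot) (w @ [x]) = w @ [x]"
    by (rule inv_app[OF graft_auts[OF rot_auts] graft_rot_fix]) (use l w' in auto)
  then show ?thesis using graft_rot_apply[of w x "[]"] by (simp add: rot_diff_def)
qed

lemma depth_inj: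
  assumes "depth i y = depth i' y'" "2 \<le> y" "y \<le> p" "2 \<le> y'" "y' \<le> p"
  shows "i = i' \<and> y = y'"
proof -
  obtain z z' where z: "y = Suc z" "y' = Suc z'" "z < p" "z' < p"
    using assms by (cases y; cases y') auto
  have "z + i * p = z' + i' * p" using assms z by (simp add: depth_def)
  moreover have "(z + i * p) div p = i" "(z' + i' * p) div p = i'" using z by auto
  ultimately have "i = i'" by metis
  then show ?thesis using assms by (simp add: depth_def)
qed

text \<open>
  The vertices \<open>1\<^sup>i y v w\<close> above level \<open>N\<close> at which the label can be prescribed: \<open>1\<^sup>i y\<close> is
  active with \<open>i < J\<close>, \<open>v\<close> has length \<open>depth i y\<close>, and \<open>w\<close> is not a reference vertex.
\<close>

definition index_set :: "(nat \<Rightarrow> nat) \<Rightarrow> nat \<Rightarrow> nat \<Rightarrow> (nat \<times> nat \<times> nat \<times> nat list \<times> nat list) set" where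
  "index_set c J N = (SIGMA i:{..<J}. SIGMA y:{2..Suc (c i)}. SIGMA n:{..<N - (Suc i + depth i y)}.
     level (depth i y) \<times> nonref n)"

lemma finite_nonref [simp]: "finite (nonref n)"
  by (simp add: nonref_def)

lemma finite_index_set: "finite (index_set c J N)"
  unfolding index_set_def by (intro finite_SigmaI finite_cartesian_product) auto

lemma card_index_set: "card (index_set c J N) =
    (\<Sum>i<J. \<Sum>y\<in>{2..Suc (c i)}. \<Sum>n<N - (Suc i + depth i y). p ^ depth i y * card (nonref n))"
  unfolding index_set_def by (simp add: card_SigmaI card_cartesian_product card_level)

text \<open>
  For each index there is an element of the group whose only nontrivial labels below \<open>1\<^sup>i y\<close> are
  those at \<open>1\<^sup>i y v w\<close> and at the reference vertex. It is trivial below active vertices of smaller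
  depth and uncontrolled below those of larger depth. So the vertices are ordered by the depth of
  the active vertex first and by their level second.
\<close>

lemma two_gen_lower:
  assumes c: "\<And>i. Suc (c i) \<le> p"
  shows "p ^ card (index_set c J N) \<le> card (levelmap N ` two_gen c)"
proof -
  \<comment> \<open>\<open>P t F\<close>: the element \<open>along_ray F\<close> serves the index \<open>t\<close>.\<close>
  define P where "P = (\<lambda>(i, y, n, v, w) F. (\<forall>i y. F i y \<in> auts) \<and> along_ray F \<in> two_gen c \<and>
    earlier_trivial i y F \<and> F i y = graft v (rot_diff n w))"
  have "\<forall>t\<in>index_set c J N. \<exists>F. P t F"
  proof
    fix t assume t: "t \<in> index_set c J N"
    obtain i y n v w where teq: "t = (i, y, n, v, w)" by (cases t)
    have *: "active c i y" "v \<in> words p" "length v = depth i y" "w \<in> level n"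
      using t by (auto simp: teq index_set_def active_def level_def nonref_def)
    have "graft v (rot_diff n w) \<in> tail_group c i y"
      by (rule tail_group_graft[OF *(1-3) rot_diff_derived[OF *(4)]])
    then obtain F where "graft v (rot_diff n w) = F i y" "\<forall>i y. F i y \<in> auts" "along_ray F \<in> two_gen c" "earlier_trivial i y F"
      unfolding tail_group_def by blast
    then have "P t F" unfolding P_def teq by simp
    then show "\<exists>F. P t F" by (rule exI[of "P t"])
  qed
  from bchoice[OF this] obtain Fc where Fc: "\<And>t. t \<in> index_set c J N \<Longrightarrow> P t (Fc t)" by blast
  define vt where "vt = (\<lambda>(i::nat, y::nat, n::nat, v, w). replicate i 1 @ y # v @ w :: nat list)"
  let ?key = "\<lambda>(i, y, n, v::nat list, w::nat list). depth i y * N + n"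
  show ?thesis
  proof (rule triangular_count[where g = "\<lambda>t. along_ray (Fc t)" and vt = vt and key = ?key, OF finite_index_set aut_group_two_gen])
    fix t assume t: "t \<in> index_set c J N"
    obtain i y n v w where teq: "t = (i, y, n, v, w)" by (cases t)
    have t': "2 \<le> y" "y \<le> p" "n < N - (Suc i + depth i y)" "v \<in> words p" "length v = depth i y" "w \<in> words p" "length w = n" "w \<in> nonref n" "w \<in> level n"
      using t c[of i] by (auto simp: teq index_set_def level_def nonref_def)
    have F: "\<And>i y. Fc t i y \<in> auts" "along_ray (Fc t) \<in> two_gen c" "earlier_trivial i y (Fc t)" "Fc t i y = graft v (rot_diff n w)"
      using Fc[OF t] unfolding P_def teq by auto
    show "along_ray (Fc t) \<in> two_gen c" by (rule F(2))
    show "vt t \<in> words p" unfolding vt_def teq using t' replicate_words[of i] by (auto simp: words_def)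
    show "length (vt t) < N" unfolding vt_def teq using t' by auto
    have y1: "y \<noteq> 1" using t' by simp
    show "along_ray (Fc t) (vt t @ [x]) = vt t @ [\<sigma> x]" for x
    proof -
      have "Fc t i y (v @ (w @ [x])) = v @ (w @ [\<sigma> x])"
        unfolding F(4) base_append[OF refl] using rot_diff_move[OF t'(8)] by simp
      then show ?thesis unfolding vt_def teq using along_ray_spine[OF y1, of "Fc t" i "v @ (w @ [x])"] teq by simp
    qed
    fix s x assume s: "s \<in> index_set c J N" and ne: "t \<noteq> s" and key: "?key s \<le> ?key t" and x: "x \<in> {1..p}"
    obtain i' y' n' v' w' where seq: "s = (i', y', n', v', w')" by (cases s)
    have s': "2 \<le> y'" "y' \<le> p" "n' < N - (Suc i' + depth i' y')" "v' \<in> words p" "length v' = depth i' y'" "w' \<in> words p" "length w' = n'" "w' \<in> nonref n'" "w' \<in> level n'"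
      using s c[of i'] by (auto simp: seq index_set_def level_def nonref_def)
    have key': "depth i' y' * N + n' \<le> depth i y * N + n" using key by (simp add: seq teq)
    have nN: "n < N" using t' by simp
    have le: "depth i' y' \<le> depth i y"
    proof (rule ccontr)
      assume "\<not> depth i' y' \<le> depth i y"
      then have "Suc (depth i y) * N \<le> depth i' y' * N" by (intro mult_le_mono1) simp
      then show False using key' nN by simp
    qed
    have "Fc t i' y' (v' @ (w' @ [x])) = v' @ (w' @ [x])"
    proof (cases "depth i' y' < depth i y")
      case True
      have "v' @ w' @ [x] \<in> words p" using s' x by (auto simp: words_def)
      then show ?thesis using F(3) s'(1,2) True unfolding earlier_trivial_def by blast
    next
      case False
      then have "depth i' y' = depth i y" using le by simp
      then have iy: "i' = i" "y' = y" using depth_inj s' t' by blast+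
      then have nn: "n' \<le> n" using key' by simp
      have lv: "length v' = length v" using s' t' iy by simp
      show ?thesis
      proof (cases "v' = v")
        case False
        then show ?thesis unfolding iy F(4) base_append[OF lv] by simp
      next
        case True
        have "w' \<noteq> w" using ne s' t' iy True by (auto simp: teq seq)
        moreover have "w' \<noteq> reference n w"
        proof
          assume r: "w' = reference n w"
          then have "n' = n" using s' reference_level[OF t'(9)] by (simp add: level_def)
          then show False using s'(8) reference_idem[OF t'(9)] r by (simp add: nonref_def)
        qed
        ultimately have "rot_diff n w (w' @ [x]) = w' @ [x]"
          using rot_diff_fix[OF t'(9)] s' nn by simp
        then show ?thesis unfolding iy F(4) base_append[OF lv] using True by simp
      qed
    qed
    moreover have "y' \<noteq> 1" using s' by simp
    ultimately show "along_ray (Fc t) (vt s @ [x]) = vt s @ [x]"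
      unfolding vt_def seq using along_ray_spine[of y' "Fc t" i' "v' @ (w' @ [x])"] by simp
  qed
qed

section \<open>Asymptotics\<close>

lemma nverts_real: "real (nverts n) = (real p ^ n - 1) / (real p - 1)"
  unfolding nverts_def using p_ge_2 by (simp add: geometric_sum)

text \<open>
  With \<open>k = M div 5\<close>, every summand is at most \<open>p ^ (4 * k) \<le> p ^ M / 2 ^ k\<close>, and there are at
  most \<open>5 * k + 5\<close> of them.
\<close>

lemma error_limit: "(\<lambda>M. (\<Sum>n<M. real p ^ (4 * (n div 5))) / real p ^ M) \<longlonglongrightarrow> 0"
proof (rule tendsto_sandwich)
  have p1: "1 \<le> real p" "2 \<le> real p" using p_ge_2 by auto
  show "eventually (\<lambda>M. 0 \<le> (\<Sum>n<M. real p ^ (4 * (n div 5))) / real p ^ M) sequentially"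
    by (intro always_eventually allI divide_nonneg_nonneg sum_nonneg) auto
  show "eventually (\<lambda>M. (\<Sum>n<M. real p ^ (4 * (n div 5))) / real p ^ M
      \<le> 5 * (real (M div 5) * (1 / 2) ^ (M div 5)) + 5 * (1 / 2) ^ (M div 5)) sequentially"
  proof (intro always_eventually allI)
    fix M :: nat
    let ?k = "M div 5"
    have "(\<Sum>n<M. real p ^ (4 * (n div 5))) \<le> (\<Sum>n<M. real p ^ (4 * ?k))"
      using p1 by (intro sum_mono power_increasing mult_le_mono2 div_le_mono) auto
    also have "\<dots> = real M * real p ^ (4 * ?k)" by simp
    finally have 1: "(\<Sum>n<M. real p ^ (4 * (n div 5))) \<le> real M * real p ^ (4 * ?k)" .
    have "real p ^ (4 * ?k) * 2 ^ ?k \<le> real p ^ (4 * ?k) * real p ^ ?k"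
      using p1 by (intro mult_left_mono power_mono) auto
    also have "\<dots> = real p ^ (5 * ?k)" by (simp add: power_add[symmetric])
    also have "\<dots> \<le> real p ^ M" using p1 by (intro power_increasing) auto
    finally have 2: "real p ^ (4 * ?k) * 2 ^ ?k \<le> real p ^ M" .
    have pM: "0 < real p ^ M" using p1 by simp
    have "(\<Sum>n<M. real p ^ (4 * (n div 5))) / real p ^ M \<le> real M * real p ^ (4 * ?k) / real p ^ M"
      using 1 pM by (intro divide_right_mono) auto
    also have "\<dots> \<le> real M * real p ^ (4 * ?k) / (real p ^ (4 * ?k) * 2 ^ ?k)"
      using 2 p1 by (intro divide_left_mono) auto
    also have "\<dots> = real M / 2 ^ ?k" using p1 by simp
    also have "\<dots> \<le> (5 * real ?k + 5) / 2 ^ ?k"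
    proof (rule divide_right_mono)
      have "M \<le> 5 * ?k + 5" by linarith
      then have "real M \<le> real (5 * ?k + 5)" by (rule of_nat_mono)
      then show "real M \<le> 5 * real ?k + 5" by simp
    qed simp
    also have "\<dots> = 5 * (real ?k * (1 / 2) ^ ?k) + 5 * (1 / 2) ^ ?k"
      by (simp add: power_one_over field_simps)
    finally show "(\<Sum>n<M. real p ^ (4 * (n div 5))) / real p ^ M
      \<le> 5 * (real ?k * (1 / 2) ^ ?k) + 5 * (1 / 2) ^ ?k" .
  qed
  have "(\<lambda>k. 5 * (real k * (1 / 2) ^ k) + 5 * (1 / 2) ^ k) \<longlonglongrightarrow> 5 * 0 + 5 * (0::real)"
    by (intro tendsto_intros powser_times_n_limit_0 LIMSEQ_power_zero) auto
  then have "(\<lambda>k. 5 * (real k * (1 / 2) ^ k) + 5 * (1 / 2) ^ k) \<longlonglongrightarrow> (0::real)" by simp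
  moreover have "filterlim (\<lambda>M::nat. M div 5) sequentially sequentially"
    by (rule filterlim_at_top_div_const_nat) simp
  ultimately show "(\<lambda>M. 5 * (real (M div 5) * (1 / 2) ^ (M div 5)) + 5 * (1 / 2) ^ (M div 5)) \<longlonglongrightarrow> (0::real)"
    by (rule filterlim_compose)
qed simp

text \<open>
  The share of one active vertex at height \<open>a\<close> with an odometer of depth \<open>r\<close>: asymptotically
  nothing of the weight \<open>1 / p ^ a\<close> is lost. The index is shifted by \<open>a + r\<close> to get
  rid of the truncated subtraction.
\<close>

lemma block_limit:
  "(\<lambda>N. (\<Sum>n<N - (a + r). real p ^ r * (real p ^ n - real p ^ (4 * (n div 5)))) / real (nverts N))
     \<longlonglongrightarrow> 1 / real p ^ a"
proof (rule LIMSEQ_offset[of _ "a + r"])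
  let ?q = "real p"
  let ?E = "\<lambda>M. (\<Sum>n<M. ?q ^ (4 * (n div 5)))"
  have q: "2 \<le> ?q" using p_ge_2 by simp
  have inv0: "(\<lambda>M. (1 / ?q) ^ M) \<longlonglongrightarrow> 0" using q by (intro LIMSEQ_power_zero) simp
  have "(\<lambda>M. ?q ^ r * ((1 - (1 / ?q) ^ M) - (?q - 1) * (?E M / ?q ^ M)) / (?q ^ (a + r) - (1 / ?q) ^ M))
      \<longlonglongrightarrow> ?q ^ r * ((1 - 0) - (?q - 1) * 0) / (?q ^ (a + r) - 0)"
    using q by (intro tendsto_intros inv0 error_limit) auto
  moreover have "?q ^ r * ((1 - 0) - (?q - 1) * 0) / (?q ^ (a + r) - 0) = 1 / ?q ^ a"
    using q by (simp add: power_add)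
  moreover have "(\<Sum>n<M + (a + r) - (a + r). ?q ^ r * (?q ^ n - ?q ^ (4 * (n div 5)))) / real (nverts (M + (a + r))) =
      ?q ^ r * ((1 - (1 / ?q) ^ M) - (?q - 1) * (?E M / ?q ^ M)) / (?q ^ (a + r) - (1 / ?q) ^ M)" for M
  proof -
    have "(\<Sum>n<M. ?q ^ n) = (?q ^ M - 1) / (?q - 1)" using q by (simp add: geometric_sum)
    then have s: "(\<Sum>n<M. ?q ^ r * (?q ^ n - ?q ^ (4 * (n div 5)))) = ?q ^ r * ((?q ^ M - 1) / (?q - 1) - ?E M)"
      by (simp add: sum_distrib_left[symmetric] sum_subtractf)
    have Q: "0 < ?q ^ M" "0 < ?q - 1" using q by auto
    have "?q ^ r * ((?q ^ M - 1) / (?q - 1) - ?E M) =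
        (?q ^ M / (?q - 1)) * (?q ^ r * ((1 - (1 / ?q) ^ M) - (?q - 1) * (?E M / ?q ^ M)))"
      using Q by (simp add: field_simps power_one_over)
    then have t: "(\<Sum>n<M. ?q ^ r * (?q ^ n - ?q ^ (4 * (n div 5)))) =
        (?q ^ M / (?q - 1)) * (?q ^ r * ((1 - (1 / ?q) ^ M) - (?q - 1) * (?E M / ?q ^ M)))"
      using s by (simp only:)
    have f: "real (nverts (M + (a + r))) = (?q ^ M / (?q - 1)) * (?q ^ (a + r) - (1 / ?q) ^ M)"
      unfolding nverts_real using Q by (simp add: field_simps power_one_over power_add)
    have "?q ^ M / (?q - 1) \<noteq> 0" using Q by simp
    then show ?thesis unfolding add_diff_cancel_right' t f by (rule mult_divide_mult_cancel_left)
  qed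
  ultimately show "(\<lambda>M. (\<Sum>n<M + (a + r) - (a + r). ?q ^ r * (?q ^ n - ?q ^ (4 * (n div 5)))) / real (nverts (M + (a + r)))) \<longlonglongrightarrow> 1 / ?q ^ a"
    by simp
qed

text \<open>
  The sequence whose limit inferior is the dimension of the closure of \<open>two_gen c\<close>.
\<close>

definition ratio :: "(nat \<Rightarrow> nat) \<Rightarrow> nat \<Rightarrow> real" where
  "ratio c N = ln (real (card (levelmap N ` two_gen c))) / (real (nverts N) * ln (real p))"

lemma ratio_ge:
  assumes c: "\<And>i. Suc (c i) \<le> p"
  shows "real (card (index_set c J N)) / real (nverts N) \<le> ratio c N"
proof -
  have lp: "0 < ln (real p)" using p_ge_2 by simp
  have "real (p ^ card (index_set c J N)) \<le> real (card (levelmap N ` two_gen c))"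
    by (rule of_nat_mono[OF two_gen_lower[OF c]])
  then have "ln (real (p ^ card (index_set c J N))) \<le> ln (real (card (levelmap N ` two_gen c)))"
    using p_ge_2 by (intro ln_mono) auto
  then have "real (card (index_set c J N)) * ln (real p) \<le> ln (real (card (levelmap N ` two_gen c)))"
    using p_ge_2 by (simp add: ln_realpow)
  then have "real (card (index_set c J N)) * ln (real p) / (real (nverts N) * ln (real p)) \<le> ratio c N"
    unfolding ratio_def using lp by (intro divide_right_mono) auto
  then show ?thesis using lp by simp
qed

lemma ratio_le:
  assumes sum: "\<And>n. (\<Sum>i<n. real (c i) / real p ^ Suc i) \<le> \<alpha>"
  shows "ratio c N \<le> \<alpha> / (1 - (1 / real p) ^ N)"
proof -
  let ?q = "real p"
  have q: "2 \<le> ?q" using p_ge_2 by simp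
  have lp: "0 < ln ?q" using p_ge_2 by simp
  let ?e = "\<Sum>i<N. c i * nverts (N - Suc i)"
  have "1 \<le> card (levelmap N ` two_gen c)"
    using finite_levelmap_auts[of "two_gen c" N] aut_groupD(1,4)[OF aut_group_two_gen[of c]]
    by (auto simp: Suc_le_eq card_gt_0_iff)
  then have "ln (real (card (levelmap N ` two_gen c))) \<le> ln (real (p ^ ?e))"
    using of_nat_mono[OF two_gen_upper[of N c], where ?'a = real] by (intro ln_mono) auto
  also have "\<dots> = real ?e * ln ?q" using p_ge_2 by (simp add: ln_realpow)
  finally have "ratio c N \<le> real ?e * ln ?q / (real (nverts N) * ln ?q)"
    unfolding ratio_def using lp by (intro divide_right_mono) auto
  then have 1: "ratio c N \<le> real ?e / real (nverts N)" using lp by simp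
  have "real ?e \<le> (\<Sum>i<N. (?q ^ N / (?q - 1)) * (real (c i) / ?q ^ Suc i))"
    unfolding of_nat_sum
  proof (rule sum_mono)
    fix i assume "i \<in> {..<N}"
    then have "?q ^ N = ?q ^ Suc i * ?q ^ (N - Suc i)" unfolding power_add[symmetric] by simp
    then have e: "?q ^ (N - Suc i) = ?q ^ N / ?q ^ Suc i" using q by simp
    have "real (nverts (N - Suc i)) \<le> ?q ^ (N - Suc i) / (?q - 1)"
      unfolding nverts_real using q by (intro divide_right_mono) auto
    then have "real (c i) * real (nverts (N - Suc i)) \<le> real (c i) * (?q ^ (N - Suc i) / (?q - 1))"
      by (intro mult_left_mono) auto
    also have "\<dots> = (?q ^ N / (?q - 1)) * (real (c i) / ?q ^ Suc i)" unfolding e by (simp add: mult_ac)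
    finally show "real (c i * nverts (N - Suc i)) \<le> (?q ^ N / (?q - 1)) * (real (c i) / ?q ^ Suc i)" by simp
  qed
  also have "\<dots> = (?q ^ N / (?q - 1)) * (\<Sum>i<N. real (c i) / ?q ^ Suc i)" by (simp add: sum_distrib_left)
  also have "\<dots> \<le> (?q ^ N / (?q - 1)) * \<alpha>" using sum[of N] q by (intro mult_left_mono) auto
  finally have 2: "real ?e \<le> (?q ^ N / (?q - 1)) * \<alpha>" .
  have K: "?q ^ N / (?q - 1) \<noteq> 0" and f: "real (nverts N) = (?q ^ N / (?q - 1)) * (1 - (1 / ?q) ^ N)"
    unfolding nverts_real using q by (simp_all add: field_simps power_one_over)
  have "real ?e / real (nverts N) \<le> (?q ^ N / (?q - 1)) * \<alpha> / real (nverts N)"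
    using 2 by (intro divide_right_mono) auto
  also have "\<dots> = \<alpha> / (1 - (1 / ?q) ^ N)"
    unfolding f using K by (rule mult_divide_mult_cancel_left)
  finally show ?thesis using 1 by simp
qed

text \<open>
  From below only the finitely many active vertices with \<open>i < J\<close> are taken into account; then \<open>J\<close>
  tends to infinity.
\<close>

lemma liminf_ratio:
  assumes c: "\<And>i. Suc (c i) \<le> p"
    and sum: "\<And>n. (\<Sum>i<n. real (c i) / real p ^ Suc i) \<le> \<alpha>"
    and lim: "(\<lambda>n. \<Sum>i<n. real (c i) / real p ^ Suc i) \<longlonglongrightarrow> \<alpha>"
  shows "liminf (\<lambda>N. ereal (ratio c N)) = ereal \<alpha>"
proof (rule antisym)
  have "(\<lambda>N. \<alpha> / (1 - (1 / real p) ^ N)) \<longlonglongrightarrow> \<alpha> / (1 - 0)"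
    using p_ge_2 by (intro tendsto_intros LIMSEQ_power_zero) auto
  then have up: "(\<lambda>N. ereal (\<alpha> / (1 - (1 / real p) ^ N))) \<longlonglongrightarrow> ereal \<alpha>" by simp
  have "liminf (\<lambda>N. ereal (ratio c N)) \<le> liminf (\<lambda>N. ereal (\<alpha> / (1 - (1 / real p) ^ N)))"
    by (rule Liminf_mono) (simp add: ratio_le[OF sum])
  also have "\<dots> = ereal \<alpha>" using up by (intro lim_imp_Liminf) auto
  finally show "liminf (\<lambda>N. ereal (ratio c N)) \<le> ereal \<alpha>" .
next
  have bound: "ereal (\<Sum>i<J. real (c i) / real p ^ Suc i) \<le> liminf (\<lambda>N. ereal (ratio c N))" for J
  proof -
    define low where "low N = (\<Sum>i<J. \<Sum>y\<in>{2..Suc (c i)}.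
      (\<Sum>n<N - (Suc i + depth i y). real p ^ depth i y * (real p ^ n - real p ^ (4 * (n div 5)))) / real (nverts N))" for N
    have "low N \<le> ratio c N" for N
    proof -
      have "low N = (\<Sum>i<J. \<Sum>y\<in>{2..Suc (c i)}. \<Sum>n<N - (Suc i + depth i y).
          real p ^ depth i y * (real p ^ n - real p ^ (4 * (n div 5)))) / real (nverts N)"
        by (simp only: low_def sum_divide_distrib)
      also have "\<dots> \<le> real (card (index_set c J N)) / real (nverts N)"
      proof (rule divide_right_mono)
        show "(\<Sum>i<J. \<Sum>y\<in>{2..Suc (c i)}. \<Sum>n<N - (Suc i + depth i y).
          real p ^ depth i y * (real p ^ n - real p ^ (4 * (n div 5)))) \<le> real (card (index_set c J N))"
          unfolding card_index_set of_nat_sum of_nat_mult of_nat_power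
          using card_nonref by (intro sum_mono mult_left_mono) auto
      qed simp
      also have "\<dots> \<le> ratio c N" by (rule ratio_ge[OF c])
      finally show ?thesis .
    qed
    moreover have "low \<longlonglongrightarrow> (\<Sum>i<J. \<Sum>y\<in>{2..Suc (c i)}. 1 / real p ^ Suc i)"
      unfolding low_def by (intro tendsto_sum block_limit)
    then have "low \<longlonglongrightarrow> (\<Sum>i<J. real (c i) / real p ^ Suc i)" by simp
    then have "(\<lambda>N. ereal (low N)) \<longlonglongrightarrow> ereal (\<Sum>i<J. real (c i) / real p ^ Suc i)" by simp
    then have "liminf (\<lambda>N. ereal (low N)) = ereal (\<Sum>i<J. real (c i) / real p ^ Suc i)"
      by (intro lim_imp_Liminf) auto
    moreover have "liminf (\<lambda>N. ereal (low N)) \<le> liminf (\<lambda>N. ereal (ratio c N))"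
      using calculation(1) by (intro Liminf_mono) auto
    ultimately show ?thesis by simp
  qed
  have "(\<lambda>n. ereal (\<Sum>i<n. real (c i) / real p ^ Suc i)) \<longlonglongrightarrow> ereal \<alpha>" using lim by simp
  then show "ereal \<alpha> \<le> liminf (\<lambda>N. ereal (ratio c N))"
    by (rule LIMSEQ_le_const2) (use bound in blast)
qed

section \<open>The spectrum\<close>

text \<open>
  The expansion of a positive \<open>\<alpha>\<close> whose partial sums stay strictly below \<open>\<alpha>\<close>, so that
  \<open>\<alpha> = 1\<close> has the digits \<open>p - 1, p - 1, \<dots>\<close>.
\<close>

lemma digits:
  assumes "0 \<le> \<alpha>" "\<alpha> \<le> 1"
  shows "\<exists>c. (\<forall>i. Suc (c i) \<le> p) \<and> (\<forall>n. (\<Sum>i<n. real (c i) / real p ^ Suc i) \<le> \<alpha>) \<and>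
    (\<lambda>n. \<Sum>i<n. real (c i) / real p ^ Suc i) \<longlonglongrightarrow> \<alpha>"
proof (cases "\<alpha> = 0")
  case True
  then show ?thesis using p_ge_2 by (intro exI[of _ "\<lambda>i. 0"]) auto
next
  case False
  let ?q = "real p"
  have q: "2 \<le> ?q" using p_ge_2 by simp
  \<comment> \<open>The largest integer strictly below \<open>p ^ n * \<alpha>\<close>; the digits are the increments.\<close>
  define A where "A n = \<lceil>?q ^ n * \<alpha>\<rceil> - 1" for n :: nat
  have A: "real_of_int (A n) < ?q ^ n * \<alpha>" "?q ^ n * \<alpha> \<le> real_of_int (A n) + 1" for n
    unfolding A_def by linarith+
  have A0: "A 0 = 0" using False assms by (simp add: A_def) linarith
  have step: "int p * A n \<le> A (Suc n)" "A (Suc n) < int p * A n + int p" for n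
  proof -
    have "real_of_int (int p * A n) < ?q ^ Suc n * \<alpha>"
      using mult_strict_left_mono[OF A(1)[of n], of ?q] q by simp
    then have "real_of_int (int p * A n) < real_of_int (A (Suc n)) + 1" using A(2)[of "Suc n"] by linarith
    then show "int p * A n \<le> A (Suc n)" by linarith
    have "?q ^ Suc n * \<alpha> \<le> real_of_int (int p * A n + int p)"
      using mult_left_mono[OF A(2)[of n], of ?q] q by (simp add: algebra_simps)
    then have "real_of_int (A (Suc n)) < real_of_int (int p * A n + int p)" using A(1)[of "Suc n"] by linarith
    then show "A (Suc n) < int p * A n + int p" by linarith
  qed
  define c where "c i = nat (A (Suc i) - int p * A i)" for i
  have cA: "real (c i) = real_of_int (A (Suc i)) - ?q * real_of_int (A i)" for i
    using step(1)[of i] by (simp add: c_def)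
  have partial: "(\<Sum>i<n. real (c i) / ?q ^ Suc i) = real_of_int (A n) / ?q ^ n" for n
  proof (induction n)
    case (Suc n)
    then show ?case using q by (simp add: cA field_simps)
  qed (simp add: A0)
  have le: "real_of_int (A n) / ?q ^ n \<le> \<alpha>" for n
    using A(1)[of n] q by (simp add: field_simps)
  have ge: "\<alpha> - (1 / ?q) ^ n \<le> real_of_int (A n) / ?q ^ n" for n
  proof -
    have "\<alpha> \<le> (real_of_int (A n) + 1) / ?q ^ n"
      using A(2)[of n] q by (simp add: pos_le_divide_eq mult.commute)
    then show ?thesis by (simp add: add_divide_distrib power_one_over)
  qed
  have "(\<lambda>n. real_of_int (A n) / ?q ^ n) \<longlonglongrightarrow> \<alpha>"
  proof (rule tendsto_sandwich)
    show "eventually (\<lambda>n. \<alpha> - (1 / ?q) ^ n \<le> real_of_int (A n) / ?q ^ n) sequentially" using ge by simp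
    show "eventually (\<lambda>n. real_of_int (A n) / ?q ^ n \<le> \<alpha>) sequentially" using le by simp
    have "(\<lambda>n. \<alpha> - (1 / ?q) ^ n) \<longlonglongrightarrow> \<alpha> - 0" using q by (intro tendsto_intros LIMSEQ_power_zero) simp
    then show "(\<lambda>n. \<alpha> - (1 / ?q) ^ n) \<longlonglongrightarrow> \<alpha>" by simp
  qed simp
  moreover have "Suc (c i) \<le> p" for i using step(2)[of i] p_ge_2 by (simp add: c_def)
  ultimately show ?thesis using le partial by (intro exI[of _ c]) simp
qed

lemma hdim_bounds:
  assumes "closed_subgroup p L"
  shows "hdim p L \<in> ereal ` {0..1}"
proof -
  have L: "subgroup L (W p)" using assms by (simp add: closed_subgroup_def)
  let ?r = "\<lambda>n. ln (real (card (levelmap n ` L))) / (nverts n * ln (real p))"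
  have lp: "0 < ln (real p)" using p_ge_2 by simp
  have r: "0 \<le> ?r n \<and> ?r n \<le> 1" for n
  proof -
    have sub: "L \<subseteq> carrier (W p)" using L by (rule subgroup.subset)
    have fW: "finite (levelmap n ` carrier (W p))"
      by (rule finite_levelmap) (rule Aut_level[OF W_Aut])
    have "card (levelmap n ` L) \<le> card (levelmap n ` carrier (W p))"
      using sub fW by (intro card_mono image_mono)
    then have 1: "card (levelmap n ` L) \<le> p ^ nverts n" by (simp add: W_card_level)
    have "levelmap n ` L \<noteq> {}" using subgroup.one_closed[OF L] by blast
    then have 0: "1 \<le> card (levelmap n ` L)"
      using finite_subset[OF image_mono[OF sub] fW] by (simp add: Suc_le_eq card_gt_0_iff)
    have "ln (real (card (levelmap n ` L))) \<le> ln (real (p ^ nverts n))"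
      using 0 of_nat_mono[OF 1, where ?'a = real] by (intro ln_mono) auto
    then have "ln (real (card (levelmap n ` L))) \<le> nverts n * ln (real p)"
      using p_ge_2 by (simp add: ln_realpow)
    moreover have "0 \<le> ln (real (card (levelmap n ` L)))" using 0 by (intro ln_ge_zero) simp
    moreover have "0 < nverts n * ln (real p)" if "nverts n \<noteq> 0"
      using that lp by (intro mult_pos_pos) auto
    ultimately show ?thesis by (cases "nverts n = 0") (auto simp: divide_le_eq_1)
  qed
  have lower: "0 \<le> hdim p L"
    unfolding hdim_eq[OF assms] using r by (intro Liminf_bounded) (auto simp: zero_ereal_def)
  have "hdim p L \<le> liminf (\<lambda>n. ereal 1)"
    unfolding hdim_eq[OF assms] using r by (intro Liminf_mono always_eventually) auto
  then have "hdim p L \<le> 1" by (simp add: Liminf_const one_ereal_def)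
  then show ?thesis using lower by (cases "hdim p L") (auto simp: zero_ereal_def one_ereal_def)
qed

theorem hspec_two: "hspec 2 p = ereal ` {0..1}"
proof
  show "hspec 2 p \<subseteq> ereal ` {0..1}" using hdim_bounds by (auto simp: hspec_def)
  show "ereal ` {0..1} \<subseteq> hspec 2 p"
  proof clarify
    fix \<alpha> :: real assume "\<alpha> \<in> {0..1}"
    then obtain c where c: "\<And>i. Suc (c i) \<le> p" "\<And>n. (\<Sum>i<n. real (c i) / real p ^ Suc i) \<le> \<alpha>"
      "(\<lambda>n. \<Sum>i<n. real (c i) / real p ^ Suc i) \<longlonglongrightarrow> \<alpha>"
      using digits[of \<alpha>] by auto
    let ?T = "{along_ray (odometers c), along_ray (seeds c)}"
    let ?S = "to_W ` ?T"
    define L where "L = Abstract_Topology.closure_of (Aut_tree_topology p) (generate (W p) ?S)"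
    interpret Gr: Group.group "W p" by (rule group_W)
    have S: "?S \<subseteq> carrier (W p)" using to_W_W two_gen_gens_auts by blast
    have gen: "generate (W p) ?S = to_W ` two_gen c" unfolding two_gen_def by (rule generate_to_W[OF two_gen_gens_auts])
    note cl = closure_subgroup[OF Gr.generate_is_subgroup[OF S], folded L_def]
    have "levelmap n ` L = levelmap n ` two_gen c" for n
      unfolding cl(2) gen by (simp add: image_image levelmap_to_W)
    then have "hdim p L = liminf (\<lambda>N. ereal (ratio c N))"
      unfolding hdim_eq[OF cl(1)] ratio_def by simp
    also have "\<dots> = ereal \<alpha>" by (rule liminf_ratio[OF c])
    finally have "hdim p L = ereal \<alpha>" .
    moreover have "card ?S \<le> 2"
      using card_image_le[of ?T to_W] card_insert_le_m1[of 2 "{along_ray (seeds c)}" "along_ray (odometers c)"] by simp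
    moreover have "top_generated_by p L ?S" using S by (simp add: top_generated_by_def L_def)
    ultimately show "ereal \<alpha> \<in> hspec 2 p"
      unfolding hspec_def using cl(1) by (metis (mono_tags, lifting) finite.emptyI finite.insertI finite_imageI mem_Collect_eq)
  qed
qed

end

theorem corollary5:
  fixes p :: nat
  assumes "Factorial_Ring.prime p"
  shows "hspec 2 p = ereal ` {0..1}"
proof -
  interpret padic_tree p using prime_ge_2_nat[OF assms] by unfold_locales
  show ?thesis by (rule hspec_two)
qed

end
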